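(* Let $(Y^3,g_Y)$ be an oriented compact 3-manifold with metric of constant curvature $\kappa\in\{1,0,-1\}$ and let $g=dt^2+g_Y$ be the cylindrical metric on $M=\mathbb{R}\times Y$. Let $\tilde h=\{h_{00},\alpha,h\}$ be a symmetric 2-tensor on $M$ with $\mathrm{tr}_g(\tilde h)=0$. Then the linearization of $\mathcal{W}^-$ at $g$ in the direction $\tilde h$ is given by $$(\mathcal{W}^-)'(h_{00},\alpha,h)=\tfrac12\mathcal{K}_{g_Y}\!\Big(-\tfrac12dh_{00}+\dot\alpha-\tilde{*}d\alpha\Big)-\tfrac12\mathrm{tf}(\ddot h)+\tfrac12\not{d}\,\dot h-E'(h),$$ where $E'(h)$ is the linearization of the traceless Ricci tensor at $g_Y$. Equivalently, after computing $E'(h)$ explicitly, $$(\mathcal{W}^-)'(h_{00},\alpha,h)=\tfrac12\mathcal{K}_{g_Y}\!\Big(-\tfrac12dh_{00}-\delta_Yh+\dot\alpha-\tilde{*}d\alpha+\tfrac12d\,\mathrm{tr}_Y(h)\Big)-\tfrac12\mathrm{tf}(\ddot h)-\kappa\,\mathrm{tf}(h)+\tfrac12\not{d}\,\dot h+\tfrac12\Delta_{g_Y}\mathrm{tf}(h).$$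
   Context: $M=\mathbb{R}\times Y$ is oriented by $dt\wedge dV_Y$; dots denote $\partial_t$; $d$, $\nabla$ in the formulas are on $Y$. A symmetric 2-tensor on $M$ is written $\tilde h=h_{00}\,dt\otimes dt+(\alpha\otimes dt+dt\otimes\alpha)+h=\{h_{00},\alpha,h\}$ with $h_{00}$ a function, $\alpha$ a ($t$-dependent) 1-form on $Y$, $h$ a ($t$-dependent) symmetric 2-tensor on $Y$. $\tilde{*}$ is the Hodge star of $(Y,g_Y)$; self-dual (anti-self-dual) 2-forms on $M$ are those of the form $dt\wedge\xi+\tilde{*}\xi$ (resp. $dt\wedge\xi-\tilde{*}\xi$). The anti-self-dual Weyl operator $\mathcal{W}^-$ (the Weyl operator on 2-forms projected to $\Lambda^2_-$) is identified with a section of $S^2_0(T^*Y)$: in a local oriented orthonormal frame $e_1,e_2,e_3$ of $Y$, $(\mathcal{W}^-)_{ij}=\langle\mathcal{W}^-(dt\wedge e_i-\tilde{*}e_i),\,dt\wedge e_j-\tilde{*}e_j\rangle$, with $dt\wedge e_i$ of unit norm; a curvature-type tensor $P_{ijkl}$ acts on 2-forms by $(\mathcal{P}\omega)_{ij}=\frac12\sum_{k,l}P_{ijkl}\omega_{kl}$, with sign convention $\mathrm{Ric}_{ab}=g^{cd}R_{acbd}$. $(\delta_Yh)_j=\nabla^ih_{ij}$, $\delta_Y\omega=\nabla^i\omega_i$, $\mathrm{tr}_Y$ is the $g_Y$-trace, $\mathrm{tf}(h)=h-\frac13\mathrm{tr}_Y(h)g_Y$, $\Delta_{g_Y}$ is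 the rough Laplacian, $\mathcal{L}_{g_Y}(\omega)_{ij}=\nabla_i\omega_j+\nabla_j\omega_i$, $\mathcal{K}_{g_Y}(\omega)=\mathcal{L}_{g_Y}(\omega)-\frac23(\delta_Y\omega)g_Y$. The Dirac-type operator $\not{d}$ on symmetric 2-tensors on $Y$ is, in a local oriented orthonormal frame, $(\not{d}h)_{ij}=\mathrm{Sym}_{ij}\big(\sum_{k,l}\epsilon_{ikl}(\nabla_kh_{lj}-\nabla_lh_{kj})\big)$, with $\mathrm{Sym}_{ij}(F)=\frac12(F_{ij}+F_{ji})$ and $\epsilon_{ijk}$ the components of the volume form. *)

theory Defs
  imports "HOL-Analysis.Analysis"
begin

text \<open>Only used on open sets, where all iterated directional derivatives are then continuous.\<close>

primrec Ck_on :: "nat \<Rightarrow> 'a::euclidean_space set \<Rightarrow> ('a \<Rightarrow> 'b::real_normed_vector) \<Rightarrow> bool" where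
  "Ck_on 0 S f \<longleftrightarrow> continuous_on S f"
| "Ck_on (Suc k) S f \<longleftrightarrow>
     f differentiable_on S \<and> (\<forall>v. Ck_on k S (\<lambda>x. frechet_derivative f (at x) v))"

definition smooth_on :: "'a::euclidean_space set \<Rightarrow> ('a \<Rightarrow> 'b::real_normed_vector) \<Rightarrow> bool" where
  "smooth_on S f \<longleftrightarrow> (\<forall>k. Ck_on k S f)"

text \<open>A chart is a pair of its domain and its coordinate map. The values of the coordinate map
  outside the domain are irrelevant. Coordinates are indexed by an arbitrary finite type.\<close>

type_synonym ('m, 'n) chart = "'m set \<times> ('m \<Rightarrow> real^'n)"

definition chart_image :: "('m, 'n::finite) chart \<Rightarrow> (real^'n) set" where
  "chart_image c = snd c ` fst c"

definition chart_inv :: "('m, 'n::finite) chart \<Rightarrow> real^'n \<Rightarrow> 'm" where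
  "chart_inv c = inv_into (fst c) (snd c)"

definition is_chart :: "('m::topological_space, 'n::finite) chart \<Rightarrow> bool" where
  "is_chart c \<longleftrightarrow> open (fst c) \<and> open (chart_image c) \<and>
     homeomorphism (fst c) (chart_image c) (snd c) (chart_inv c)"

definition transition :: "('m, 'n::finite) chart \<Rightarrow> ('m, 'n) chart \<Rightarrow> real^'n \<Rightarrow> real^'n" where
  "transition c c' = snd c' \<circ> chart_inv c"

definition jacobian_at :: "('m, 'n::finite) chart \<Rightarrow> ('m, 'n) chart \<Rightarrow> real^'n \<Rightarrow> real^'n^'n" where
  "jacobian_at c c' x = matrix (frechet_derivative (transition c c') (at x))"

text \<open>The whole type is the manifold. It is Hausdorff by its type class where this notion is
  used; second countability is automatic for compact manifolds.\<close>

definition oriented_atlas :: "('m::t2_space, 'n::finite) chart set \<Rightarrow> bool" where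
  "oriented_atlas A \<longleftrightarrow>
     (\<forall>c\<in>A. is_chart c) \<and> (\<Union>c\<in>A. fst c) = UNIV \<and>
     (\<forall>c\<in>A. \<forall>c'\<in>A.
        smooth_on (snd c ` (fst c \<inter> fst c')) (transition c c') \<and>
        (\<forall>x\<in>snd c ` (fst c \<inter> fst c'). det (jacobian_at c c' x) > 0))"

text \<open>A covariant 2-tensor field is given by its matrix of components \<open>T c x $ i $ j\<close> in each
  chart \<open>c\<close> of the atlas, as a function of the coordinates \<open>x\<close>, subject to the transformation
  law on overlaps.\<close>

definition symmetric_2tensor ::
  "('m, 'n::finite) chart set \<Rightarrow> (('m, 'n) chart \<Rightarrow> real^'n \<Rightarrow> real^'n^'n) \<Rightarrow> bool" where
  "symmetric_2tensor A T \<longleftrightarrow>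
     (\<forall>c\<in>A. smooth_on (chart_image c) (T c) \<and>
            (\<forall>x\<in>chart_image c. transpose (T c x) = T c x)) \<and>
     (\<forall>c\<in>A. \<forall>c'\<in>A. \<forall>p\<in>fst c \<inter> fst c'.
        T c (snd c p) =
          transpose (jacobian_at c c' (snd c p)) ** T c' (snd c' p) ** jacobian_at c c' (snd c p))"

definition riemannian_metric ::
  "('m, 'n::finite) chart set \<Rightarrow> (('m, 'n) chart \<Rightarrow> real^'n \<Rightarrow> real^'n^'n) \<Rightarrow> bool" where
  "riemannian_metric A g \<longleftrightarrow> symmetric_2tensor A g \<and>
     (\<forall>c\<in>A. \<forall>x\<in>chart_image c. \<forall>v. v \<noteq> 0 \<longrightarrow> v \<bullet> (g c x *v v) > 0)"

text \<open>From here on \<open>g\<close> is the matrix field of a metric in one chart, and \<open>G\<close> its value at a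
  point.\<close>

definition pd :: "'n \<Rightarrow> (real^'n::finite \<Rightarrow> 'b::real_normed_vector) \<Rightarrow> real^'n \<Rightarrow> 'b" where
  "pd k f x = frechet_derivative f (at x) (axis k 1)"

text \<open>\<open>christoffel g x k i j\<close> is $\Gamma^k_{ij}$.\<close>

definition christoffel ::
  "(real^'n::finite \<Rightarrow> real^'n^'n) \<Rightarrow> real^'n \<Rightarrow> 'n \<Rightarrow> 'n \<Rightarrow> 'n \<Rightarrow> real" where
  "christoffel g x k i j =
     (\<Sum>l\<in>UNIV. matrix_inv (g x) $ k $ l * (pd i g x $ j $ l + pd j g x $ i $ l - pd l g x $ i $ j)) / 2"

text \<open>\<open>curv_endo g x i j k l\<close> is the \<open>l\<close>-th component of
  $R(\partial_i,\partial_j)\partial_k = \nabla_i\nabla_j\partial_k - \nabla_j\nabla_i\partial_k$.\<close>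

definition curv_endo ::
  "(real^'n::finite \<Rightarrow> real^'n^'n) \<Rightarrow> real^'n \<Rightarrow> 'n \<Rightarrow> 'n \<Rightarrow> 'n \<Rightarrow> 'n \<Rightarrow> real" where
  "curv_endo g x i j k l =
     pd i (\<lambda>y. christoffel g y l j k) x - pd j (\<lambda>y. christoffel g y l i k) x +
     (\<Sum>m\<in>UNIV. christoffel g x m j k * christoffel g x l i m
              - christoffel g x m i k * christoffel g x l j m)"

text \<open>$R_{ijkl} = g(R(\partial_i,\partial_j)\partial_l,\partial_k)$, so that $R_{ijij}$ is
  positive on spheres.\<close>

definition riemann ::
  "(real^'n::finite \<Rightarrow> real^'n^'n) \<Rightarrow> real^'n \<Rightarrow> 'n \<Rightarrow> 'n \<Rightarrow> 'n \<Rightarrow> 'n \<Rightarrow> real" where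
  "riemann g x i j k l = (\<Sum>m\<in>UNIV. g x $ k $ m * curv_endo g x i j l m)"

definition sectional_curvature ::
  "(real^'n::finite \<Rightarrow> real^'n^'n) \<Rightarrow> real^'n \<Rightarrow> real^'n \<Rightarrow> real^'n \<Rightarrow> real" where
  "sectional_curvature g x u v =
     (\<Sum>i\<in>UNIV. \<Sum>j\<in>UNIV. \<Sum>k\<in>UNIV. \<Sum>l\<in>UNIV. riemann g x i j k l * u $ i * v $ j * u $ k * v $ l)
     / ((u \<bullet> (g x *v u)) * (v \<bullet> (g x *v v)) - (u \<bullet> (g x *v v))\<^sup>2)"

definition constant_curvature ::
  "('m, 'n::finite) chart set \<Rightarrow> (('m, 'n) chart \<Rightarrow> real^'n \<Rightarrow> real^'n^'n) \<Rightarrow> real \<Rightarrow> bool" where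
  "constant_curvature A g \<kappa> \<longleftrightarrow>
     (\<forall>c\<in>A. \<forall>x\<in>chart_image c. \<forall>u v. u \<noteq> v \<and> independent {u, v} \<longrightarrow>
        sectional_curvature (g c) x u v = \<kappa>)"

definition ricci :: "(real^'n::finite \<Rightarrow> real^'n^'n) \<Rightarrow> real^'n \<Rightarrow> real^'n^'n" where
  "ricci g x = (\<chi> a b. \<Sum>c\<in>UNIV. \<Sum>d\<in>UNIV. matrix_inv (g x) $ c $ d * riemann g x a c b d)"

definition mtrace :: "real^'n^'n \<Rightarrow> real^'n^'n \<Rightarrow> real" where
  "mtrace G T = (\<Sum>i\<in>UNIV. \<Sum>j\<in>UNIV. matrix_inv G $ i $ j * T $ i $ j)"

definition tf :: "real^'n^'n \<Rightarrow> real^'n^'n \<Rightarrow> real^'n^'n" where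
  "tf G T = T - (mtrace G T / real CARD('n)) *\<^sub>R G"

definition scalar_curvature :: "(real^'n::finite \<Rightarrow> real^'n^'n) \<Rightarrow> real^'n \<Rightarrow> real" where
  "scalar_curvature g x = mtrace (g x) (ricci g x)"

definition traceless_ricci :: "(real^'n::finite \<Rightarrow> real^'n^'n) \<Rightarrow> real^'n \<Rightarrow> real^'n^'n" where
  "traceless_ricci g x = ricci g x - (scalar_curvature g x / real CARD('n)) *\<^sub>R g x"

definition weyl ::
  "(real^'n::finite \<Rightarrow> real^'n^'n) \<Rightarrow> real^'n \<Rightarrow> 'n \<Rightarrow> 'n \<Rightarrow> 'n \<Rightarrow> 'n \<Rightarrow> real" where
  "weyl g x i j k l = riemann g x i j k l
     - (ricci g x $ i $ k * g x $ j $ l - ricci g x $ i $ l * g x $ j $ k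
        + ricci g x $ j $ l * g x $ i $ k - ricci g x $ j $ k * g x $ i $ l) / (real CARD('n) - 2)
     + scalar_curvature g x * (g x $ i $ k * g x $ j $ l - g x $ i $ l * g x $ j $ k)
        / ((real CARD('n) - 1) * (real CARD('n) - 2))"

text \<open>A 2-form at a point is its antisymmetric matrix of components, normalised so that
  $(\xi\wedge\eta)_{ab} = \xi_a\eta_b - \xi_b\eta_a$. The inner product makes
  $\epsilon^a\wedge\epsilon^b$ a unit vector for an orthonormal coframe.\<close>

definition form_inner :: "real^'n^'n \<Rightarrow> real^'n^'n \<Rightarrow> real^'n^'n \<Rightarrow> real" where
  "form_inner G \<omega> \<eta> =
     (\<Sum>a\<in>UNIV. \<Sum>b\<in>UNIV. \<Sum>p\<in>UNIV. \<Sum>q\<in>UNIV.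
        matrix_inv G $ a $ p * matrix_inv G $ b $ q * \<omega> $ a $ b * \<eta> $ p $ q) / 2"

definition weyl_operator ::
  "(real^'n::finite \<Rightarrow> real^'n^'n) \<Rightarrow> real^'n \<Rightarrow> real^'n^'n \<Rightarrow> real^'n^'n" where
  "weyl_operator g x \<omega> = (\<chi> i j.
     (\<Sum>k\<in>UNIV. \<Sum>l\<in>UNIV. \<Sum>p\<in>UNIV. \<Sum>q\<in>UNIV.
        weyl g x i j k l * matrix_inv (g x) $ k $ p * matrix_inv (g x) $ l $ q * \<omega> $ p $ q) / 2)"

text \<open>Covariant derivatives: \<open>cov1 g w x $ i $ j\<close> is $\nabla_i w_j$, \<open>cov2 g T x $ k $ i $ j\<close> is
  $\nabla_k T_{ij}$, and \<open>cov3 g S x k l i j\<close> is $\nabla_k S_{lij}$.\<close>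

definition cov1 :: "(real^'n::finite \<Rightarrow> real^'n^'n) \<Rightarrow> (real^'n \<Rightarrow> real^'n) \<Rightarrow> real^'n \<Rightarrow> real^'n^'n" where
  "cov1 g w x = (\<chi> i j. pd i w x $ j - (\<Sum>m\<in>UNIV. christoffel g x m i j * w x $ m))"

definition cov2 ::
  "(real^'n::finite \<Rightarrow> real^'n^'n) \<Rightarrow> (real^'n \<Rightarrow> real^'n^'n) \<Rightarrow> real^'n \<Rightarrow> real^'n^'n^'n" where
  "cov2 g T x = (\<chi> k i j. pd k T x $ i $ j
     - (\<Sum>m\<in>UNIV. christoffel g x m k i * T x $ m $ j + christoffel g x m k j * T x $ i $ m))"

definition cov3 ::
  "(real^'n::finite \<Rightarrow> real^'n^'n) \<Rightarrow> (real^'n \<Rightarrow> real^'n^'n^'n) \<Rightarrow> real^'n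
     \<Rightarrow> 'n \<Rightarrow> 'n \<Rightarrow> 'n \<Rightarrow> 'n \<Rightarrow> real" where
  "cov3 g S x k l i j = pd k S x $ l $ i $ j
     - (\<Sum>m\<in>UNIV. christoffel g x m k l * S x $ m $ i $ j + christoffel g x m k i * S x $ l $ m $ j
              + christoffel g x m k j * S x $ l $ i $ m)"

definition rough_laplacian ::
  "(real^'n::finite \<Rightarrow> real^'n^'n) \<Rightarrow> (real^'n \<Rightarrow> real^'n^'n) \<Rightarrow> real^'n \<Rightarrow> real^'n^'n" where
  "rough_laplacian g T x =
     (\<chi> i j. \<Sum>k\<in>UNIV. \<Sum>l\<in>UNIV. matrix_inv (g x) $ k $ l * cov3 g (cov2 g T) x k l i j)"

definition div1 :: "(real^'n::finite \<Rightarrow> real^'n^'n) \<Rightarrow> (real^'n \<Rightarrow> real^'n) \<Rightarrow> real^'n \<Rightarrow> real" where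
  "div1 g w x = (\<Sum>i\<in>UNIV. \<Sum>k\<in>UNIV. matrix_inv (g x) $ i $ k * cov1 g w x $ k $ i)"

definition div2 ::
  "(real^'n::finite \<Rightarrow> real^'n^'n) \<Rightarrow> (real^'n \<Rightarrow> real^'n^'n) \<Rightarrow> real^'n \<Rightarrow> real^'n" where
  "div2 g T x = (\<chi> j. \<Sum>i\<in>UNIV. \<Sum>k\<in>UNIV. matrix_inv (g x) $ i $ k * cov2 g T x $ k $ i $ j)"

definition lie_op ::
  "(real^'n::finite \<Rightarrow> real^'n^'n) \<Rightarrow> (real^'n \<Rightarrow> real^'n) \<Rightarrow> real^'n \<Rightarrow> real^'n^'n" where
  "lie_op g w x = (\<chi> i j. cov1 g w x $ i $ j + cov1 g w x $ j $ i)"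

definition conformal_killing ::
  "(real^3 \<Rightarrow> real^3^3) \<Rightarrow> (real^3 \<Rightarrow> real^3) \<Rightarrow> real^3 \<Rightarrow> real^3^3" where
  "conformal_killing g w x = lie_op g w x - (2/3 * div1 g w x) *\<^sub>R g x"

definition d0 :: "(real^'n::finite \<Rightarrow> real) \<Rightarrow> real^'n \<Rightarrow> real^'n" where
  "d0 f x = (\<chi> i. pd i f x)"

definition d1 :: "(real^'n::finite \<Rightarrow> real^'n) \<Rightarrow> real^'n \<Rightarrow> real^'n^'n" where
  "d1 w x = (\<chi> i j. pd i w x $ j - pd j w x $ i)"

definition levi3 :: "3 \<Rightarrow> 3 \<Rightarrow> 3 \<Rightarrow> real" where
  "levi3 i j k = det (vector [axis i 1, axis j 1, axis k 1] :: real^3^3)"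

text \<open>Hodge stars of 1-forms and of 2-forms; the volume form has components
  \<open>sqrt (det G) * levi3 i j k\<close> in the charts of an oriented atlas.\<close>

definition star1 :: "real^3^3 \<Rightarrow> real^3 \<Rightarrow> real^3^3" where
  "star1 G \<xi> = (\<chi> k l. sqrt (det G) *
     (\<Sum>i\<in>UNIV. \<Sum>p\<in>UNIV. matrix_inv G $ i $ p * \<xi> $ p * levi3 i k l))"

definition star2 :: "real^3^3 \<Rightarrow> real^3^3 \<Rightarrow> real^3" where
  "star2 G \<omega> = (\<chi> i. sqrt (det G) / 2 *
     (\<Sum>k\<in>UNIV. \<Sum>l\<in>UNIV. \<Sum>p\<in>UNIV. \<Sum>q\<in>UNIV.
        matrix_inv G $ k $ p * matrix_inv G $ l $ q * \<omega> $ p $ q * levi3 k l i))"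

text \<open>The rows \<open>e $ 1\<close>, \<open>e $ 2\<close>, \<open>e $ 3\<close> are the values of a frame at a point, in the
  coordinates of a chart of an oriented atlas.\<close>

definition oriented_orthonormal :: "real^3^3 \<Rightarrow> real^3^3 \<Rightarrow> bool" where
  "oriented_orthonormal G e \<longleftrightarrow>
     (\<forall>i j. e $ i \<bullet> (G *v (e $ j)) = (if i = j then 1 else 0)) \<and> det e > 0"

definition frame_comp :: "real^3^3 \<Rightarrow> real^3^3 \<Rightarrow> real^3^3" where
  "frame_comp e T = (\<chi> i j. e $ i \<bullet> (T *v (e $ j)))"

text \<open>Components of the Dirac-type operator in an oriented orthonormal frame, where the volume
  form has components \<open>levi3 i j k\<close>; \<open>N k l j\<close> is $\nabla_k h_{lj}$ in the frame.\<close>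

definition dslash_frame ::
  "(real^3 \<Rightarrow> real^3^3) \<Rightarrow> (real^3 \<Rightarrow> real^3^3) \<Rightarrow> real^3 \<Rightarrow> real^3^3 \<Rightarrow> real^3^3" where
  "dslash_frame g h x e =
     (let N = (\<lambda>k l j. \<Sum>a\<in>UNIV. \<Sum>b\<in>UNIV. \<Sum>c\<in>UNIV.
                  cov2 g h x $ a $ b $ c * e $ k $ a * e $ l $ b * e $ j $ c);
          F = (\<lambda>i j. \<Sum>k\<in>UNIV. \<Sum>l\<in>UNIV. levi3 i k l * (N k l j - N l k j))
      in \<chi> i j. (F i j + F j i) / 2)"

text \<open>Coordinates on $\mathbb{R}\times Y$ are indexed by \<open>3 option\<close>, with \<open>None\<close> the index
  of $t$ and \<open>Some i\<close> those of $Y$.\<close>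

definition cyl_point :: "real \<Rightarrow> real^'n \<Rightarrow> real^('n option)" where
  "cyl_point t x = (\<chi> a. case a of None \<Rightarrow> t | Some i \<Rightarrow> x $ i)"

definition cyl_chart :: "('m, 'n::finite) chart \<Rightarrow> (real \<times> 'm, 'n option) chart" where
  "cyl_chart c = (UNIV \<times> fst c, \<lambda>(t, p). cyl_point t (snd c p))"

definition cyl_atlas :: "('m, 'n::finite) chart set \<Rightarrow> (real \<times> 'm, 'n option) chart set" where
  "cyl_atlas A = cyl_chart ` A"

definition cyl_metric ::
  "(real^'n::finite \<Rightarrow> real^'n^'n) \<Rightarrow> real^('n option) \<Rightarrow> real^('n option)^('n option)" where
  "cyl_metric g X = (\<chi> a b. case a of
       None \<Rightarrow> (case b of None \<Rightarrow> 1 | Some j \<Rightarrow> 0)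
     | Some i \<Rightarrow> (case b of None \<Rightarrow> 0 | Some j \<Rightarrow> g (\<chi> k. X $ Some k) $ i $ j))"

text \<open>The parts $h_{00}$, $\alpha$, $h$ of a symmetric 2-tensor on the cylinder, as
  $t$-dependent tensors on $Y$, and the derivative $\partial_t$ of such tensors.\<close>

definition part00 ::
  "(real^('n::finite option) \<Rightarrow> real^('n option)^('n option)) \<Rightarrow> real \<Rightarrow> real^'n \<Rightarrow> real" where
  "part00 H t x = H (cyl_point t x) $ None $ None"

definition part0Y ::
  "(real^('n::finite option) \<Rightarrow> real^('n option)^('n option)) \<Rightarrow> real \<Rightarrow> real^'n \<Rightarrow> real^'n" where
  "part0Y H t x = (\<chi> i. H (cyl_point t x) $ None $ Some i)"

definition partYY ::
  "(real^('n::finite option) \<Rightarrow> real^('n option)^('n option)) \<Rightarrow> real \<Rightarrow> real^'n \<Rightarrow> real^'n^'n" where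
  "partYY H t x = (\<chi> i j. H (cyl_point t x) $ Some i $ Some j)"

definition dot :: "(real \<Rightarrow> real^'n \<Rightarrow> 'b::real_normed_vector) \<Rightarrow> real \<Rightarrow> real^'n \<Rightarrow> 'b" where
  "dot F t x = vector_derivative (\<lambda>s. F s x) (at t)"

text \<open>The rows are ordered as $t$, $x^1$, $x^2$, $x^3$, so that the Hodge star below is the one
  of the orientation $dt\wedge dV_Y$.\<close>

definition levi4 :: "3 option \<Rightarrow> 3 option \<Rightarrow> 3 option \<Rightarrow> 3 option \<Rightarrow> real" where
  "levi4 a b c d = det ((\<chi> r. case r of None \<Rightarrow> axis a 1
     | Some m \<Rightarrow> (vector [axis b 1, axis c 1, axis d 1] :: real^(3 option)^3) $ m)
       :: real^(3 option)^(3 option))"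

definition hodge4 ::
  "real^(3 option)^(3 option) \<Rightarrow> real^(3 option)^(3 option) \<Rightarrow> real^(3 option)^(3 option)" where
  "hodge4 G \<omega> = (\<chi> c d. sqrt (det G) / 2 *
     (\<Sum>a\<in>UNIV. \<Sum>b\<in>UNIV. \<Sum>p\<in>UNIV. \<Sum>q\<in>UNIV.
        matrix_inv G $ a $ p * matrix_inv G $ b $ q * \<omega> $ p $ q * levi4 a b c d))"

definition asd_part ::
  "real^(3 option)^(3 option) \<Rightarrow> real^(3 option)^(3 option) \<Rightarrow> real^(3 option)^(3 option)" where
  "asd_part G \<omega> = (1/2) *\<^sub>R (\<omega> - hodge4 G \<omega>)"

text \<open>The anti-self-dual Weyl operator of an arbitrary metric \<open>g\<close> on the cylinder: the block of
  the Weyl operator on the forms that are anti-self-dual for \<open>g\<close>.\<close>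

definition asd_weyl_operator ::
  "(real^(3 option) \<Rightarrow> real^(3 option)^(3 option)) \<Rightarrow> real^(3 option)
     \<Rightarrow> real^(3 option)^(3 option) \<Rightarrow> real^(3 option)^(3 option)" where
  "asd_weyl_operator g X \<omega> = asd_part (g X) (weyl_operator g X (asd_part (g X) \<omega>))"

text \<open>The 2-form $dt\wedge\xi - \tilde{*}\xi$.\<close>

definition asd_form :: "real^3^3 \<Rightarrow> real^3 \<Rightarrow> real^(3 option)^(3 option)" where
  "asd_form G \<xi> = (\<chi> a b. case a of
       None \<Rightarrow> (case b of None \<Rightarrow> 0 | Some j \<Rightarrow> \<xi> $ j)
     | Some i \<Rightarrow> (case b of None \<Rightarrow> - \<xi> $ i | Some j \<Rightarrow> - star1 G \<xi> $ i $ j))"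

text \<open>The matrix of $\mathcal{W}^-$ of a metric \<open>g'\<close> on the cylinder, read as a symmetric tensor
  on \<open>Y\<close> at the point \<open>(t, x)\<close>, in a frame \<open>e\<close> that is orthonormal for the metric \<open>g\<close> of \<open>Y\<close>.
  The forms and the inner product used for this identification are those of the cylindrical metric
  and stay fixed when \<open>g'\<close> is varied. The frame acts as a coframe through \<open>g\<close>.\<close>

definition asd_weyl_frame ::
  "(real^3 \<Rightarrow> real^3^3) \<Rightarrow> real \<Rightarrow> real^3 \<Rightarrow> real^3^3
     \<Rightarrow> (real^(3 option) \<Rightarrow> real^(3 option)^(3 option)) \<Rightarrow> real^3^3" where
  "asd_weyl_frame g t x e g' = (\<chi> i j.
     form_inner (cyl_metric g (cyl_point t x))
       (asd_weyl_operator g' (cyl_point t x) (asd_form (g x) (g x *v (e $ i))))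
       (asd_form (g x) (g x *v (e $ j))))"

text \<open>For \<open>F\<close> depending on a metric, the derivative of \<open>F (g + s h)\<close> at \<open>s = 0\<close>. All uses of
  \<open>F\<close> below are values at a point of local expressions in the metric, so only the fact that
  \<open>g + s h\<close> is a metric near that point for small \<open>s\<close> matters.\<close>

definition has_linearization ::
  "(('a \<Rightarrow> 'b::real_normed_vector) \<Rightarrow> 'c::real_normed_vector)
     \<Rightarrow> ('a \<Rightarrow> 'b) \<Rightarrow> ('a \<Rightarrow> 'b) \<Rightarrow> 'c \<Rightarrow> bool" where
  "has_linearization F g h D \<longleftrightarrow> ((\<lambda>s::real. F (\<lambda>y. g y + s *\<^sub>R h y)) has_vector_derivative D) (at 0)"

definition linearization ::
  "(('a \<Rightarrow> 'b::real_normed_vector) \<Rightarrow> 'c::real_normed_vector)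
     \<Rightarrow> ('a \<Rightarrow> 'b) \<Rightarrow> ('a \<Rightarrow> 'b) \<Rightarrow> 'c" where
  "linearization F g h = vector_derivative (\<lambda>s::real. F (\<lambda>y. g y + s *\<^sub>R h y)) (at 0)"

end

theory Submission
  imports Defs
begin

text \<open>
  The curvature of a metric at a point depends on its 2-jet there only, so linearization is a
  derivative in one real parameter. It gives the covariant formula
  $R'_{ijkl} = \sum_m h_{km} R_{ijl}{}^m + \nabla_i C_{jlk} - \nabla_j C_{ilk}$ with
  $2C_{jlk} = \nabla_j h_{lk} + \nabla_l h_{jk} - \nabla_k h_{jl}$, valid in every dimension.

  The cylinder over a space form is conformally flat. Hence the Weyl operator vanishes at the
  background metric, and the variation of the projections to anti-self-dual forms contributes
  nothing: the derivative of $\mathcal{W}^-$ is the pairing of the linearized Weyl tensor with the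
  fixed forms $dt\wedge e_i - \tilde{*}e_i$. In an orthonormal frame both sides become linear
  expressions in the components of $\nabla\nabla\tilde h$ and $\kappa\tilde h$; all differential operators
  of $Y$ that occur are contractions of $\nabla\nabla\tilde h$, because the metric and the volume form are
  parallel. They agree modulo the commutators of covariant derivatives, which the
  constant curvature turns into $\kappa\tilde h$-terms.
\<close>

section \<open>Partial derivatives\<close>

text \<open>The identity is proved at one point of one chart, with a frame that is a constant matrix
  at that point: covariant derivatives are formed in coordinates and contracted with the frame
  afterwards, so a frame is never differentiated. The curvature is linearized in arbitrary dimension
  because this is used twice, on the cylinder for the Weyl tensor and on Y for E'(h). What links the
  two is that the Christoffel symbols of the cylinder with an index in the direction of t vanish;
  derivatives in t and covariant derivatives on Y are then components of one object, the second
  covariant derivative on the cylinder. The obstacle is the final comparison: second covariant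
  derivatives commute only up to curvature, so expressions can be compared only with their
  derivatives in the same order. The frame components are therefore rewritten to a normal form with
  sorted indices, in which each of the nine entries is an identity of linear expressions. Both
  formulas are compared with one such expression; they differ by the explicit form of E'(h).\<close>

lemma has_real_derivative_along_line:
  fixes f :: "'a::euclidean_space \<Rightarrow> real"
  assumes "f differentiable (at (y + s *\<^sub>R u))"
  shows "((\<lambda>r. f (y + r *\<^sub>R u)) has_real_derivative frechet_derivative f (at (y + s *\<^sub>R u)) u) (at s)"
proof -
  have "(f has_derivative frechet_derivative f (at (y + s *\<^sub>R u))) (at (y + s *\<^sub>R u))"
    using assms frechet_derivative_works by blast
  then have "((\<lambda>r. f (y + r *\<^sub>R u)) has_derivative
      (\<lambda>r. frechet_derivative f (at (y + s *\<^sub>R u)) (r *\<^sub>R u))) (at s)"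
    by (rule has_derivative_compose[rotated]) (auto intro!: derivative_eq_intros)
  moreover have "(\<lambda>r. frechet_derivative f (at (y + s *\<^sub>R u)) (r *\<^sub>R u)) =
      (*) (frechet_derivative f (at (y + s *\<^sub>R u)) u)"
    using linear_frechet_derivative[OF assms] by (auto simp: linear_scale)
  ultimately show ?thesis by (simp add: has_field_derivative_def)
qed

text \<open>The mean value theorem is applied in the direction u to the increment of f along
  \<open>h *\<^sub>R v\<close>, and then in the direction v to the derivative along u. The left side
  is symmetric in u and v, which the next lemma exploits.\<close>

lemma second_difference_mean_value:
  fixes f :: "'a::euclidean_space \<Rightarrow> real"
  assumes h: "0 < h"
    and S: "\<And>s r. 0 \<le> s \<Longrightarrow> s \<le> h \<Longrightarrow> 0 \<le> r \<Longrightarrow> r \<le> h \<Longrightarrow> x + s *\<^sub>R u + r *\<^sub>R v \<in> S"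
    and f: "\<And>y. y \<in> S \<Longrightarrow> f differentiable (at y)"
    and fu: "\<And>y. y \<in> S \<Longrightarrow> (\<lambda>y. frechet_derivative f (at y) u) differentiable (at y)"
  obtains s r where "0 < s" "s < h" "0 < r" "r < h"
    "f (x + h *\<^sub>R u + h *\<^sub>R v) - f (x + h *\<^sub>R u) - f (x + h *\<^sub>R v) + f x =
      h\<^sup>2 * frechet_derivative (\<lambda>y. frechet_derivative f (at y) u) (at (x + s *\<^sub>R u + r *\<^sub>R v)) v"
proof -
  let ?fu = "\<lambda>y. frechet_derivative f (at y) u"
  have *: "((\<lambda>s. f ((x + r *\<^sub>R v) + s *\<^sub>R u)) has_real_derivative ?fu ((x + r *\<^sub>R v) + s *\<^sub>R u)) (at s)"
    if "0 \<le> s" "s \<le> h" "0 \<le> r" "r \<le> h" for s r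
    using S[OF that] by (intro has_real_derivative_along_line f) (simp add: algebra_simps)
  have "((\<lambda>s. f ((x + h *\<^sub>R v) + s *\<^sub>R u) - f ((x + 0 *\<^sub>R v) + s *\<^sub>R u)) has_real_derivative
      ?fu ((x + h *\<^sub>R v) + s *\<^sub>R u) - ?fu ((x + 0 *\<^sub>R v) + s *\<^sub>R u)) (at s)"
    if "0 \<le> s" "s \<le> h" for s
    using that h by (intro DERIV_diff *) auto
  from MVT2[OF h this] obtain s where s: "0 < s" "s < h" and
    1: "f ((x + h *\<^sub>R v) + h *\<^sub>R u) - f (x + h *\<^sub>R u) - (f (x + h *\<^sub>R v) - f x) =
        h * (?fu ((x + h *\<^sub>R v) + s *\<^sub>R u) - ?fu (x + s *\<^sub>R u))" by auto
  have "((\<lambda>r. ?fu ((x + s *\<^sub>R u) + r *\<^sub>R v)) has_real_derivative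
      frechet_derivative ?fu (at ((x + s *\<^sub>R u) + r *\<^sub>R v)) v) (at r)"
    if "0 \<le> r" "r \<le> h" for r
    using S[of s r] s that by (intro has_real_derivative_along_line fu) (simp add: algebra_simps)
  from MVT2[OF h this] obtain r where r: "0 < r" "r < h" and
    2: "?fu ((x + s *\<^sub>R u) + h *\<^sub>R v) - ?fu (x + s *\<^sub>R u) =
        h * frechet_derivative ?fu (at ((x + s *\<^sub>R u) + r *\<^sub>R v)) v" by auto
  have "?fu ((x + h *\<^sub>R v) + s *\<^sub>R u) = ?fu ((x + s *\<^sub>R u) + h *\<^sub>R v)"
    by (simp add: algebra_simps)
  with 1 2 have "f (x + h *\<^sub>R u + h *\<^sub>R v) - f (x + h *\<^sub>R u) - f (x + h *\<^sub>R v) + f x =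
      h\<^sup>2 * frechet_derivative ?fu (at (x + s *\<^sub>R u + r *\<^sub>R v)) v"
    by (simp add: algebra_simps power2_eq_square)
  with s r that show ?thesis by blast
qed

text \<open>One second difference is \<open>h\<^sup>2\<close> times a value of either mixed
  derivative at points of a small parallelogram at x; continuity at x then excludes distinct values
  there.\<close>

lemma mixed_derivatives_commute:
  fixes f :: "'a::euclidean_space \<Rightarrow> real"
  assumes S: "open S" "x \<in> S"
    and f: "\<And>y. y \<in> S \<Longrightarrow> f differentiable (at y)"
    and fu: "\<And>y w. y \<in> S \<Longrightarrow> (\<lambda>y. frechet_derivative f (at y) w) differentiable (at y)"
    and c: "\<And>w w'. continuous_on S (\<lambda>y. frechet_derivative (\<lambda>y. frechet_derivative f (at y) w) (at y) w')"
  shows "frechet_derivative (\<lambda>y. frechet_derivative f (at y) u) (at x) v =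
         frechet_derivative (\<lambda>y. frechet_derivative f (at y) v) (at x) u"
    (is "?A x = ?B x")
proof (rule ccontr)
  assume ne: "?A x \<noteq> ?B x"
  \<comment> \<open>Half the gap: a common value cannot lie within less than this distance of both
    \<open>?A x\<close> and \<open>?B x\<close>.\<close>
  define \<epsilon> where "\<epsilon> = \<bar>?A x - ?B x\<bar> / 2"
  have \<epsilon>: "\<epsilon> > 0" using ne by (simp add: \<epsilon>_def)
  have "isCont ?A x" "isCont ?B x"
    using c S continuous_on_eq_continuous_at by blast+
  then have "(?A \<longlongrightarrow> ?A x) (nhds x)" "(?B \<longlongrightarrow> ?B x) (nhds x)"
    unfolding continuous_within by (auto intro: iffD1[OF tendsto_at_iff_tendsto_nhds])
  then have "\<forall>\<^sub>F y in nhds x. dist (?A y) (?A x) < \<epsilon>" "\<forall>\<^sub>F y in nhds x. dist (?B y) (?B x) < \<epsilon>"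
    using \<epsilon> by (auto dest: tendstoD)
  moreover have "\<forall>\<^sub>F y in nhds x. y \<in> S"
    using S by (rule eventually_nhds_in_open)
  ultimately have "\<forall>\<^sub>F y in nhds x. y \<in> S \<and> dist (?A y) (?A x) < \<epsilon> \<and> dist (?B y) (?B x) < \<epsilon>"
    by eventually_elim auto
  then obtain d where d: "d > 0" and dS: "\<And>y. dist y x < d \<Longrightarrow>
      y \<in> S \<and> dist (?A y) (?A x) < \<epsilon> \<and> dist (?B y) (?B x) < \<epsilon>"
    by (auto simp: eventually_nhds_metric)
  \<comment> \<open>With this h the parallelogram spanned at x by \<open>h *\<^sub>R u\<close> and
    \<open>h *\<^sub>R v\<close> lies in the ball of radius d; the summand 1 keeps the denominator
    positive when u = v = 0.\<close>
  define h where "h = d / (2 * (norm u + norm v + 1))"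
  have n: "norm u + norm v + 1 > 0" by (smt (verit) norm_ge_zero)
  have h: "h > 0" using d n by (auto simp: h_def)
  have near: "dist (x + s *\<^sub>R u + r *\<^sub>R v) x < d" if "0 \<le> s" "s \<le> h" "0 \<le> r" "r \<le> h" for s r
  proof -
    have "dist (x + s *\<^sub>R u + r *\<^sub>R v) x \<le> norm (s *\<^sub>R u) + norm (r *\<^sub>R v)"
      using norm_triangle_ineq[of "s *\<^sub>R u" "r *\<^sub>R v"] by (simp add: dist_norm add.assoc del: norm_scaleR)
    also have "\<dots> \<le> h * norm u + h * norm v"
      using that by (auto intro!: add_mono mult_right_mono)
    also have "\<dots> \<le> h * (norm u + norm v + 1)" using h by (simp add: algebra_simps)
    also have "\<dots> = d / 2" using n by (simp add: h_def field_simps)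
    finally show ?thesis using d by simp
  qed
  obtain s r where 1: "0 < s" "s < h" "0 < r" "r < h"
    "f (x + h *\<^sub>R u + h *\<^sub>R v) - f (x + h *\<^sub>R u) - f (x + h *\<^sub>R v) + f x =
      h\<^sup>2 * ?A (x + s *\<^sub>R u + r *\<^sub>R v)"
    by (rule second_difference_mean_value[OF h, of x u v S f]) (use near dS f fu in auto)
  have near': "dist (x + s *\<^sub>R v + r *\<^sub>R u) x < d" if "0 \<le> s" "s \<le> h" "0 \<le> r" "r \<le> h" for s r
    using near[of r s] that by (simp add: algebra_simps)
  obtain s' r' where 2: "0 < s'" "s' < h" "0 < r'" "r' < h"
    "f (x + h *\<^sub>R v + h *\<^sub>R u) - f (x + h *\<^sub>R v) - f (x + h *\<^sub>R u) + f x =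
      h\<^sup>2 * ?B (x + s' *\<^sub>R v + r' *\<^sub>R u)"
    by (rule second_difference_mean_value[OF h, of x v u S f]) (use near' dS f fu in auto)
  have "x + h *\<^sub>R v + h *\<^sub>R u = x + h *\<^sub>R u + h *\<^sub>R v" by (simp add: algebra_simps)
  then have "h\<^sup>2 * ?A (x + s *\<^sub>R u + r *\<^sub>R v) = h\<^sup>2 * ?B (x + s' *\<^sub>R v + r' *\<^sub>R u)"
    using 1(5) 2(5) by (simp add: algebra_simps)
  then have "?A (x + s *\<^sub>R u + r *\<^sub>R v) = ?B (x + s' *\<^sub>R v + r' *\<^sub>R u)" using h by simp
  moreover have "dist (?A (x + s *\<^sub>R u + r *\<^sub>R v)) (?A x) < \<epsilon>"
    using dS[OF near, of s r] 1 by auto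
  moreover have "dist (?B (x + s' *\<^sub>R v + r' *\<^sub>R u)) (?B x) < \<epsilon>"
    using dS[OF near', of s' r'] 2 by auto
  ultimately show False by (simp add: \<epsilon>_def dist_real_def abs_if split: if_splits)
qed

section \<open>Differentiability classes under congruence and linear maps\<close>

lemma Ck_on_cong:
  assumes "open S" "\<And>x. x \<in> S \<Longrightarrow> f x = g x" "Ck_on k S f"
  shows "Ck_on k S g"
  using assms(2,3)
proof (induction k arbitrary: f g)
  case 0
  then show ?case by (auto cong: continuous_on_cong)
next
  case (Suc k)
  have d: "g differentiable at x" "frechet_derivative f (at x) = frechet_derivative g (at x)" if "x \<in> S" for x
  proof -
    have "f differentiable at x"
      using Suc.prems that assms(1) by (auto simp: differentiable_on_eq_differentiable_at)
    then show "frechet_derivative f (at x) = frechet_derivative g (at x)"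
      using frechet_derivative_transform_within_open[OF _ assms(1) that] Suc.prems by blast
    show "g differentiable at x"
      using \<open>f differentiable at x\<close> has_derivative_transform_within_open[OF _ assms(1) that] Suc.prems
      unfolding differentiable_def by blast
  qed
  then have "g differentiable_on S"
    by (simp add: differentiable_at_imp_differentiable_on)
  moreover have "Ck_on k S (\<lambda>x. frechet_derivative g (at x) v)" for v
    by (rule Suc.IH[of "\<lambda>x. frechet_derivative f (at x) v"]) (use d Suc.prems in auto)
  ultimately show ?case by simp
qed

lemma frechet_derivative_bounded_linear:
  assumes "bounded_linear L" "f differentiable at x"
  shows "frechet_derivative (\<lambda>x. L (f x)) (at x) = (\<lambda>v. L (frechet_derivative f (at x) v))"
  by (rule frechet_derivative_at[symmetric], rule bounded_linear.has_derivative[OF assms(1)])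
     (use assms(2) frechet_derivative_works in blast)

lemma Ck_on_bounded_linear:
  assumes "open S" "bounded_linear L" "Ck_on k S f"
  shows "Ck_on k S (\<lambda>x. L (f x))"
  using assms(3)
proof (induction k arbitrary: f)
  case 0
  then show ?case using assms(2) by (auto intro: bounded_linear.continuous_on)
next
  case (Suc k)
  have d: "f differentiable at x" if "x \<in> S" for x
    using Suc.prems that assms(1) by (auto simp: differentiable_on_eq_differentiable_at)
  have "(\<lambda>x. L (f x)) differentiable at x" if "x \<in> S" for x
    using d[OF that] assms(2) unfolding differentiable_def by (blast intro: bounded_linear.has_derivative)
  moreover have "Ck_on k S (\<lambda>x. frechet_derivative (\<lambda>x. L (f x)) (at x) v)" for v
  proof (rule Ck_on_cong[OF assms(1)])
    show "Ck_on k S (\<lambda>x. L (frechet_derivative f (at x) v))"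
      by (rule Suc.IH) (use Suc.prems in auto)
  qed (use d assms(2) in \<open>simp add: frechet_derivative_bounded_linear\<close>)
  ultimately show ?case by (simp add: differentiable_at_imp_differentiable_on)
qed

text \<open>Symmetry of the second derivatives is recorded as a property, in place of their
  continuity, so that linear combinations, pullbacks and restrictions to slices inherit it by mere
  calculation.\<close>

definition C2_on :: "(real^'n::finite) set \<Rightarrow> (real^'n \<Rightarrow> real) \<Rightarrow> bool" where
  "C2_on S f \<longleftrightarrow> (\<forall>x\<in>S. f differentiable at x \<and> (\<forall>k. pd k f differentiable at x) \<and>
     (\<forall>k l. pd k (pd l f) x = pd l (pd k f) x))"

lemma Ck_on_2_imp_C2_on:
  assumes "open S" "Ck_on 2 S f"
  shows "C2_on S f"
proof -
  have k: "Ck_on (Suc (Suc 0)) S f" using assms by (simp add: numeral_2_eq_2)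
  have d: "f differentiable at x" "(\<lambda>y. frechet_derivative f (at y) v) differentiable at x" if "x \<in> S" for x v
    using k that assms(1) by (auto simp: differentiable_on_eq_differentiable_at)
  show ?thesis unfolding C2_on_def pd_def
    by (intro ballI conjI allI d mixed_derivatives_commute[OF assms(1)]) (use k in auto)
qed

lemma smooth_on_imp_C2_on:
  assumes "open S" "smooth_on S (T :: real^'n::finite \<Rightarrow> real^'a::finite^'b::finite)"
  shows "C2_on S (\<lambda>y. T y $ i $ j)"
proof (rule Ck_on_2_imp_C2_on[OF assms(1)])
  have "bounded_linear (\<lambda>A :: real^'a^'b. A $ i $ j)"
    by (intro bounded_linear_compose[OF bounded_linear_vec_nth] bounded_linear_vec_nth)
  then show "Ck_on 2 S (\<lambda>y. T y $ i $ j)"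
    using assms by (intro Ck_on_bounded_linear[of S "\<lambda>A. A $ i $ j"]) (auto simp: smooth_on_def)
qed

section \<open>Calculus of coordinate derivatives\<close>

lemma pd_eqI: "(f has_derivative f') (at x) \<Longrightarrow> pd k f x = f' (axis k 1)"
  unfolding pd_def using frechet_derivative_at by metis

lemma pd_has_derivative:
  "f differentiable at x \<Longrightarrow> (f has_derivative frechet_derivative f (at x)) (at x)"
  using frechet_derivative_works by blast

lemma pd_const [simp]: "pd k (\<lambda>y. c) x = 0"
  by (simp add: pd_def)

lemma pd_add: "f differentiable at x \<Longrightarrow> h differentiable at x \<Longrightarrow>
    pd k (\<lambda>y. f y + h y) x = pd k f x + pd k h x"
  by (subst pd_eqI[OF has_derivative_add[OF pd_has_derivative pd_has_derivative]]) (auto simp: pd_def)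

lemma pd_diff: "f differentiable at x \<Longrightarrow> h differentiable at x \<Longrightarrow>
    pd k (\<lambda>y. f y - h y) x = pd k f x - pd k h x"
  by (subst pd_eqI[OF has_derivative_diff[OF pd_has_derivative pd_has_derivative]]) (auto simp: pd_def)

lemma pd_mult: "f differentiable at x \<Longrightarrow> h differentiable at x \<Longrightarrow>
    pd k (\<lambda>y. f y * h y) x = f x * pd k h x + pd k f x * h x" for f h :: "_ \<Rightarrow> real"
  by (subst pd_eqI[OF has_derivative_mult[OF pd_has_derivative pd_has_derivative]]) (auto simp: pd_def)

lemma pd_cmult: "f differentiable at x \<Longrightarrow> pd k (\<lambda>y. c * f y) x = c * pd k f x" for f :: "_ \<Rightarrow> real"
  by (simp add: pd_mult)

lemma pd_scaleR: "f differentiable at x \<Longrightarrow> pd k (\<lambda>y. c *\<^sub>R f y) x = c *\<^sub>R pd k f x"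
  by (subst pd_eqI[OF has_derivative_scaleR_right[OF pd_has_derivative]]) (auto simp: pd_def)

lemma pd_divide: "f differentiable at x \<Longrightarrow> pd k (\<lambda>y. f y / c) x = pd k f x / c" for f :: "_ \<Rightarrow> real"
  using pd_cmult[of f x k "1/c"] by simp

lemma pd_sum: "(\<And>i. i \<in> I \<Longrightarrow> f i differentiable at x) \<Longrightarrow>
    pd k (\<lambda>y. \<Sum>i\<in>I. f i y) x = (\<Sum>i\<in>I. pd k (f i) x)"
  by (subst pd_eqI[OF has_derivative_sum[OF pd_has_derivative]]) (auto simp: pd_def)

lemma pd_bounded_linear: "bounded_linear L \<Longrightarrow> f differentiable at x \<Longrightarrow> pd k (\<lambda>y. L (f y)) x = L (pd k f x)"
  by (simp add: pd_def frechet_derivative_bounded_linear)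

lemma pd_nth: "f differentiable at x \<Longrightarrow> pd k f x $ i = pd k (\<lambda>y. f y $ i) x"
  by (rule pd_bounded_linear[OF bounded_linear_vec_nth, symmetric])

lemma differentiable_vec_nth: "f differentiable F \<Longrightarrow> (\<lambda>y. f y $ i) differentiable F"
  unfolding differentiable_def by (blast intro: bounded_linear.has_derivative[OF bounded_linear_vec_nth])

lemma differentiable_vecI:
  fixes f :: "'a::real_normed_vector \<Rightarrow> 'b::euclidean_space^'n::finite"
  assumes "\<And>i. (\<lambda>y. f y $ i) differentiable at x"
  shows "f differentiable at x"
proof -
  have "(\<lambda>y. f y \<bullet> b) differentiable at x" if b: "b \<in> Basis" for b
  proof -
    obtain i c where "b = axis i c" using b by (auto simp: Basis_vec_def)
    then show ?thesis using assms[of i] by (simp add: inner_axis)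
  qed
  then show ?thesis by (subst differentiable_componentwise_within) blast
qed

lemma pd_cong_open:
  assumes "open S" "x \<in> S" "\<And>y. y \<in> S \<Longrightarrow> f y = h y"
  shows "pd k f x = pd k h x"
proof -
  have "(f has_derivative D) (at x) \<longleftrightarrow> (h has_derivative D) (at x)" for D
    using has_derivative_transform_within_open[OF _ assms(1,2)] assms(3) by metis
  then show ?thesis by (simp add: pd_def frechet_derivative_def)
qed

lemma differentiable_cong_open:
  assumes "open S" "x \<in> S" "\<And>y. y \<in> S \<Longrightarrow> f y = h y" "f differentiable at x"
  shows "h differentiable at x"
  using has_derivative_transform_within_open[OF _ assms(1,2)] assms(3,4)
  unfolding differentiable_def by blast

section \<open>Determinants and inverses of matrix-valued functions\<close>

lemma differentiable_det:
  fixes A :: "'a::real_normed_vector \<Rightarrow> real^'n^'n"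
  assumes "\<And>i j. (\<lambda>y. A y $ i $ j) differentiable at x"
  shows "(\<lambda>y. det (A y)) differentiable at x"
proof -
  have "\<exists>D. ((\<lambda>y. \<Prod>i\<in>UNIV. A y $ i $ p i) has_derivative D) (at x)" for p :: "'n \<Rightarrow> 'n"
    using has_derivative_prod[of UNIV "\<lambda>i y. A y $ i $ p i" "\<lambda>i. frechet_derivative (\<lambda>y. A y $ i $ p i) (at x)" x UNIV] assms
      frechet_derivative_works by blast
  then have "(\<lambda>y. \<Prod>i\<in>UNIV. A y $ i $ p i) differentiable at x" for p :: "'n \<Rightarrow> 'n"
    by (simp add: differentiable_def)
  then show ?thesis unfolding det_def
    by (intro differentiable_sum ballI differentiable_mult differentiable_const) (auto simp: finite_permutations)
qed

lemma
  fixes A :: "real^'n^'n"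
  assumes "det A \<noteq> 0"
  shows matrix_inv_right: "A ** matrix_inv A = mat 1"
    and matrix_inv_left: "matrix_inv A ** A = mat 1"
proof -
  from assms have "\<exists>B. A ** B = mat 1 \<and> B ** A = mat 1"
    by (simp add: invertible_det_nz[symmetric] invertible_def)
  from someI_ex[OF this] show "A ** matrix_inv A = mat 1" "matrix_inv A ** A = mat 1"
    unfolding matrix_inv_def by auto
qed

lemma matrix_inv_unique: "A ** B = mat 1 \<Longrightarrow> matrix_inv A = B" for A B :: "real^'n^'n"
  by (metis invertible_det_nz invertible_right_inverse matrix_inv_left matrix_mul_assoc matrix_mul_lid matrix_mul_rid)

text \<open>Cramer's rule. It writes the entries of the inverse as quotients of determinants, from
  which their differentiability follows.\<close>

lemma matrix_inv_nth:
  fixes A :: "real^'n^'n"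
  assumes "det A \<noteq> 0"
  shows "matrix_inv A $ k $ l = det (\<chi> i j. if j = k then axis l 1 $ i else A $ i $ j) / det A"
proof -
  have "A *v (matrix_inv A *v axis l 1) = axis l 1"
    by (simp add: matrix_vector_mul_assoc matrix_inv_right[OF assms])
  then have "(matrix_inv A *v axis l 1) $ k = det (\<chi> i j. if j = k then axis l 1 $ i else A $ i $ j) / det A"
    by (subst (asm) cramer[OF assms]) simp
  then show ?thesis by (simp add: matrix_vector_mult_basis column_def)
qed

lemma eventually_det_nonzero:
  fixes A :: "'a::real_normed_vector \<Rightarrow> real^'n^'n"
  assumes "\<And>i j. (\<lambda>y. A y $ i $ j) differentiable at x" "det (A x) \<noteq> 0"
  shows "\<forall>\<^sub>F y in nhds x. det (A y) \<noteq> 0"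
proof -
  have "isCont (\<lambda>y. det (A y)) x"
    by (intro differentiable_imp_continuous_within differentiable_det assms)
  then have "((\<lambda>y. det (A y)) \<longlongrightarrow> det (A x)) (nhds x)"
    unfolding continuous_within tendsto_at_iff_tendsto_nhds[of "\<lambda>y. det (A y)" x] .
  from tendsto_imp_eventually_ne[OF this assms(2)] show ?thesis .
qed

lemma differentiable_matrix_inv:
  fixes A :: "'a::real_normed_vector \<Rightarrow> real^'n^'n"
  assumes A: "\<And>i j. (\<lambda>y. A y $ i $ j) differentiable at x" "det (A x) \<noteq> 0"
  shows "(\<lambda>y. matrix_inv (A y) $ k $ l) differentiable at x"
proof -
  obtain U where U: "open U" "x \<in> U" "\<And>y. y \<in> U \<Longrightarrow> det (A y) \<noteq> 0"
    using eventually_det_nonzero[OF A] by (auto simp: eventually_nhds)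
  have "(\<lambda>y. if j = k then axis l 1 $ i else A y $ i $ j) differentiable at x" for i j
    using A(1) by (cases "j = k") auto
  then have "(\<lambda>y. det (\<chi> i j. if j = k then axis l 1 $ i else A y $ i $ j) / det (A y)) differentiable at x"
    by (intro differentiable_divide differentiable_det A)
       (use A in auto)
  then show ?thesis
    by (rule differentiable_cong_open[OF U(1,2), rotated]) (simp add: U(3) matrix_inv_nth)
qed

text \<open>Differentiating B A = 1 gives B' A + B A' = 0, and multiplication by B on the right
  solves for B'. That B is differentiable at all comes from Cramer's rule.\<close>

lemma has_derivative_matrix_inv:
  fixes A :: "'a::real_normed_vector \<Rightarrow> real^'n^'n"
  assumes A: "\<And>i j. ((\<lambda>y. A y $ i $ j) has_derivative A' i j) (at x)" "det (A x) \<noteq> 0"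
  shows "((\<lambda>y. matrix_inv (A y) $ k $ l) has_derivative
    (\<lambda>v. - (\<Sum>p\<in>UNIV. \<Sum>q\<in>UNIV. matrix_inv (A x) $ k $ p * A' p q v * matrix_inv (A x) $ q $ l))) (at x)"
proof -
  let ?B = "\<lambda>y. matrix_inv (A y)"
  have dA: "(\<lambda>y. A y $ i $ j) differentiable at x" for i j
    using A(1) differentiable_def by blast
  obtain U where U: "open U" "x \<in> U" "\<And>y. y \<in> U \<Longrightarrow> det (A y) \<noteq> 0"
    using eventually_det_nonzero[OF dA A(2)] by (auto simp: eventually_nhds)
  define B' where "B' k l = frechet_derivative (\<lambda>y. ?B y $ k $ l) (at x)" for k l
  have B: "((\<lambda>y. ?B y $ k $ l) has_derivative B' k l) (at x)" for k l
    using differentiable_matrix_inv[OF dA A(2)] frechet_derivative_works by (auto simp: B'_def)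
  have BA: "(\<Sum>p\<in>UNIV. ?B y $ k $ p * A y $ p $ q) = (if k = q then 1 else 0)" if "y \<in> U" for y k q
    using matrix_inv_left[OF U(3)[OF that]] by (simp add: vec_eq_iff matrix_matrix_mult_def mat_def)
  have AB: "(\<Sum>q\<in>UNIV. A x $ p $ q * ?B x $ q $ l) = (if p = l then 1 else 0)" for p l
    using matrix_inv_right[OF A(2)] by (simp add: vec_eq_iff matrix_matrix_mult_def mat_def)
  have z: "(\<Sum>p\<in>UNIV. B' k p v * A x $ p $ q + ?B x $ k $ p * A' p q v) = 0" for q v
  proof -
    have 1: "((\<lambda>y. \<Sum>p\<in>UNIV. ?B y $ k $ p * A y $ p $ q) has_derivative
       (\<lambda>v. \<Sum>p\<in>UNIV. ?B x $ k $ p * A' p q v + B' k p v * A x $ p $ q)) (at x)"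
      by (intro has_derivative_sum has_derivative_mult A(1) B)
    have "((\<lambda>y. \<Sum>p\<in>UNIV. ?B y $ k $ p * A y $ p $ q) has_derivative (\<lambda>v. 0)) (at x)"
      by (rule has_derivative_transform_within_open[OF has_derivative_const U(1,2)]) (simp add: BA)
    from has_derivative_unique[OF 1 this] show ?thesis
      by (simp add: fun_eq_iff add.commute)
  qed
  have "B' k l v = - (\<Sum>p\<in>UNIV. \<Sum>q\<in>UNIV. ?B x $ k $ p * A' p q v * ?B x $ q $ l)" for v
  proof -
    have "0 = (\<Sum>q\<in>UNIV. (\<Sum>p\<in>UNIV. B' k p v * A x $ p $ q + ?B x $ k $ p * A' p q v) * ?B x $ q $ l)"
      using z by simp
    also have "\<dots> = (\<Sum>p\<in>UNIV. B' k p v * (\<Sum>q\<in>UNIV. A x $ p $ q * ?B x $ q $ l)) +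
        (\<Sum>q\<in>UNIV. \<Sum>p\<in>UNIV. ?B x $ k $ p * A' p q v * ?B x $ q $ l)"
      by (simp add: sum.distrib sum_distrib_left sum_distrib_right distrib_right mult.assoc)
         (rule sum.swap)
    also have "(\<Sum>p\<in>UNIV. B' k p v * (\<Sum>q\<in>UNIV. A x $ p $ q * ?B x $ q $ l)) = B' k l v"
      by (simp add: AB if_distrib cong: if_cong)
    finally show ?thesis by (subst (asm) sum.swap) simp
  qed
  then have "B' k l = (\<lambda>v. - (\<Sum>p\<in>UNIV. \<Sum>q\<in>UNIV. ?B x $ k $ p * A' p q v * ?B x $ q $ l))" by auto
  with B show ?thesis by metis
qed

lemma C2_on_subset: "C2_on S f \<Longrightarrow> U \<subseteq> S \<Longrightarrow> C2_on U f"
  unfolding C2_on_def by blast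

text \<open>The Christoffel symbols of the first kind. They are linear in the metric and free of its
  inverse, so they make sense for a variation \<open>H\<close> as well and are affine in s for
  \<open>g + s H\<close>.\<close>

definition lchr :: "(real^'n::finite \<Rightarrow> real^'n^'n) \<Rightarrow> real^'n \<Rightarrow> 'n \<Rightarrow> 'n \<Rightarrow> 'n \<Rightarrow> real" where
  "lchr g x i j k = (pd i g x $ j $ k + pd j g x $ i $ k - pd k g x $ i $ j) / 2"

section \<open>Curvature of a metric in a chart\<close>

lemma sum_delta_mult [simp]:
  fixes f :: "'a::finite \<Rightarrow> real"
  shows "(\<Sum>p\<in>UNIV. (if k = p then 1 else 0) * f p) = f k"
    and "(\<Sum>p\<in>UNIV. (if p = k then 1 else 0) * f p) = f k"
    and "(\<Sum>p\<in>UNIV. f p * (if k = p then 1 else 0)) = f k"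
    and "(\<Sum>p\<in>UNIV. f p * (if p = k then 1 else 0)) = f k"
  by (simp_all add: if_distrib[of "\<lambda>a. a * _"] if_distrib[of "\<lambda>a. _ * a"] cong: if_cong)

lemma christoffel_lchr: "christoffel g x k i j = (\<Sum>l\<in>UNIV. matrix_inv (g x) $ k $ l * lchr g x i j l)"
  by (simp add: christoffel_def lchr_def sum_divide_distrib)

text \<open>Metrics and their variations are both of this kind; nondegeneracy is added below.\<close>

locale C2_field =
  fixes H :: "real^'n::finite \<Rightarrow> real^'n^'n" and S :: "(real^'n) set"
  assumes open_S: "open S"
    and C2: "\<And>i j. C2_on S (\<lambda>y. H y $ i $ j)"
    and sym: "\<And>y i j. y \<in> S \<Longrightarrow> H y $ i $ j = H y $ j $ i"
begin

lemma diff_nth: "y \<in> S \<Longrightarrow> (\<lambda>z. H z $ i $ j) differentiable at y"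
  using C2 by (auto simp: C2_on_def)

lemma diff: "y \<in> S \<Longrightarrow> H differentiable at y"
  by (intro differentiable_vecI diff_nth)

lemma pd_nth_nth: "y \<in> S \<Longrightarrow> pd k H y $ i $ j = pd k (\<lambda>z. H z $ i $ j) y"
  using diff diff[THEN differentiable_vec_nth] by (simp add: pd_nth)

lemma pd_sym: "y \<in> S \<Longrightarrow> pd k H y $ i $ j = pd k H y $ j $ i"
  by (simp add: pd_nth_nth) (rule pd_cong_open[OF open_S _ sym])

lemma diff_pd:
  assumes y: "y \<in> S"
  shows "(\<lambda>z. pd k H z $ i $ j) differentiable at y"
proof (rule differentiable_cong_open[OF open_S y])
  show "pd k (\<lambda>z. H z $ i $ j) differentiable at y"
    using C2 y by (simp add: C2_on_def)
qed (simp add: pd_nth_nth)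

lemma pd_pd_commute:
  "y \<in> S \<Longrightarrow> pd k (\<lambda>z. pd l H z $ i $ j) y = pd l (\<lambda>z. pd k H z $ i $ j) y"
  using C2 pd_cong_open[OF open_S, of y "\<lambda>z. pd l H z $ i $ j" "pd l (\<lambda>z. H z $ i $ j)"]
    pd_cong_open[OF open_S, of y "\<lambda>z. pd k H z $ i $ j" "pd k (\<lambda>z. H z $ i $ j)"]
  by (simp add: pd_nth_nth C2_on_def)

lemma pd_pd_sym: "y \<in> S \<Longrightarrow> pd k (\<lambda>z. pd l H z $ i $ j) y = pd k (\<lambda>z. pd l H z $ j $ i) y"
  by (rule pd_cong_open[OF open_S]) (auto simp: pd_sym)

lemma lchr_sym: "y \<in> S \<Longrightarrow> lchr H y i j k = lchr H y j i k"
  by (simp add: lchr_def pd_sym)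

text \<open>For a metric this is compatibility with the connection, with all indices lowered; as an
  identity it holds for every symmetric field.\<close>

lemma pd_eq_lchr: "y \<in> S \<Longrightarrow> pd i H y $ j $ k = lchr H y i j k + lchr H y i k j"
  using pd_sym[of y i j k] by (simp add: lchr_def field_simps)

lemma diff_lchr: "y \<in> S \<Longrightarrow> (\<lambda>z. lchr H z i j k) differentiable at y"
  unfolding lchr_def by (intro differentiable_divide differentiable_add differentiable_diff diff_pd) auto

lemma pd_lchr: "y \<in> S \<Longrightarrow> pd l (\<lambda>z. lchr H z i j k) y =
    (pd l (\<lambda>z. pd i H z $ j $ k) y + pd l (\<lambda>z. pd j H z $ i $ k) y - pd l (\<lambda>z. pd k H z $ i $ j) y) / 2"
  unfolding lchr_def
  by (simp add: pd_divide pd_add pd_diff diff_pd differentiable_add differentiable_diff)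

end

locale local_metric = C2_field g S
  for g :: "real^'n::finite \<Rightarrow> real^'n^'n" and S +
  assumes nz: "\<And>y. y \<in> S \<Longrightarrow> det (g y) \<noteq> 0"
begin

lemma inv_left: "y \<in> S \<Longrightarrow> (\<Sum>p\<in>UNIV. matrix_inv (g y) $ k $ p * g y $ p $ l) = (if k = l then 1 else 0)"
  using matrix_inv_left[OF nz] by (simp add: vec_eq_iff matrix_matrix_mult_def mat_def)

lemma inv_right: "y \<in> S \<Longrightarrow> (\<Sum>p\<in>UNIV. g y $ k $ p * matrix_inv (g y) $ p $ l) = (if k = l then 1 else 0)"
  using matrix_inv_right[OF nz] by (simp add: vec_eq_iff matrix_matrix_mult_def mat_def)

lemma inv_sym: assumes y: "y \<in> S" shows "matrix_inv (g y) $ k $ l = matrix_inv (g y) $ l $ k"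
proof -
  have "transpose (g y) = g y" using sym[OF y] by (simp add: vec_eq_iff transpose_def)
  then have "g y ** transpose (matrix_inv (g y)) = mat 1"
    using arg_cong[OF matrix_inv_left[OF nz[OF y]], of transpose]
    by (simp add: matrix_transpose_mul transpose_mat)
  then have "matrix_inv (g y) = transpose (matrix_inv (g y))" by (rule matrix_inv_unique)
  then have "matrix_inv (g y) $ k $ l = transpose (matrix_inv (g y)) $ k $ l" by simp
  then show ?thesis by (simp add: transpose_def)
qed

lemma diff_inv: "y \<in> S \<Longrightarrow> (\<lambda>z. matrix_inv (g z) $ k $ l) differentiable at y"
  by (intro differentiable_matrix_inv diff_nth nz)

lemma diff_chr: "y \<in> S \<Longrightarrow> (\<lambda>z. christoffel g z k i j) differentiable at y"
  unfolding christoffel_lchr by (intro differentiable_sum ballI differentiable_mult diff_inv diff_lchr) auto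

lemma chr_sym: "y \<in> S \<Longrightarrow> christoffel g y k i j = christoffel g y k j i"
  by (simp add: christoffel_lchr lchr_sym)

lemma lower_chr:
  assumes y: "y \<in> S"
  shows "(\<Sum>m\<in>UNIV. g y $ k $ m * christoffel g y m i j) = lchr g y i j k"
proof -
  have "(\<Sum>m\<in>UNIV. g y $ k $ m * christoffel g y m i j) =
      (\<Sum>l\<in>UNIV. (\<Sum>m\<in>UNIV. g y $ k $ m * matrix_inv (g y) $ m $ l) * lchr g y i j l)"
    by (simp add: christoffel_lchr sum_distrib_left sum_distrib_right mult.assoc) (rule sum.swap)
  also have "\<dots> = lchr g y i j k" by (simp add: inv_right[OF y])
  finally show ?thesis .
qed

lemma lower_chr': "y \<in> S \<Longrightarrow> (\<Sum>m\<in>UNIV. christoffel g y m i j * g y $ m $ k) = lchr g y i j k"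
  using lower_chr[of y k i j] by (simp add: sym[of y k] mult.commute)

text \<open>Lowering the index inside the derivative produces terms in the derivative of g; metric
  compatibility splits them in two, and one half cancels the quadratic terms of
  \<open>curv_endo\<close>. The differentiated terms are now linear in the metric, and the inverse
  enters only through the remaining quadratic terms.\<close>

lemma riemann_lower:
  assumes x: "x \<in> S"
  shows "riemann g x i j k l = pd i (\<lambda>y. lchr g y j l k) x - pd j (\<lambda>y. lchr g y i l k) x
     - (\<Sum>m\<in>UNIV. lchr g x i k m * christoffel g x m j l) + (\<Sum>m\<in>UNIV. lchr g x j k m * christoffel g x m i l)"
proof -
  let ?G = "christoffel g"
  have 1: "(\<Sum>m\<in>UNIV. g x $ k $ m * pd i (\<lambda>y. ?G y m j l) x) =
     pd i (\<lambda>y. lchr g y j l k) x - (\<Sum>m\<in>UNIV. (lchr g x i k m + lchr g x i m k) * ?G x m j l)" for i j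
  proof -
    have "pd i (\<lambda>y. lchr g y j l k) x = pd i (\<lambda>y. \<Sum>m\<in>UNIV. g y $ k $ m * ?G y m j l) x"
      by (rule pd_cong_open[OF open_S x]) (simp add: lower_chr)
    also have "\<dots> = (\<Sum>m\<in>UNIV. g x $ k $ m * pd i (\<lambda>y. ?G y m j l) x + pd i g x $ k $ m * ?G x m j l)"
      by (simp add: pd_sum pd_mult diff_chr diff_nth x differentiable_mult pd_nth_nth[OF x])
    finally show ?thesis by (simp add: sum.distrib pd_eq_lchr[OF x])
  qed
  have 2: "(\<Sum>m\<in>UNIV. g x $ k $ m * (\<Sum>p\<in>UNIV. ?G x p j l * ?G x m i p)) =
      (\<Sum>m\<in>UNIV. lchr g x i m k * ?G x m j l)" for i j
  proof -
    have "(\<Sum>m\<in>UNIV. g x $ k $ m * (\<Sum>p\<in>UNIV. ?G x p j l * ?G x m i p)) =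
        (\<Sum>p\<in>UNIV. (\<Sum>m\<in>UNIV. g x $ k $ m * ?G x m i p) * ?G x p j l)"
      unfolding sum_distrib_left sum_distrib_right by (subst sum.swap) (simp add: mult_ac)
    then show ?thesis by (simp add: lower_chr[OF x])
  qed
  show ?thesis
    using 1[of i j] 1[of j i] 2[of i j] 2[of j i]
    by (simp add: riemann_def curv_endo_def distrib_left right_diff_distrib sum.distrib sum_subtractf distrib_right)
qed

lemma riemann_antisym_left: "riemann g x i j k l = - riemann g x j i k l"
  by (simp add: riemann_def curv_endo_def sum_negf[symmetric] algebra_simps sum_subtractf)

text \<open>In the lowered form the quadratic terms agree because the inverse metric is symmetric,
  and the second derivatives of the metric agree after reordering.\<close>

lemma riemann_pair:
  assumes x: "x \<in> S"
  shows "riemann g x i j k l = riemann g x k l i j"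
proof -
  have *: "(\<Sum>m\<in>UNIV. lchr g x i j m * christoffel g x m k l) = (\<Sum>m\<in>UNIV. lchr g x k l m * christoffel g x m i j)" for i j k l
    unfolding christoffel_lchr sum_distrib_left
    by (subst sum.swap) (simp add: inv_sym[OF x] algebra_simps)
  have "riemann g x k l i j = pd k (\<lambda>y. lchr g y l j i) x - pd l (\<lambda>y. lchr g y k j i) x
     - (\<Sum>m\<in>UNIV. lchr g x i k m * christoffel g x m j l) + (\<Sum>m\<in>UNIV. lchr g x j k m * christoffel g x m i l)"
    unfolding riemann_lower[OF x] *[of j k]
    by (simp add: lchr_sym[OF x, of k i] lchr_sym[OF x, of l i] chr_sym[OF x, of _ l j] chr_sym[OF x, of _ k j])
  moreover define D where "D a b c d = pd a (\<lambda>y. pd b g y $ c $ d) x" for a b c d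
  moreover define Q where "Q a b c d = (\<Sum>m\<in>UNIV. lchr g x a b m * christoffel g x m c d)" for a b c d
  ultimately have 1: "riemann g x k l i j =
      (D k l j i + D k j l i - D k i l j) / 2 - (D l k j i + D l j k i - D l i k j) / 2 - Q i k j l + Q j k i l"
    and 2: "riemann g x i j k l =
      (D i j l k + D i l j k - D i k j l) / 2 - (D j i l k + D j l i k - D j k i l) / 2 - Q i k j l + Q j k i l"
    by (simp_all only: riemann_lower[OF x, of i j k l] pd_lchr[OF x])
  have c: "D a b c d = D b a c d" and s: "D a b c d = D a b d c" for a b c d
    unfolding D_def by (rule pd_pd_commute[OF x], rule pd_pd_sym[OF x])
  show ?thesis
    unfolding 1 2
    using c[of i j l k] c[of k l j i] c[of i l j k] s[of l i k j] c[of i k j l] s[of k i l j]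
      c[of j l i k] s[of l j k i] c[of j k i l] s[of k j l i] by argo
qed

text \<open>Torsion-freeness: \<open>lchr\<close> and \<open>christoffel\<close> are symmetric in
  the two differentiating indices, so the terms of the cyclic sum cancel in pairs.\<close>

lemma riemann_bianchi:
  assumes x: "x \<in> S"
  shows "riemann g x i j k l + riemann g x j l k i + riemann g x l i k j = 0"
proof -
  have p: "pd c (\<lambda>y. lchr g y a b k) x = pd c (\<lambda>y. lchr g y b a k) x" for a b c
  proof (rule pd_cong_open[OF open_S x])
    fix y assume "y \<in> S" then show "lchr g y a b k = lchr g y b a k" by (rule lchr_sym)
  qed
  define Q where "Q a b c = (\<Sum>m\<in>UNIV. lchr g x a k m * christoffel g x m b c)" for a b c
  have q: "Q a b c = Q a c b" for a b c unfolding Q_def by (subst chr_sym[OF x]) (rule refl)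
  show ?thesis
    unfolding riemann_lower[OF x] Q_def[symmetric]
    using p[of i l j] p[of j l i] p[of l j i] q[of i l j] q[of j i l] q[of l i j] by linarith
qed

lemma curv_endo_riemann:
  assumes x: "x \<in> S"
  shows "curv_endo g x i j k l = (\<Sum>m\<in>UNIV. matrix_inv (g x) $ l $ m * riemann g x i j m k)"
proof -
  have "(\<Sum>m\<in>UNIV. matrix_inv (g x) $ l $ m * riemann g x i j m k) =
      (\<Sum>m\<in>UNIV. \<Sum>p\<in>UNIV. matrix_inv (g x) $ l $ m * g x $ m $ p * curv_endo g x i j k p)"
    by (simp only: riemann_def sum_distrib_left mult.assoc)
  also have "\<dots> = (\<Sum>p\<in>UNIV. (\<Sum>m\<in>UNIV. matrix_inv (g x) $ l $ m * g x $ m $ p) * curv_endo g x i j k p)"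
    by (subst sum.swap) (simp only: sum_distrib_right)
  also have "\<dots> = curv_endo g x i j k l" by (simp only: inv_left[OF x] sum_delta_mult)
  finally show ?thesis ..
qed

end

section \<open>Linearized curvature\<close>

lemma cov2_nth: "cov2 g T x $ k $ i $ j = pd k T x $ i $ j
     - (\<Sum>m\<in>UNIV. christoffel g x m k i * T x $ m $ j + christoffel g x m k j * T x $ i $ m)"
  by (simp add: cov2_def)

locale metric_variation = local_metric g S + H: C2_field H S
  for g H :: "real^'n::finite \<Rightarrow> real^'n^'n" and S
begin

text \<open>The variation of the Christoffel symbols, with the upper index lowered.\<close>

definition chr_var :: "real^'n \<Rightarrow> 'n \<Rightarrow> 'n \<Rightarrow> 'n \<Rightarrow> real" where
  "chr_var y i j k = (cov2 g H y $ i $ j $ k + cov2 g H y $ j $ i $ k - cov2 g H y $ k $ i $ j) / 2"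

text \<open>The amount by which partial and covariant derivatives of \<open>H\<close> differ in one
  slot. It is not a tensor; in the linearized curvature all such terms cancel or combine to
  curvature.\<close>

definition chr_H :: "real^'n \<Rightarrow> 'n \<Rightarrow> 'n \<Rightarrow> 'n \<Rightarrow> real" where
  "chr_H y i j k = (\<Sum>m\<in>UNIV. christoffel g y m i j * H y $ m $ k)"

lemma cov2_chr_H: "y \<in> S \<Longrightarrow> cov2 g H y $ k $ i $ j = pd k H y $ i $ j - chr_H y k i j - chr_H y k j i"
  by (simp add: cov2_nth chr_H_def sum.distrib H.sym[of y i])

lemma chr_H_sym: "y \<in> S \<Longrightarrow> chr_H y i j k = chr_H y j i k"
  by (simp add: chr_H_def chr_sym)

lemma cov2_sym: "y \<in> S \<Longrightarrow> cov2 g H y $ k $ i $ j = cov2 g H y $ k $ j $ i"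
  by (simp add: cov2_chr_H H.pd_sym)

lemma lchr_H: "y \<in> S \<Longrightarrow> lchr H y i j k = chr_var y i j k + chr_H y i j k"
  using chr_H_sym[of y i j k] chr_H_sym[of y i k j] chr_H_sym[of y j k i]
  by (simp add: lchr_def chr_var_def cov2_chr_H field_simps)

lemma chr_var_sym: "y \<in> S \<Longrightarrow> chr_var y i j k = chr_var y j i k"
  using cov2_sym[of y k i j] by (simp add: chr_var_def)

lemma pd_H: "y \<in> S \<Longrightarrow> pd i H y $ m $ k = chr_var y i m k + chr_var y i k m + chr_H y i m k + chr_H y i k m"
  by (simp add: H.pd_eq_lchr lchr_H)

lemma diff_chr_H: "y \<in> S \<Longrightarrow> (\<lambda>z. chr_H z i j k) differentiable at y"
  unfolding chr_H_def by (intro differentiable_sum ballI differentiable_mult diff_chr H.diff_nth) auto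

lemma diff_cov2: assumes y: "y \<in> S" shows "(\<lambda>z. cov2 g H z $ k $ i $ j) differentiable at y"
proof (rule differentiable_cong_open[OF open_S y])
  show "(\<lambda>z. pd k H z $ i $ j - chr_H z k i j - chr_H z k j i) differentiable at y"
    by (intro differentiable_diff H.diff_pd diff_chr_H y)
qed (simp add: cov2_chr_H)

lemma diff_cov2': "y \<in> S \<Longrightarrow> cov2 g H differentiable at y"
  by (intro differentiable_vecI diff_cov2)

lemma cov3_cov2: "x \<in> S \<Longrightarrow> cov3 g (cov2 g H) x k l i j = pd k (\<lambda>y. cov2 g H y $ l $ i $ j) x
     - (\<Sum>m\<in>UNIV. christoffel g x m k l * cov2 g H x $ m $ i $ j + christoffel g x m k i * cov2 g H x $ l $ m $ j
              + christoffel g x m k j * cov2 g H x $ l $ i $ m)"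
  by (simp add: cov3_def pd_nth diff_cov2' differentiable_vec_nth)

lemma cov3_sym: assumes x: "x \<in> S" shows "cov3 g (cov2 g H) x k l i j = cov3 g (cov2 g H) x k l j i"
proof -
  have "pd k (\<lambda>y. cov2 g H y $ l $ i $ j) x = pd k (\<lambda>y. cov2 g H y $ l $ j $ i) x"
    by (rule pd_cong_open[OF open_S x]) (rule cov2_sym)
  then show ?thesis
    by (simp add: cov3_cov2[OF x] cov2_sym[OF x, of _ j i] cov2_sym[OF x, of l j] cov2_sym[OF x, of l _ i] sum.distrib)
qed

text \<open>\<open>chr_var\<close> is a tensor with three lower indices and the right side is its
  covariant derivative, which is linear and respects permutations of the slots of
  \<open>cov2 g H\<close>.\<close>

lemma cov_chr_var:
  assumes x: "x \<in> S"
  shows "(cov3 g (cov2 g H) x i j l k + cov3 g (cov2 g H) x i l j k - cov3 g (cov2 g H) x i k j l) / 2 =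
    pd i (\<lambda>y. chr_var y j l k) x - (\<Sum>m\<in>UNIV. christoffel g x m i j * chr_var x m l k)
     - (\<Sum>m\<in>UNIV. christoffel g x m i l * chr_var x j m k) - (\<Sum>m\<in>UNIV. christoffel g x m i k * chr_var x j l m)"
proof -
  have "pd i (\<lambda>y. chr_var y j l k) x = (pd i (\<lambda>y. cov2 g H y $ j $ l $ k) x
      + pd i (\<lambda>y. cov2 g H y $ l $ j $ k) x - pd i (\<lambda>y. cov2 g H y $ k $ j $ l) x) / 2"
    unfolding chr_var_def
    by (simp add: pd_divide pd_add pd_diff diff_cov2[OF x])
  then show ?thesis
    unfolding cov3_cov2[OF x] chr_var_def
    by (simp add: sum.distrib sum_subtractf sum_divide_distrib[symmetric] add_divide_distrib diff_divide_distrib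
        distrib_left right_diff_distrib)
qed

lemma pd_chr_var:
  assumes x: "x \<in> S"
  shows "pd i (\<lambda>y. chr_var y j l k) x = pd i (\<lambda>y. lchr H y j l k) x
    - (\<Sum>m\<in>UNIV. pd i (\<lambda>y. christoffel g y m j l) x * H x $ m $ k)
    - (\<Sum>m\<in>UNIV. christoffel g x m j l * pd i H x $ m $ k)"
proof -
  have "pd i (\<lambda>y. chr_var y j l k) x = pd i (\<lambda>y. lchr H y j l k - chr_H y j l k) x"
    by (rule pd_cong_open[OF open_S x]) (simp add: lchr_H)
  also have "\<dots> = pd i (\<lambda>y. lchr H y j l k) x - pd i (\<lambda>y. chr_H y j l k) x"
    by (intro pd_diff H.diff_lchr diff_chr_H x)
  also have "pd i (\<lambda>y. chr_H y j l k) x = (\<Sum>m\<in>UNIV. pd i (\<lambda>y. christoffel g y m j l * H y $ m $ k) x)"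
    unfolding chr_H_def by (intro pd_sum differentiable_mult diff_chr H.diff_nth x)
  also have "\<dots> = (\<Sum>m\<in>UNIV. christoffel g x m j l * pd i H x $ m $ k + pd i (\<lambda>y. christoffel g y m j l) x * H x $ m $ k)"
    by (simp only: pd_mult[OF diff_chr[OF x] H.diff_nth[OF x]] H.pd_nth_nth[OF x])
  finally show ?thesis by (simp add: sum.distrib)
qed

section \<open>The curve of metrics and the derivative of its curvature\<close>

definition metric_at :: "real \<Rightarrow> real^'n \<Rightarrow> real^'n^'n" where
  "metric_at s = (\<lambda>y. g y + s *\<^sub>R H y)"

lemma C2_field_metric_at: "C2_field (metric_at s) S"
proof
  show "C2_on S (\<lambda>y. metric_at s y $ i $ j)" for i j
  proof -
    have 1: "pd k (\<lambda>y. g y $ i $ j + s * H y $ i $ j) y = pd k (\<lambda>y. g y $ i $ j) y + s * pd k (\<lambda>y. H y $ i $ j) y"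
      if "y \<in> S" for k y
      using that by (simp add: pd_add pd_cmult diff_nth H.diff_nth differentiable_mult)
    have 2: "pd k (\<lambda>y. g y $ i $ j) differentiable at y" "pd k (\<lambda>y. H y $ i $ j) differentiable at y" if "y \<in> S" for k y
      using C2 H.C2 that by (auto simp: C2_on_def)
    have 3: "pd k (\<lambda>y. g y $ i $ j + s * H y $ i $ j) differentiable at y" if y: "y \<in> S" for k y
      by (rule differentiable_cong_open[OF open_S y, of "\<lambda>y. pd k (\<lambda>y. g y $ i $ j) y + s * pd k (\<lambda>y. H y $ i $ j) y"])
         (auto simp: 1 intro!: differentiable_add differentiable_mult 2 y)
    have 4: "pd k (pd l (\<lambda>y. g y $ i $ j + s * H y $ i $ j)) y =
        pd k (pd l (\<lambda>y. g y $ i $ j)) y + s * pd k (pd l (\<lambda>y. H y $ i $ j)) y" if y: "y \<in> S" for k l y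
    proof -
      have "pd k (pd l (\<lambda>y. g y $ i $ j + s * H y $ i $ j)) y =
          pd k (\<lambda>y. pd l (\<lambda>y. g y $ i $ j) y + s * pd l (\<lambda>y. H y $ i $ j) y) y"
        by (rule pd_cong_open[OF open_S y]) (rule 1)
      then show ?thesis using 2[OF y] by (simp add: pd_add pd_cmult differentiable_mult)
    qed
    show ?thesis
      unfolding C2_on_def metric_at_def using C2 H.C2 3 4
      by (auto simp: C2_on_def intro!: differentiable_add differentiable_mult diff_nth H.diff_nth)
  qed
qed (use open_S sym H.sym in \<open>auto simp: metric_at_def\<close>)

lemma lchr_metric_at: "y \<in> S \<Longrightarrow> lchr (metric_at s) y i j k = lchr g y i j k + s * lchr H y i j k"
  unfolding lchr_def metric_at_def
  by (simp add: pd_add pd_scaleR diff H.diff differentiable_scaleR field_simps)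

text \<open>Nondegeneracy at x extends only to some neighbourhood of x, which may depend on s. Any
  neighbourhood serves, since the curvature at x is a local expression.\<close>

lemma local_metric_metric_at:
  assumes "x \<in> S" "det (metric_at s x) \<noteq> 0"
  shows "\<exists>U. x \<in> U \<and> U \<subseteq> S \<and> local_metric (metric_at s) U"
proof -
  interpret s: C2_field "metric_at s" S by (rule C2_field_metric_at)
  let ?U = "S \<inter> (\<lambda>y. det (metric_at s y)) -` (- {0})"
  have "continuous_on S (\<lambda>y. det (metric_at s y))"
    by (intro continuous_at_imp_continuous_on ballI differentiable_imp_continuous_within differentiable_det s.diff_nth)
  then have o: "open ?U" by (intro continuous_open_preimage open_S) auto
  have "local_metric (metric_at s) ?U"
  proof
    show "C2_on ?U (\<lambda>y. metric_at s y $ i $ j)" for i j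
      by (rule C2_on_subset[OF s.C2]) simp
  qed (use o s.sym in auto)
  with assms show ?thesis by (intro exI[of _ ?U] conjI) simp_all
qed

lemma eventually_metric_at:
  assumes x: "x \<in> S"
  shows "\<forall>\<^sub>F s in nhds 0. det (metric_at s x) \<noteq> 0"
  by (rule eventually_det_nonzero) (use nz[OF x] in \<open>auto simp: metric_at_def\<close>)

lemma has_derivative_inv_metric_at:
  assumes x: "x \<in> S"
  shows "((\<lambda>s. matrix_inv (metric_at s x) $ k $ l) has_real_derivative
    - (\<Sum>p\<in>UNIV. \<Sum>q\<in>UNIV. matrix_inv (g x) $ k $ p * H x $ p $ q * matrix_inv (g x) $ q $ l)) (at 0)"
proof -
  have "((\<lambda>s. matrix_inv (metric_at s x) $ k $ l) has_derivative
     (\<lambda>v. - (\<Sum>p\<in>UNIV. \<Sum>q\<in>UNIV. matrix_inv (metric_at 0 x) $ k $ p * (v * H x $ p $ q) * matrix_inv (metric_at 0 x) $ q $ l))) (at 0)"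
    by (rule has_derivative_matrix_inv) (use nz[OF x] in \<open>auto simp: metric_at_def intro!: derivative_eq_intros\<close>)
  then show ?thesis
    by (simp add: has_field_derivative_def metric_at_def sum_distrib_left sum_distrib_right sum_negf[symmetric] mult_ac)
       (erule back_subst[of "\<lambda>f. (_ has_derivative f) _"], auto simp: sum_distrib_left mult_ac)
qed


lemma metric_at_0: "metric_at 0 = g"
  by (simp add: metric_at_def)

text \<open>The variation of the inverse contributes a term in \<open>chr_H\<close>, which cancels
  the non-tensorial part of \<open>lchr H\<close>; what remains is \<open>chr_var\<close> with an
  index raised.\<close>

lemma has_derivative_chr_metric_at:
  assumes x: "x \<in> S"
  shows "((\<lambda>s. christoffel (metric_at s) x m j l) has_real_derivative
    (\<Sum>n\<in>UNIV. matrix_inv (g x) $ m $ n * chr_var x j l n)) (at 0)"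
proof -
  let ?i = "matrix_inv (g x)"
  have "((\<lambda>s. \<Sum>n\<in>UNIV. matrix_inv (metric_at s x) $ m $ n * (lchr g x j l n + s * lchr H x j l n)) has_real_derivative
     (\<Sum>n\<in>UNIV. ?i $ m $ n * lchr H x j l n +
        - (\<Sum>p\<in>UNIV. \<Sum>q\<in>UNIV. ?i $ m $ p * H x $ p $ q * ?i $ q $ n) * lchr g x j l n)) (at 0)"
    by (rule DERIV_sum, rule derivative_eq_intros, rule has_derivative_inv_metric_at[OF x])
       (auto intro!: derivative_eq_intros simp: metric_at_0)
  moreover have "(\<Sum>n\<in>UNIV. (\<Sum>p\<in>UNIV. \<Sum>q\<in>UNIV. ?i $ m $ p * H x $ p $ q * ?i $ q $ n) * lchr g x j l n) =
      (\<Sum>p\<in>UNIV. ?i $ m $ p * chr_H x j l p)"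
  proof -
    have "(\<Sum>n\<in>UNIV. (\<Sum>p\<in>UNIV. \<Sum>q\<in>UNIV. ?i $ m $ p * H x $ p $ q * ?i $ q $ n) * lchr g x j l n) =
      (\<Sum>p\<in>UNIV. \<Sum>n\<in>UNIV. \<Sum>q\<in>UNIV. ?i $ m $ p * H x $ p $ q * ?i $ q $ n * lchr g x j l n)"
      unfolding sum_distrib_right by (rule sum.swap)
    also have "\<dots> = (\<Sum>p\<in>UNIV. \<Sum>q\<in>UNIV. \<Sum>n\<in>UNIV. ?i $ m $ p * H x $ p $ q * ?i $ q $ n * lchr g x j l n)"
      by (rule sum.cong[OF refl]) (rule sum.swap)
    also have "\<dots> = (\<Sum>p\<in>UNIV. ?i $ m $ p * chr_H x j l p)"
      unfolding chr_H_def christoffel_lchr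
      by (simp add: sum_distrib_left sum_distrib_right mult_ac H.sym[OF x])
    finally show ?thesis .
  qed
  ultimately show ?thesis
    unfolding christoffel_lchr lchr_metric_at[OF x]
    by (elim DERIV_cong) (simp add: sum_subtractf sum.distrib lchr_H[OF x] distrib_left)
qed

text \<open>In the form \<open>riemann_lower\<close> the dependence on s is affine apart from one
  Christoffel factor in each quadratic term, and the derivative of that factor is
  \<open>has_derivative_chr_metric_at\<close>.\<close>

lemma has_derivative_riemann_metric_at_aux:
  assumes x: "x \<in> S"
  shows "((\<lambda>s. riemann (metric_at s) x i j k l) has_real_derivative
    (pd i (\<lambda>y. lchr H y j l k) x - (\<Sum>m\<in>UNIV. lchr H x i k m * christoffel g x m j l + christoffel g x m i k * chr_var x j l m))
    - (pd j (\<lambda>y. lchr H y i l k) x - (\<Sum>m\<in>UNIV. lchr H x j k m * christoffel g x m i l + christoffel g x m j k * chr_var x i l m))) (at 0)"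
proof -
  let ?R = "\<lambda>s. (pd i (\<lambda>y. lchr g y j l k) x + s * pd i (\<lambda>y. lchr H y j l k) x)
     - (pd j (\<lambda>y. lchr g y i l k) x + s * pd j (\<lambda>y. lchr H y i l k) x)
     - (\<Sum>m\<in>UNIV. (lchr g x i k m + s * lchr H x i k m) * christoffel (metric_at s) x m j l)
     + (\<Sum>m\<in>UNIV. (lchr g x j k m + s * lchr H x j k m) * christoffel (metric_at s) x m i l)"
  have eq: "riemann (metric_at s) x i j k l = ?R s" if s: "det (metric_at s x) \<noteq> 0" for s
  proof -
    obtain U where U: "x \<in> U" "U \<subseteq> S" "local_metric (metric_at s) U"
      using local_metric_metric_at[OF x s] by blast
    interpret s: local_metric "metric_at s" U by (rule U)
    have "pd a (\<lambda>y. lchr (metric_at s) y b c d) x = pd a (\<lambda>y. lchr g y b c d) x + s * pd a (\<lambda>y. lchr H y b c d) x" for a b c d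
    proof -
      have "pd a (\<lambda>y. lchr (metric_at s) y b c d) x = pd a (\<lambda>y. lchr g y b c d + s * lchr H y b c d) x"
        by (rule pd_cong_open[OF open_S x]) (rule lchr_metric_at)
      then show ?thesis by (simp add: pd_add pd_cmult diff_lchr[OF x] H.diff_lchr[OF x] differentiable_mult)
    qed
    then show ?thesis unfolding s.riemann_lower[OF U(1)] by (simp add: lchr_metric_at[OF x])
  qed
  have Q: "((\<lambda>s. \<Sum>m\<in>UNIV. (lchr g x i k m + s * lchr H x i k m) * christoffel (metric_at s) x m j l) has_real_derivative
      (\<Sum>m\<in>UNIV. lchr H x i k m * christoffel g x m j l + christoffel g x m i k * chr_var x j l m)) (at 0)" for i j
  proof -
    have "((\<lambda>s. \<Sum>m\<in>UNIV. (lchr g x i k m + s * lchr H x i k m) * christoffel (metric_at s) x m j l) has_real_derivative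
       (\<Sum>m\<in>UNIV. lchr H x i k m * christoffel g x m j l + (\<Sum>n\<in>UNIV. matrix_inv (g x) $ m $ n * chr_var x j l n) * lchr g x i k m)) (at 0)"
      by (rule DERIV_sum, rule derivative_eq_intros, (rule derivative_eq_intros refl)+, rule has_derivative_chr_metric_at[OF x])
         (simp add: metric_at_0)
    moreover have "(\<Sum>m\<in>UNIV. (\<Sum>n\<in>UNIV. matrix_inv (g x) $ m $ n * chr_var x j l n) * lchr g x i k m) =
        (\<Sum>m\<in>UNIV. christoffel g x m i k * chr_var x j l m)"
      unfolding christoffel_lchr sum_distrib_right
      by (subst sum.swap) (simp add: inv_sym[OF x] mult_ac)
    ultimately show ?thesis by (simp add: sum.distrib)
  qed
  have "(?R has_real_derivative
    (pd i (\<lambda>y. lchr H y j l k) x - pd j (\<lambda>y. lchr H y i l k) x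
      - (\<Sum>m\<in>UNIV. lchr H x i k m * christoffel g x m j l + christoffel g x m i k * chr_var x j l m)
      + (\<Sum>m\<in>UNIV. lchr H x j k m * christoffel g x m i l + christoffel g x m j k * chr_var x i l m))) (at 0)"
    by (intro DERIV_add DERIV_diff Q) (auto intro!: derivative_eq_intros)
  moreover have "\<forall>\<^sub>F s in nhds 0. riemann (metric_at s) x i j k l = ?R s"
    using eventually_metric_at[OF x] by eventually_elim (rule eq)
  ultimately show ?thesis by (subst DERIV_cong_ev[OF refl _ refl]) (auto simp: algebra_simps)
qed


text \<open>\<open>lchr H\<close> and the derivative of \<open>H\<close> are split into tensorial
  and Christoffel parts. The latter collect into \<open>H\<close> times one of the two halves of
  \<open>curv_endo\<close>; antisymmetrization in i and j supplies the other half.\<close>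

lemma riemann_var_aux:
  assumes x: "x \<in> S"
  shows "pd i (\<lambda>y. lchr H y j l k) x - (\<Sum>m\<in>UNIV. lchr H x i k m * christoffel g x m j l + christoffel g x m i k * chr_var x j l m) =
    (\<Sum>m\<in>UNIV. H x $ k $ m * (pd i (\<lambda>y. christoffel g y m j l) x + (\<Sum>p\<in>UNIV. christoffel g x p j l * christoffel g x m i p)))
    + pd i (\<lambda>y. chr_var y j l k) x + (\<Sum>m\<in>UNIV. christoffel g x m j l * chr_var x i m k)
    - (\<Sum>m\<in>UNIV. christoffel g x m i k * chr_var x j l m)"
proof -
  have 1: "(\<Sum>m\<in>UNIV. H x $ k $ m * (\<Sum>p\<in>UNIV. christoffel g x p j l * christoffel g x m i p)) =
      (\<Sum>m\<in>UNIV. christoffel g x m j l * chr_H x i m k)"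
    unfolding chr_H_def sum_distrib_left
    by (subst sum.swap) (simp add: H.sym[OF x, of k] mult_ac)
  show ?thesis
    unfolding pd_chr_var[OF x] pd_H[OF x] lchr_H[OF x]
    using 1 by (simp add: distrib_left distrib_right sum.distrib H.sym[OF x, of k] mult_ac)
qed

lemma has_derivative_riemann_metric_at:
  assumes x: "x \<in> S"
  shows "((\<lambda>s. riemann (metric_at s) x i j k l) has_real_derivative
    (\<Sum>m\<in>UNIV. H x $ k $ m * curv_endo g x i j l m) +
    (cov3 g (cov2 g H) x i j l k + cov3 g (cov2 g H) x i l j k - cov3 g (cov2 g H) x i k j l) / 2 -
    (cov3 g (cov2 g H) x j i l k + cov3 g (cov2 g H) x j l i k - cov3 g (cov2 g H) x j k i l) / 2) (at 0)"
proof -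
  have "(\<Sum>m\<in>UNIV. H x $ k $ m * curv_endo g x i j l m) =
     (\<Sum>m\<in>UNIV. H x $ k $ m * (pd i (\<lambda>y. christoffel g y m j l) x + (\<Sum>p\<in>UNIV. christoffel g x p j l * christoffel g x m i p)))
   - (\<Sum>m\<in>UNIV. H x $ k $ m * (pd j (\<lambda>y. christoffel g y m i l) x + (\<Sum>p\<in>UNIV. christoffel g x p i l * christoffel g x m j p)))"
    by (simp add: curv_endo_def sum_subtractf sum.distrib right_diff_distrib distrib_left)
  \<comment> \<open>Of the Christoffel terms in \<open>cov_chr_var\<close> this one has no
    counterpart in \<open>riemann_var_aux\<close>; being symmetric in i and j, it drops out of the
    difference.\<close>
  moreover have "(\<Sum>m\<in>UNIV. christoffel g x m i j * chr_var x m l k) = (\<Sum>m\<in>UNIV. christoffel g x m j i * chr_var x m l k)"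
    by (simp only: chr_sym[OF x, of _ i j])
  ultimately show ?thesis
    using has_derivative_riemann_metric_at_aux[OF x, of i j k l]
    unfolding riemann_var_aux[OF x] cov_chr_var[OF x]
    by (elim DERIV_cong) (simp add: chr_var_sym[OF x, of _ j] chr_var_sym[OF x, of _ i])
qed

text \<open>The Ricci identity, by direct expansion in coordinates.\<close>

lemma cov3_commute:
  assumes x: "x \<in> S"
  shows "cov3 g (cov2 g H) x k l i j - cov3 g (cov2 g H) x l k i j =
    - (\<Sum>m\<in>UNIV. curv_endo g x k l i m * H x $ m $ j) - (\<Sum>m\<in>UNIV. curv_endo g x k l j m * H x $ i $ m)"
proof -
  let ?G = "christoffel g x" and ?N = "cov2 g H x"
  \<comment> \<open>The four kinds of terms in the derivative of \<open>chr_H\<close>: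
    \<open>P\<close> differentiates the Christoffel symbol, \<open>V\<close> contains a covariant
    derivative of \<open>H\<close>, \<open>W\<close> and \<open>Z\<close> are quadratic in the
    Christoffel symbols. In the commutator \<open>V\<close> and \<open>Z\<close> cancel, while
    \<open>P\<close> and \<open>W\<close> make up the curvature.\<close>
  define P where "P k l i j = (\<Sum>m\<in>UNIV. pd k (\<lambda>y. christoffel g y m l i) x * H x $ m $ j)" for k l i j
  define V where "V k l i j = (\<Sum>m\<in>UNIV. ?G m l i * ?N $ k $ m $ j)" for k l i j
  define W where "W k l i j = (\<Sum>m\<in>UNIV. ?G m l i * chr_H x k m j)" for k l i j
  define Z where "Z k l i j = (\<Sum>m\<in>UNIV. ?G m l i * chr_H x k j m)" for k l i j
  have chr: "pd k (\<lambda>y. chr_H y l i j) x = P k l i j + V k l i j + W k l i j + Z k l i j" for k l i j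
  proof -
    have "pd k (\<lambda>y. chr_H y l i j) x = (\<Sum>m\<in>UNIV. pd k (\<lambda>y. christoffel g y m l i * H y $ m $ j) x)"
      unfolding chr_H_def by (intro pd_sum differentiable_mult diff_chr H.diff_nth x)
    also have "\<dots> = (\<Sum>m\<in>UNIV. ?G m l i * pd k H x $ m $ j + pd k (\<lambda>y. christoffel g y m l i) x * H x $ m $ j)"
      by (simp only: pd_mult[OF diff_chr[OF x] H.diff_nth[OF x]] H.pd_nth_nth[OF x])
    also have "\<dots> = (\<Sum>m\<in>UNIV. ?G m l i * (?N $ k $ m $ j + chr_H x k m j + chr_H x k j m) + pd k (\<lambda>y. christoffel g y m l i) x * H x $ m $ j)"
      by (simp add: cov2_chr_H[OF x])
    finally show ?thesis
      by (simp add: P_def V_def W_def Z_def sum.distrib distrib_left)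
  qed
  have N: "pd k (\<lambda>y. cov2 g H y $ l $ i $ j) x = pd k (\<lambda>y. pd l H y $ i $ j) x
      - (P k l i j + V k l i j + W k l i j + Z k l i j) - (P k l j i + V k l j i + W k l j i + Z k l j i)" for k l
  proof -
    have "pd k (\<lambda>y. cov2 g H y $ l $ i $ j) x = pd k (\<lambda>y. pd l H y $ i $ j - chr_H y l i j - chr_H y l j i) x"
      by (rule pd_cong_open[OF open_S x]) (rule cov2_chr_H)
    also have "\<dots> = pd k (\<lambda>y. pd l H y $ i $ j) x - pd k (\<lambda>y. chr_H y l i j) x - pd k (\<lambda>y. chr_H y l j i) x"
      by (simp add: pd_diff H.diff_pd diff_chr_H x differentiable_diff)
    finally show ?thesis by (simp only: chr)
  qed
  have Z: "Z k l i j = Z l k j i" for k l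
    unfolding Z_def chr_H_def sum_distrib_left
    by (subst sum.swap) (simp add: H.sym[OF x] mult_ac)
  have C: "cov3 g (cov2 g H) x k l i j = pd k (\<lambda>y. cov2 g H y $ l $ i $ j) x
      - (\<Sum>m\<in>UNIV. ?G m k l * ?N $ m $ i $ j) - V l k i j - V l k j i" for k l
    unfolding cov3_cov2[OF x] V_def
    by (simp add: sum.distrib cov2_sym[OF x, of l i] )
  have E: "(\<Sum>m\<in>UNIV. curv_endo g x k l i m * H x $ m $ j) = P k l i j - P l k i j + W k l i j - W l k i j" for i j
  proof -
    have W: "W k l i j = (\<Sum>m\<in>UNIV. (\<Sum>p\<in>UNIV. ?G p l i * ?G m k p) * H x $ m $ j)" for k l
      unfolding W_def chr_H_def sum_distrib_left sum_distrib_right by (subst sum.swap) (simp add: mult_ac)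
    show ?thesis unfolding W
      by (simp add: P_def curv_endo_def sum_subtractf sum.distrib left_diff_distrib distrib_right)
  qed
  have E': "(\<Sum>m\<in>UNIV. curv_endo g x k l j m * H x $ i $ m) = P k l j i - P l k j i + W k l j i - W l k j i"
    using E[of j i] by (simp add: H.sym[OF x, of i])
  have G: "(\<Sum>m\<in>UNIV. ?G m k l * ?N $ m $ i $ j) = (\<Sum>m\<in>UNIV. ?G m l k * ?N $ m $ i $ j)"
    by (simp only: chr_sym[OF x, of _ k l])
  show ?thesis
    unfolding C N E E' G
    using Z[of k l] Z[of l k] H.pd_pd_commute[OF x, of k l i j] by argo
qed

end

section \<open>The cylinder\<close>

lemma UNIV_option: "(UNIV :: 'n option set) = insert None (range Some)"
  by (auto simp: notin_range_Some)

lemma sum_option: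
  fixes f :: "'n::finite option \<Rightarrow> 'b::comm_monoid_add"
  shows "(\<Sum>a\<in>UNIV. f a) = f None + (\<Sum>i\<in>UNIV. f (Some i))"
  unfolding UNIV_option by (simp add: sum.reindex)

definition cyl_proj :: "real^('n::finite option) \<Rightarrow> real^'n" where
  "cyl_proj X = (\<chi> k. X $ Some k)"

definition cyl_set :: "(real^'n::finite) set \<Rightarrow> (real^('n option)) set" where
  "cyl_set S = {X. cyl_proj X \<in> S}"

lemma cyl_point_nth [simp]: "cyl_point t x $ None = t" "cyl_point t x $ Some i = x $ i"
  by (simp_all add: cyl_point_def)

lemma cyl_proj_point [simp]: "cyl_proj (cyl_point t x) = x"
  by (simp add: cyl_proj_def vec_eq_iff)

lemma cyl_proj_axis [simp]: "cyl_proj (axis None 1) = 0" "cyl_proj (axis (Some k) 1) = axis k 1"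
  by (simp_all add: cyl_proj_def vec_eq_iff axis_def)

lemma cyl_point_mem [simp]: "cyl_point t x \<in> cyl_set S \<longleftrightarrow> x \<in> S"
  by (simp add: cyl_set_def)

lemma bounded_linear_cyl_proj: "bounded_linear (cyl_proj :: real^('n::finite option) \<Rightarrow> _)"
  unfolding linear_conv_bounded_linear[symmetric] by (rule linearI) (simp_all add: cyl_proj_def vec_eq_iff)

lemma bounded_linear_cyl_point: "bounded_linear (cyl_point 0 :: real^'n::finite \<Rightarrow> _)"
  unfolding linear_conv_bounded_linear[symmetric]
  by (rule linearI) (auto simp: cyl_point_def vec_eq_iff split: option.splits)

lemma cyl_point_eq: "cyl_point t x = t *\<^sub>R axis None 1 + cyl_point 0 x"
  by (auto simp: cyl_point_def vec_eq_iff axis_def split: option.splits)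

lemma cyl_point_axis: "cyl_point 0 (axis k 1) = axis (Some k) 1"
  by (auto simp: cyl_point_def vec_eq_iff axis_def split: option.splits)

lemma has_derivative_cyl_point: "(cyl_point t has_derivative cyl_point 0) (at x)"
  unfolding cyl_point_eq[of t, abs_def]
  by (auto intro!: derivative_eq_intros bounded_linear.has_derivative[OF bounded_linear_cyl_point])

lemma open_cyl_set: "open S \<Longrightarrow> open (cyl_set S)"
  using continuous_open_vimage[of S cyl_proj] linear_continuous_at[OF bounded_linear_cyl_proj]
  by (auto simp: cyl_set_def vimage_def)

section \<open>Calculus for pullbacks along the projection and for restrictions to slices\<close>

lemma has_derivative_comp_proj:
  assumes "f differentiable at (cyl_proj X)"
  shows "((\<lambda>X. f (cyl_proj X)) has_derivative (\<lambda>v. frechet_derivative f (at (cyl_proj X)) (cyl_proj v))) (at X)"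
  by (rule has_derivative_compose[OF bounded_linear.has_derivative[OF bounded_linear_cyl_proj has_derivative_ident]
      pd_has_derivative[OF assms]])

lemma differentiable_comp_proj:
  "f differentiable at (cyl_proj X) \<Longrightarrow> (\<lambda>X. f (cyl_proj X)) differentiable at X"
  using has_derivative_comp_proj differentiableI by blast

lemma pd_comp_proj:
  assumes "f differentiable at (cyl_proj X)"
  shows "pd None (\<lambda>X. f (cyl_proj X)) X = 0"
    and "pd (Some k) (\<lambda>X. f (cyl_proj X)) X = pd k f (cyl_proj X)"
  unfolding pd_eqI[OF has_derivative_comp_proj[OF assms]] cyl_proj_axis
  using linear_frechet_derivative[OF assms] by (simp_all only: linear_0 pd_def)

lemma has_derivative_slice:
  assumes "F differentiable at (cyl_point t y)"
  shows "((\<lambda>y. F (cyl_point t y)) has_derivative (\<lambda>v. frechet_derivative F (at (cyl_point t y)) (cyl_point 0 v))) (at y)"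
  by (rule has_derivative_compose[OF has_derivative_cyl_point pd_has_derivative[OF assms]])

lemma differentiable_slice:
  "F differentiable at (cyl_point t y) \<Longrightarrow> (\<lambda>y. F (cyl_point t y)) differentiable at y"
  using has_derivative_slice differentiableI by blast

lemma pd_slice:
  assumes "F differentiable at (cyl_point t y)"
  shows "pd k (\<lambda>y. F (cyl_point t y)) y = pd (Some k) F (cyl_point t y)"
  unfolding pd_eqI[OF has_derivative_slice[OF assms], of k] cyl_point_axis by (simp only: pd_def)

lemma has_vector_derivative_slice:
  assumes "F differentiable at (cyl_point t y)"
  shows "((\<lambda>s. F (cyl_point s y)) has_vector_derivative pd None F (cyl_point t y)) (at t)"
proof -
  have "((\<lambda>s. s *\<^sub>R axis None 1 + cyl_point 0 y) has_derivative (\<lambda>s. s *\<^sub>R axis None 1)) (at t)"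
    by (auto intro!: derivative_eq_intros)
  then have "((\<lambda>s. cyl_point s y) has_derivative (\<lambda>s. s *\<^sub>R axis None 1)) (at t)"
    by (simp only: cyl_point_eq[symmetric])
  from has_derivative_compose[OF this pd_has_derivative[OF assms]] show ?thesis
    using linear_frechet_derivative[OF assms]
    by (simp add: has_vector_derivative_def pd_def linear_scale)
qed

lemma C2_on_comp_proj:
  assumes "open S" "C2_on S f"
  shows "C2_on (cyl_set S) (\<lambda>X. f (cyl_proj X))"
proof -
  note o = open_cyl_set[OF assms(1)]
  have f: "f differentiable at (cyl_proj X)" and pf: "pd k f differentiable at (cyl_proj X)"
    and c: "pd k (pd l f) (cyl_proj X) = pd l (pd k f) (cyl_proj X)" if "X \<in> cyl_set S" for X k l
    using assms(2) that unfolding C2_on_def cyl_set_def by blast+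
  have p: "pd a (\<lambda>X. f (cyl_proj X)) X = (case a of None \<Rightarrow> 0 | Some k \<Rightarrow> pd k f (cyl_proj X))"
    if "X \<in> cyl_set S" for X a
    using pd_comp_proj[OF f[OF that]] by (simp split: option.split)
  have pp: "pd a (pd b (\<lambda>X. f (cyl_proj X))) X =
      (case b of None \<Rightarrow> 0 | Some l \<Rightarrow> case a of None \<Rightarrow> 0 | Some k \<Rightarrow> pd k (pd l f) (cyl_proj X))"
    if X: "X \<in> cyl_set S" for X a b
  proof -
    have "pd a (pd b (\<lambda>X. f (cyl_proj X))) X = pd a (\<lambda>X. case b of None \<Rightarrow> 0 | Some k \<Rightarrow> pd k f (cyl_proj X)) X"
      by (rule pd_cong_open[OF o X]) (rule p)
    then show ?thesis using pd_comp_proj[OF pf[OF X]] by (simp split: option.split)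
  qed
  have "pd a (\<lambda>X. f (cyl_proj X)) differentiable at X" if X: "X \<in> cyl_set S" for a X
    by (rule differentiable_cong_open[OF o X, of "\<lambda>X. case a of None \<Rightarrow> 0 | Some k \<Rightarrow> pd k f (cyl_proj X)"])
       (use p differentiable_comp_proj[OF pf[OF X]] in \<open>cases a; simp\<close>)+
  then show ?thesis
    unfolding C2_on_def
    by (intro ballI conjI allI) (simp_all add: pp f differentiable_comp_proj c split: option.split)
qed

lemma C2_on_slice:
  assumes "open S" "C2_on (cyl_set S) F"
  shows "C2_on S (\<lambda>y. F (cyl_point t y))"
proof -
  have f: "F differentiable at (cyl_point t y)" and pf: "pd k F differentiable at (cyl_point t y)"
    and c: "pd k (pd l F) (cyl_point t y) = pd l (pd k F) (cyl_point t y)" if "y \<in> S" for y k l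
    using assms(2) that unfolding C2_on_def by simp_all
  have p: "pd k (\<lambda>y. F (cyl_point t y)) y = pd (Some k) F (cyl_point t y)" if "y \<in> S" for y k
    by (rule pd_slice[OF f[OF that]])
  have pp: "pd k (pd l (\<lambda>y. F (cyl_point t y))) y = pd (Some k) (pd (Some l) F) (cyl_point t y)" if y: "y \<in> S" for y k l
  proof -
    have "pd k (pd l (\<lambda>y. F (cyl_point t y))) y = pd k (\<lambda>y. pd (Some l) F (cyl_point t y)) y"
      by (rule pd_cong_open[OF assms(1) y]) (rule p)
    then show ?thesis by (simp add: pd_slice[OF pf[OF y]])
  qed
  have "pd k (\<lambda>y. F (cyl_point t y)) differentiable at y" if y: "y \<in> S" for k y
    by (rule differentiable_cong_open[OF assms(1) y, of "\<lambda>y. pd (Some k) F (cyl_point t y)"])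
       (use p differentiable_slice[OF pf[OF y]] in simp_all)
  then show ?thesis
    unfolding C2_on_def using f c by (intro ballI conjI allI) (simp_all add: pp differentiable_slice)
qed

section \<open>The product metric: inverse, Christoffel symbols and curvature\<close>

lemma cyl_metric_nth [simp]:
  "cyl_metric g X $ None $ None = 1" "cyl_metric g X $ None $ Some j = 0" "cyl_metric g X $ Some i $ None = 0"
  "cyl_metric g X $ Some i $ Some j = g (cyl_proj X) $ i $ j"
  by (simp_all add: cyl_metric_def cyl_proj_def)

lemma forall_option: "(\<forall>a. P a) \<longleftrightarrow> P None \<and> (\<forall>i. P (Some i))"
  by (metis not_None_eq)

lemma matrix_mult_cyl_metric:
  "cyl_metric g X ** cyl_metric g' X = cyl_metric (\<lambda>y. g y ** g' y) X"
  by (simp add: vec_eq_iff matrix_matrix_mult_def sum_option forall_option)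

lemma cyl_metric_mat: "cyl_metric (\<lambda>y. mat 1) X = mat 1"
  by (simp add: vec_eq_iff mat_def forall_option)

context local_metric begin

lemma matrix_inv_cyl: "X \<in> cyl_set S \<Longrightarrow> matrix_inv (cyl_metric g X) = cyl_metric (\<lambda>y. matrix_inv (g y)) X"
proof (rule matrix_inv_unique)
  assume "X \<in> cyl_set S"
  then have "g (cyl_proj X) ** matrix_inv (g (cyl_proj X)) = mat 1"
    by (intro matrix_inv_right nz) (simp add: cyl_set_def)
  then have "cyl_metric (\<lambda>y. g y ** matrix_inv (g y)) X = cyl_metric (\<lambda>y. mat 1) X"
    by (simp add: vec_eq_iff forall_option)
  then show "cyl_metric g X ** cyl_metric (\<lambda>y. matrix_inv (g y)) X = mat 1"
    by (simp add: matrix_mult_cyl_metric cyl_metric_mat)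
qed

lemma local_metric_cyl: "local_metric (cyl_metric g) (cyl_set S)"
proof
  show "open (cyl_set S)" by (rule open_cyl_set[OF open_S])
  show "C2_on (cyl_set S) (\<lambda>y. cyl_metric g y $ i $ j)" for i j
  proof -
    have [simp]: "C2_on (cyl_set S) (\<lambda>y. c)" for c by (simp add: C2_on_def pd_def[abs_def])
    show ?thesis using C2_on_comp_proj[OF open_S C2] by (cases i; cases j) simp_all
  qed
  show "cyl_metric g y $ i $ j = cyl_metric g y $ j $ i" if "y \<in> cyl_set S" for y i j
    using sym[of "cyl_proj y"] that by (cases i; cases j) (simp_all add: cyl_set_def)
  show "det (cyl_metric g y) \<noteq> 0" if "y \<in> cyl_set S" for y
  proof -
    have "g (cyl_proj y) ** matrix_inv (g (cyl_proj y)) = mat 1"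
      using that by (intro matrix_inv_right nz) (simp add: cyl_set_def)
    then have "cyl_metric (\<lambda>y. g y ** matrix_inv (g y)) y = cyl_metric (\<lambda>y. mat 1) y"
      by (simp add: vec_eq_iff forall_option)
    then have "cyl_metric g y ** cyl_metric (\<lambda>y. matrix_inv (g y)) y = mat 1"
      by (simp add: matrix_mult_cyl_metric cyl_metric_mat)
    then show ?thesis by (metis invertible_det_nz invertible_right_inverse)
  qed
qed

end

locale cylinder = local_metric g S for g :: "real^'n::finite \<Rightarrow> real^'n^'n" and S
begin

sublocale M: local_metric "cyl_metric g" "cyl_set S"
  by (rule local_metric_cyl)

lemma pd_cyl_metric:
  assumes X: "X \<in> cyl_set S"
  shows "pd None (cyl_metric g) X $ a $ b = 0"
    and "pd (Some k) (cyl_metric g) X $ None $ b = 0"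
    and "pd (Some k) (cyl_metric g) X $ a $ None = 0"
    and "pd (Some k) (cyl_metric g) X $ Some i $ Some j = pd k g (cyl_proj X) $ i $ j"
proof -
  have x: "cyl_proj X \<in> S" using X by (simp add: cyl_set_def)
  note d = diff_nth[OF x]
  show "pd None (cyl_metric g) X $ a $ b = 0"
    using pd_comp_proj(1)[OF d] by (cases a; cases b) (simp_all add: M.pd_nth_nth[OF X])
  show "pd (Some k) (cyl_metric g) X $ None $ b = 0" "pd (Some k) (cyl_metric g) X $ a $ None = 0"
    by (cases a; cases b; simp add: M.pd_nth_nth[OF X])+
  show "pd (Some k) (cyl_metric g) X $ Some i $ Some j = pd k g (cyl_proj X) $ i $ j"
    using pd_comp_proj(2)[OF d] by (simp add: M.pd_nth_nth[OF X] pd_nth_nth[OF x])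
qed

lemma lchr_cyl:
  assumes X: "X \<in> cyl_set S"
  shows "lchr (cyl_metric g) X None b c = 0" "lchr (cyl_metric g) X a None c = 0" "lchr (cyl_metric g) X a b None = 0"
    "lchr (cyl_metric g) X (Some i) (Some j) (Some k) = lchr g (cyl_proj X) i j k"
proof -
  have *: "pd a (cyl_metric g) X $ None $ b = 0" "pd a (cyl_metric g) X $ b $ None = 0" for a b
    using pd_cyl_metric[OF X] by (cases a; simp)+
  show "lchr (cyl_metric g) X None b c = 0" "lchr (cyl_metric g) X a None c = 0" "lchr (cyl_metric g) X a b None = 0"
    "lchr (cyl_metric g) X (Some i) (Some j) (Some k) = lchr g (cyl_proj X) i j k"
    by (simp_all add: lchr_def * pd_cyl_metric[OF X])
qed

text \<open>The metric is a product with a flat line. As the symbols with an index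
  \<open>None\<close> vanish, covariant differentiation on the cylinder becomes plain
  differentiation in t and the covariant derivative of Y on the parts of a tensor.\<close>

lemma chr_cyl:
  assumes X: "X \<in> cyl_set S"
  shows "christoffel (cyl_metric g) X None b c = 0" "christoffel (cyl_metric g) X a None c = 0"
    "christoffel (cyl_metric g) X a b None = 0"
    "christoffel (cyl_metric g) X (Some k) (Some i) (Some j) = christoffel g (cyl_proj X) k i j"
  by (simp_all add: christoffel_lchr matrix_inv_cyl[OF X] sum_option lchr_cyl[OF X])

lemma pd_chr_cyl:
  assumes X: "X \<in> cyl_set S"
  shows "pd d (\<lambda>X. christoffel (cyl_metric g) X None b c) X = 0"
    "pd d (\<lambda>X. christoffel (cyl_metric g) X a None c) X = 0"
    "pd d (\<lambda>X. christoffel (cyl_metric g) X a b None) X = 0"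
    "pd None (\<lambda>X. christoffel (cyl_metric g) X a b c) X = 0"
    "pd (Some l) (\<lambda>X. christoffel (cyl_metric g) X (Some k) (Some i) (Some j)) X = pd l (\<lambda>y. christoffel g y k i j) (cyl_proj X)"
proof -
  have x: "cyl_proj X \<in> S" using X by (simp add: cyl_set_def)
  note o = open_cyl_set[OF open_S]
  show z: "pd d (\<lambda>X. christoffel (cyl_metric g) X None b c) X = 0"
    "pd d (\<lambda>X. christoffel (cyl_metric g) X a None c) X = 0"
    "pd d (\<lambda>X. christoffel (cyl_metric g) X a b None) X = 0" for a b c d
    by (subst pd_cong_open[OF o X, where h = "\<lambda>X. 0"]; simp add: chr_cyl)+
  have "pd d (\<lambda>X. christoffel (cyl_metric g) X (Some k) (Some i) (Some j)) X =
      pd d (\<lambda>X. christoffel g (cyl_proj X) k i j) X" for d k i j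
    by (rule pd_cong_open[OF o X]) (simp add: chr_cyl)
  with pd_comp_proj[OF diff_chr[OF x]] show
    "pd (Some l) (\<lambda>X. christoffel (cyl_metric g) X (Some k) (Some i) (Some j)) X = pd l (\<lambda>y. christoffel g y k i j) (cyl_proj X)"
    "pd None (\<lambda>X. christoffel (cyl_metric g) X a b c) X = 0"
    by (simp_all, (cases a; cases b; cases c; simp add: z))
qed

lemma curv_endo_cyl:
  assumes X: "X \<in> cyl_set S"
  shows "curv_endo (cyl_metric g) X None b c d = 0" "curv_endo (cyl_metric g) X a None c d = 0"
    "curv_endo (cyl_metric g) X a b None d = 0" "curv_endo (cyl_metric g) X a b c None = 0"
    "curv_endo (cyl_metric g) X (Some i) (Some j) (Some k) (Some l) = curv_endo g (cyl_proj X) i j k l"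
  by (simp_all add: curv_endo_def sum_option chr_cyl[OF X] pd_chr_cyl[OF X])

lemma riemann_cyl:
  assumes X: "X \<in> cyl_set S"
  shows "riemann (cyl_metric g) X None b c d = 0" "riemann (cyl_metric g) X a None c d = 0"
    "riemann (cyl_metric g) X a b None d = 0" "riemann (cyl_metric g) X a b c None = 0"
    "riemann (cyl_metric g) X (Some i) (Some j) (Some k) (Some l) = riemann g (cyl_proj X) i j k l"
  by (simp_all add: riemann_def sum_option curv_endo_cyl[OF X])

end

locale cyl_variation = cylinder g S + H: C2_field H "cyl_set S"
  for g :: "real^'n::finite \<Rightarrow> real^'n^'n" and S and H :: "real^('n option) \<Rightarrow> real^('n option)^('n option)"
begin

sublocale V: metric_variation "cyl_metric g" H "cyl_set S" ..

lemma C2_field_partYY: "C2_field (partYY H t) S"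
proof
  show "C2_on S (\<lambda>y. partYY H t y $ i $ j)" for i j
    unfolding partYY_def by (simp add: C2_on_slice[OF open_S H.C2])
qed (use open_S H.sym in \<open>simp_all add: partYY_def\<close>)

lemma metric_variation_partYY: "metric_variation g (partYY H t) S"
  by (intro metric_variation.intro C2_field_partYY local_metric_axioms)

abbreviation "\<Gamma> \<equiv> christoffel g"
abbreviation "N X a b c \<equiv> cov2 (cyl_metric g) H X $ a $ b $ c"
abbreviation "N2 X \<equiv> cov3 (cyl_metric g) (cov2 (cyl_metric g) H) X"

section \<open>Operators on the parts as components of covariant derivatives on the cylinder\<close>

lemma pd_part:
  assumes y: "y \<in> S"
  shows "pd k (\<lambda>y. H (cyl_point t y) $ a $ b) y = pd (Some k) H (cyl_point t y) $ a $ b"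
proof -
  have X: "cyl_point t y \<in> cyl_set S" using y by simp
  show ?thesis by (simp add: H.pd_nth_nth[OF X] pd_slice[OF H.diff_nth[OF X]])
qed

lemma diff_part: "y \<in> S \<Longrightarrow> (\<lambda>y. H (cyl_point t y) $ a $ b) differentiable at y"
  by (rule differentiable_slice) (simp add: H.diff_nth)

lemma diff_part': "y \<in> S \<Longrightarrow> part0Y H t differentiable at y" "y \<in> S \<Longrightarrow> part00 H t differentiable at y"
  "y \<in> S \<Longrightarrow> partYY H t differentiable at y"
  by (auto intro!: differentiable_vecI simp: diff_part part0Y_def part00_def[abs_def] partYY_def)

lemma d0_part00: "y \<in> S \<Longrightarrow> d0 (part00 H t) y = (\<chi> k. N (cyl_point t y) (Some k) None None)"
  by (simp add: d0_def vec_eq_iff part00_def[abs_def] pd_part cov2_nth sum_option chr_cyl)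

lemma cov1_part0Y: "y \<in> S \<Longrightarrow> cov1 g (part0Y H t) y = (\<chi> k j. N (cyl_point t y) (Some k) None (Some j))"
  by (simp add: cov1_def vec_eq_iff pd_nth diff_part' cov2_nth sum_option chr_cyl)
     (simp add: part0Y_def pd_part)

lemma cov2_partYY: "y \<in> S \<Longrightarrow> cov2 g (partYY H t) y = (\<chi> k i j. N (cyl_point t y) (Some k) (Some i) (Some j))"
  by (simp add: vec_eq_iff cov2_nth pd_nth diff_part' differentiable_vec_nth sum_option chr_cyl)
     (simp add: partYY_def pd_part)

end

lemma has_vector_derivative_vec_lambda:
  fixes f :: "real \<Rightarrow> 'a::finite \<Rightarrow> 'b::euclidean_space"
  assumes "\<And>i. ((\<lambda>s. f s i) has_vector_derivative D i) (at t)"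
  shows "((\<lambda>s. \<chi> i. f s i) has_vector_derivative (\<chi> i. D i)) (at t)"
proof -
  have "((\<lambda>s. (\<chi> i. f s i) \<bullet> b) has_derivative (\<lambda>s. (s *\<^sub>R (\<chi> i. D i)) \<bullet> b)) (at t)" if *: "b \<in> Basis" for b
  proof -
    obtain i c where b: "b = axis i c" using * by (auto simp: Basis_vec_def)
    show ?thesis
      using has_derivative_inner_left[OF assms[of i, unfolded has_vector_derivative_def], of c]
      by (simp add: b inner_axis)
  qed
  then show ?thesis
    unfolding has_vector_derivative_def by (subst has_derivative_componentwise_within) blast
qed

context cyl_variation begin

lemma has_vector_derivative_part_nth:
  assumes y: "y \<in> S"
  shows "((\<lambda>s. H (cyl_point s y) $ a $ b) has_vector_derivative N (cyl_point t y) None a b) (at t)"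
proof -
  have X: "cyl_point t y \<in> cyl_set S" using y by simp
  show ?thesis
    using has_vector_derivative_slice[OF H.diff_nth[OF X]]
    by (simp add: cov2_nth sum_option chr_cyl[OF X] H.pd_nth_nth[OF X])
qed

lemma dot_part0Y: "y \<in> S \<Longrightarrow> dot (part0Y H) t y = (\<chi> i. N (cyl_point t y) None None (Some i))"
  unfolding dot_def part0Y_def
  by (intro vector_derivative_at has_vector_derivative_vec_lambda has_vector_derivative_part_nth)

lemma dot_partYY: "y \<in> S \<Longrightarrow> dot (partYY H) t y = (\<chi> i j. N (cyl_point t y) None (Some i) (Some j))"
  unfolding dot_def partYY_def
  by (intro vector_derivative_at has_vector_derivative_vec_lambda has_vector_derivative_part_nth)

lemma pd_N_slice:
  "y \<in> S \<Longrightarrow> pd k (\<lambda>y. N (cyl_point t y) a b c) y = pd (Some k) (\<lambda>X. N X a b c) (cyl_point t y)"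
  by (rule pd_slice) (simp add: V.diff_cov2)

lemma diff_N_slice: "y \<in> S \<Longrightarrow> (\<lambda>y. N (cyl_point t y) a b c) differentiable at y"
  by (rule differentiable_slice) (simp add: V.diff_cov2)

lemma N2_eq: "X \<in> cyl_set S \<Longrightarrow> N2 X a b c d = pd a (\<lambda>X. N X b c d) X
     - (\<Sum>m\<in>UNIV. (christoffel (cyl_metric g) X m a b * N X m c d + christoffel (cyl_metric g) X m a c * N X b m d
              + christoffel (cyl_metric g) X m a d * N X b c m))"
  by (rule V.cov3_cov2)

lemma dot_dot_partYY:
  assumes y: "y \<in> S"
  shows "dot (dot (partYY H)) t y = (\<chi> i j. N2 (cyl_point t y) None None (Some i) (Some j))"
proof -
  have X: "cyl_point t y \<in> cyl_set S" using y by simp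
  have "((\<lambda>s. N (cyl_point s y) None (Some i) (Some j)) has_vector_derivative N2 (cyl_point t y) None None (Some i) (Some j)) (at t)" for i j
    using has_vector_derivative_slice[OF V.diff_cov2[OF X]]
    by (simp add: N2_eq[OF X] chr_cyl[OF X] sum_option)
  then show ?thesis
    unfolding dot_def[of "dot (partYY H)"] dot_partYY[OF y]
    by (intro vector_derivative_at has_vector_derivative_vec_lambda)
qed

lemma cov3_partYY:
  assumes y: "y \<in> S"
  shows "cov3 g (cov2 g (partYY H t)) y k l i j = N2 (cyl_point t y) (Some k) (Some l) (Some i) (Some j)"
proof -
  interpret Y: metric_variation g "partYY H t" S by (rule metric_variation_partYY)
  have X: "cyl_point t y \<in> cyl_set S" using y by simp
  have "pd k (\<lambda>y. cov2 g (partYY H t) y $ l $ i $ j) y = pd k (\<lambda>y. N (cyl_point t y) (Some l) (Some i) (Some j)) y"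
    by (rule pd_cong_open[OF open_S y]) (simp add: cov2_partYY)
  then show ?thesis
    by (simp add: Y.cov3_cov2[OF y] N2_eq[OF X] pd_N_slice[OF y] chr_cyl[OF X] sum_option cov2_partYY[OF y])
qed

text \<open>The functions \<open>a\<close>, \<open>b\<close>, \<open>c\<close> tell which slot of
  the covariant derivative of \<open>H\<close> carries the free index, so that one statement covers
  both \<open>d0 (part00 H t)\<close> and \<open>dot (part0Y H) t\<close>.\<close>

lemma cov1_eqI:
  assumes y: "y \<in> S" and w: "\<And>y. y \<in> S \<Longrightarrow> w y = (\<chi> j. N (cyl_point t y) (a j) (b j) (c j))"
  shows "cov1 g w y = (\<chi> k j. pd (Some k) (\<lambda>X. N X (a j) (b j) (c j)) (cyl_point t y)
    - (\<Sum>m\<in>UNIV. \<Gamma> y m k j * N (cyl_point t y) (a m) (b m) (c m)))"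
proof -
  have "pd k w y $ j = pd (Some k) (\<lambda>X. N X (a j) (b j) (c j)) (cyl_point t y)" for k j
  proof -
    have "pd k w y = pd k (\<lambda>y. \<chi> j. N (cyl_point t y) (a j) (b j) (c j)) y"
      by (rule pd_cong_open[OF open_S y w])
    moreover have "(\<lambda>y. \<chi> j. N (cyl_point t y) (a j) (b j) (c j)) differentiable at y"
      by (rule differentiable_vecI) (simp add: diff_N_slice[OF y])
    ultimately show ?thesis by (simp add: pd_nth pd_N_slice[OF y])
  qed
  then show ?thesis by (simp add: cov1_def w[OF y])
qed

lemma cov1_d0_part00: "y \<in> S \<Longrightarrow> cov1 g (d0 (part00 H t)) y = (\<chi> k j. N2 (cyl_point t y) (Some k) (Some j) None None)"
  by (subst cov1_eqI[OF _ d0_part00]) (simp_all add: N2_eq chr_cyl sum_option)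

lemma cov1_dot_part0Y: "y \<in> S \<Longrightarrow> cov1 g (dot (part0Y H) t) y = (\<chi> k j. N2 (cyl_point t y) (Some k) None None (Some j))"
  by (subst cov1_eqI[OF _ dot_part0Y]) (simp_all add: N2_eq chr_cyl sum_option)

lemma cov2_eqI:
  assumes y: "y \<in> S" and w: "\<And>y. y \<in> S \<Longrightarrow> w y = (\<chi> i j. N (cyl_point t y) (a i) (b i) (Some j))"
  shows "cov2 g w y = (\<chi> k i j. pd (Some k) (\<lambda>X. N X (a i) (b i) (Some j)) (cyl_point t y)
    - (\<Sum>m\<in>UNIV. \<Gamma> y m k i * N (cyl_point t y) (a m) (b m) (Some j) + \<Gamma> y m k j * N (cyl_point t y) (a i) (b i) (Some m)))"
proof -
  have "pd k w y $ i $ j = pd (Some k) (\<lambda>X. N X (a i) (b i) (Some j)) (cyl_point t y)" for k i j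
  proof -
    have "pd k w y = pd k (\<lambda>y. \<chi> i j. N (cyl_point t y) (a i) (b i) (Some j)) y"
      by (rule pd_cong_open[OF open_S y w])
    moreover have "(\<lambda>y. \<chi> i j. N (cyl_point t y) (a i) (b i) (Some j)) differentiable at y"
      by (intro differentiable_vecI) (simp add: diff_N_slice[OF y])
    moreover have "(\<lambda>y. \<chi> j. N (cyl_point t y) (a i) (b i) (Some j)) differentiable at y"
      by (intro differentiable_vecI) (simp add: diff_N_slice[OF y])
    ultimately show ?thesis by (simp add: pd_nth pd_N_slice[OF y])
  qed
  then show ?thesis by (simp add: cov2_def w[OF y])
qed

lemma cov2_dot_partYY: "y \<in> S \<Longrightarrow> cov2 g (dot (partYY H) t) y =
    (\<chi> k i j. N2 (cyl_point t y) (Some k) None (Some i) (Some j))"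
  by (subst cov2_eqI[OF _ dot_partYY]) (simp_all add: N2_eq chr_cyl sum_option)

end

section \<open>Differential operators and contractions\<close>

context local_metric begin

text \<open>The inverse metric is parallel: the right side consists of the Christoffel terms of its
  two upper indices.\<close>

lemma pd_inv:
  assumes y: "y \<in> S"
  shows "pd i (\<lambda>z. matrix_inv (g z) $ k $ l) y =
    - (\<Sum>m\<in>UNIV. christoffel g y k i m * matrix_inv (g y) $ m $ l + christoffel g y l i m * matrix_inv (g y) $ k $ m)"
proof -
  let ?I = "matrix_inv (g y)"
  have "((\<lambda>z. matrix_inv (g z) $ k $ l) has_derivative
    (\<lambda>v. - (\<Sum>p\<in>UNIV. \<Sum>q\<in>UNIV. ?I $ k $ p * frechet_derivative (\<lambda>z. g z $ p $ q) (at y) v * ?I $ q $ l))) (at y)"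
    by (intro has_derivative_matrix_inv nz y pd_has_derivative diff_nth)
  then have "pd i (\<lambda>z. matrix_inv (g z) $ k $ l) y = - (\<Sum>p\<in>UNIV. \<Sum>q\<in>UNIV. ?I $ k $ p * pd i (\<lambda>z. g z $ p $ q) y * ?I $ q $ l)"
    by (simp add: pd_eqI pd_def[of i "\<lambda>z. g z $ _ $ _"])
  also have "\<dots> = - (\<Sum>p\<in>UNIV. \<Sum>q\<in>UNIV. ?I $ k $ p * (lchr g y i p q + lchr g y i q p) * ?I $ q $ l)"
    by (simp add: pd_nth_nth[OF y, symmetric] pd_eq_lchr[OF y])
  also have "\<dots> = - ((\<Sum>p\<in>UNIV. \<Sum>q\<in>UNIV. ?I $ k $ p * lchr g y i p q * ?I $ q $ l)
      + (\<Sum>q\<in>UNIV. \<Sum>p\<in>UNIV. ?I $ k $ p * lchr g y i q p * ?I $ q $ l))"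
    by (subst (3) sum.swap) (simp add: algebra_simps sum.distrib)
  also have "(\<Sum>q\<in>UNIV. \<Sum>p\<in>UNIV. ?I $ k $ p * lchr g y i q p * ?I $ q $ l) = (\<Sum>m\<in>UNIV. christoffel g y k i m * ?I $ m $ l)"
    by (simp add: christoffel_lchr sum_distrib_right)
  also have "(\<Sum>p\<in>UNIV. \<Sum>q\<in>UNIV. ?I $ k $ p * lchr g y i p q * ?I $ q $ l) = (\<Sum>m\<in>UNIV. christoffel g y l i m * ?I $ k $ m)"
    by (simp add: christoffel_lchr sum_distrib_right sum_distrib_left inv_sym[OF y, of l] mult_ac)
  finally show ?thesis by (simp add: sum.distrib)
qed

text \<open>The derivative of the parallel inverse metric turns into Christoffel terms acting on the
  contracted slots of \<open>B\<close>. Contraction thus commutes with covariant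
  differentiation.\<close>

lemma pd_contract:
  assumes y: "y \<in> S" and B: "\<And>k l. B k l differentiable at y"
  shows "pd i (\<lambda>z. \<Sum>k\<in>UNIV. \<Sum>l\<in>UNIV. matrix_inv (g z) $ k $ l * B k l z) y =
    (\<Sum>k\<in>UNIV. \<Sum>l\<in>UNIV. matrix_inv (g y) $ k $ l *
      (pd i (B k l) y - (\<Sum>m\<in>UNIV. christoffel g y m i k * B m l y) - (\<Sum>m\<in>UNIV. christoffel g y m i l * B k m y)))"
proof -
  let ?I = "matrix_inv (g y)" and ?G = "christoffel g y"
  have "pd i (\<lambda>z. \<Sum>k\<in>UNIV. \<Sum>l\<in>UNIV. matrix_inv (g z) $ k $ l * B k l z) y =
     (\<Sum>k\<in>UNIV. \<Sum>l\<in>UNIV. ?I $ k $ l * pd i (B k l) y + pd i (\<lambda>z. matrix_inv (g z) $ k $ l) y * B k l y)"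
    by (simp add: pd_sum pd_mult diff_inv[OF y] B differentiable_mult differentiable_sum)
  also have "\<dots> = (\<Sum>k\<in>UNIV. \<Sum>l\<in>UNIV. ?I $ k $ l * pd i (B k l) y)
     - (\<Sum>k\<in>UNIV. \<Sum>l\<in>UNIV. \<Sum>m\<in>UNIV. ?G k i m * ?I $ m $ l * B k l y)
     - (\<Sum>k\<in>UNIV. \<Sum>l\<in>UNIV. \<Sum>m\<in>UNIV. ?G l i m * ?I $ k $ m * B k l y)"
    unfolding pd_inv[OF y] by (simp add: sum.distrib sum_subtractf sum_distrib_right sum_distrib_left algebra_simps)
  also have "(\<Sum>k\<in>UNIV. \<Sum>l\<in>UNIV. \<Sum>m\<in>UNIV. ?G k i m * ?I $ m $ l * B k l y) =
      (\<Sum>m\<in>UNIV. \<Sum>l\<in>UNIV. \<Sum>k\<in>UNIV. ?G k i m * ?I $ m $ l * B k l y)"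
    by (subst sum.swap, subst (2) sum.swap, subst sum.swap) (rule refl)
  also have "(\<Sum>k\<in>UNIV. \<Sum>l\<in>UNIV. \<Sum>m\<in>UNIV. ?G l i m * ?I $ k $ m * B k l y) =
      (\<Sum>k\<in>UNIV. \<Sum>m\<in>UNIV. \<Sum>l\<in>UNIV. ?G l i m * ?I $ k $ m * B k l y)"
    by (subst (2) sum.swap) (rule refl)
  finally show ?thesis
    by (simp add: sum_subtractf right_diff_distrib sum_distrib_left mult_ac)
qed

lemma metric_compatible: "y \<in> S \<Longrightarrow> cov2 g g y $ k $ i $ j = 0"
  using lower_chr'[of y k i j] lower_chr[of y i k j]
  by (simp add: cov2_nth sum.distrib pd_eq_lchr mult.commute)

end

context metric_variation begin

lemma pd_mtrace:
  assumes y: "y \<in> S"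
  shows "pd i (\<lambda>z. mtrace (g z) (H z)) y = (\<Sum>k\<in>UNIV. \<Sum>l\<in>UNIV. matrix_inv (g y) $ k $ l * cov2 g H y $ i $ k $ l)"
  unfolding mtrace_def pd_contract[OF y H.diff_nth[OF y]]
  by (simp add: cov2_nth H.pd_nth_nth[OF y] sum.distrib algebra_simps)

lemma diff_mtrace: "y \<in> S \<Longrightarrow> (\<lambda>z. mtrace (g z) (H z)) differentiable at y"
  unfolding mtrace_def by (intro differentiable_sum ballI differentiable_mult diff_inv H.diff_nth) auto

lemma diff_contract: "y \<in> S \<Longrightarrow> (\<And>k l. B k l differentiable at y) \<Longrightarrow>
    (\<lambda>z. \<Sum>k\<in>UNIV. \<Sum>l\<in>UNIV. matrix_inv (g z) $ k $ l * B k l z) differentiable at y"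
  by (intro differentiable_sum ballI differentiable_mult diff_inv) auto

lemma contract_linear:
  "(\<Sum>m\<in>UNIV. c m * (\<Sum>k\<in>UNIV. \<Sum>l\<in>UNIV. I k l * B m k l)) = (\<Sum>k\<in>UNIV. \<Sum>l\<in>UNIV. I k l * (\<Sum>m\<in>UNIV. c m * B m k l))"
  for c :: "'a::finite \<Rightarrow> real" and I :: "'b::finite \<Rightarrow> 'c::finite \<Rightarrow> real"
proof -
  have "(\<Sum>m\<in>UNIV. c m * (\<Sum>k\<in>UNIV. \<Sum>l\<in>UNIV. I k l * B m k l)) = (\<Sum>m\<in>UNIV. \<Sum>k\<in>UNIV. \<Sum>l\<in>UNIV. I k l * (c m * B m k l))"
    by (simp add: sum_distrib_left mult_ac)
  also have "\<dots> = (\<Sum>k\<in>UNIV. \<Sum>l\<in>UNIV. \<Sum>m\<in>UNIV. I k l * (c m * B m k l))"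
    by (subst sum.swap) (rule sum.cong[OF refl], rule sum.swap)
  finally show ?thesis by (simp add: sum_distrib_left)
qed

text \<open>Two uses of the parallel inverse metric: the Hessian of the trace is the trace of the
  second covariant derivative.\<close>

lemma hessian_mtrace:
  assumes y: "y \<in> S"
  shows "pd i (\<lambda>z. pd j (\<lambda>z. mtrace (g z) (H z)) z) y - (\<Sum>m\<in>UNIV. christoffel g y m i j * pd m (\<lambda>z. mtrace (g z) (H z)) y) =
    (\<Sum>k\<in>UNIV. \<Sum>l\<in>UNIV. matrix_inv (g y) $ k $ l * cov3 g (cov2 g H) y i j k l)"
proof -
  have "pd i (\<lambda>z. pd j (\<lambda>z. mtrace (g z) (H z)) z) y =
      pd i (\<lambda>z. \<Sum>k\<in>UNIV. \<Sum>l\<in>UNIV. matrix_inv (g z) $ k $ l * cov2 g H z $ j $ k $ l) y"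
    by (rule pd_cong_open[OF open_S y]) (rule pd_mtrace)
  then show ?thesis
    unfolding pd_contract[OF y diff_cov2[OF y]] pd_mtrace[OF y] contract_linear cov3_cov2[OF y]
    by (simp add: sum_subtractf[symmetric] right_diff_distrib[symmetric] sum.distrib algebra_simps)
qed

lemma diff_pd_mtrace:
  assumes y: "y \<in> S"
  shows "(\<lambda>z. pd j (\<lambda>z. mtrace (g z) (H z)) z) differentiable at y"
  by (rule differentiable_cong_open[OF open_S y pd_mtrace[symmetric]])
     (simp_all add: diff_contract[OF y diff_cov2[OF y]])

lemma diff_d0_mtrace: "y \<in> S \<Longrightarrow> d0 (\<lambda>z. mtrace (g z) (H z)) differentiable at y"
  by (intro differentiable_vecI) (simp add: d0_def diff_pd_mtrace)

lemma cov1_d0_mtrace: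
  assumes y: "y \<in> S"
  shows "cov1 g (d0 (\<lambda>z. mtrace (g z) (H z))) y =
    (\<chi> i j. \<Sum>k\<in>UNIV. \<Sum>l\<in>UNIV. matrix_inv (g y) $ k $ l * cov3 g (cov2 g H) y i j k l)"
  by (simp add: cov1_def pd_nth diff_d0_mtrace[OF y] hessian_mtrace[OF y, symmetric]) (simp add: d0_def)

lemma div2_nth: "div2 g H y $ j = (\<Sum>k\<in>UNIV. \<Sum>l\<in>UNIV. matrix_inv (g y) $ k $ l * cov2 g H y $ l $ k $ j)"
  by (simp add: div2_def)

lemma diff_div2: "y \<in> S \<Longrightarrow> div2 g H differentiable at y"
  by (intro differentiable_vecI) (simp add: div2_nth diff_contract diff_cov2)

lemma cov1_div2:
  assumes y: "y \<in> S"
  shows "cov1 g (div2 g H) y =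
    (\<chi> i j. \<Sum>k\<in>UNIV. \<Sum>l\<in>UNIV. matrix_inv (g y) $ k $ l * cov3 g (cov2 g H) y i l k j)"
proof -
  have "cov1 g (div2 g H) y $ i $ j = (\<Sum>k\<in>UNIV. \<Sum>l\<in>UNIV. matrix_inv (g y) $ k $ l * cov3 g (cov2 g H) y i l k j)" for i j
    unfolding cov1_def vec_lambda_beta pd_nth[OF diff_div2[OF y]] div2_nth pd_contract[OF y diff_cov2[OF y]]
      contract_linear cov3_cov2[OF y]
    by (simp add: sum_subtractf[symmetric] right_diff_distrib[symmetric] sum.distrib algebra_simps)
  then show ?thesis by (simp add: vec_eq_iff)
qed

text \<open>As the metric is parallel, \<open>tf\<close> commutes with both covariant derivatives,
  and the Laplacian of the trace comes from \<open>hessian_mtrace\<close>.\<close>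

lemma rough_laplacian_tf:
  assumes y: "y \<in> S"
  shows "rough_laplacian g (\<lambda>z. tf (g z) (H z)) y = (\<chi> i j.
    (\<Sum>k\<in>UNIV. \<Sum>l\<in>UNIV. matrix_inv (g y) $ k $ l * cov3 g (cov2 g H) y k l i j)
    - (\<Sum>k\<in>UNIV. \<Sum>l\<in>UNIV. matrix_inv (g y) $ k $ l *
        (\<Sum>p\<in>UNIV. \<Sum>q\<in>UNIV. matrix_inv (g y) $ p $ q * cov3 g (cov2 g H) y k l p q)) / real CARD('n) * g y $ i $ j)"
proof -
  let ?n = "real CARD('n)" and ?t = "\<lambda>z. mtrace (g z) (H z)" and ?T = "\<lambda>z. tf (g z) (H z)"
  have T: "cov2 g ?T z = (\<chi> k i j. cov2 g H z $ k $ i $ j - pd k ?t z / ?n * g z $ i $ j)" if z: "z \<in> S" for z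
  proof -
    have d: "(\<lambda>z. ?T z $ i $ j) differentiable at z" for i j
      by (simp add: tf_def differentiable_diff differentiable_mult differentiable_divide diff_mtrace z H.diff_nth diff_nth)
    then have d': "?T differentiable at z" by (intro differentiable_vecI)
    have p: "pd k ?T z $ i $ j = pd k H z $ i $ j - (pd k ?t z / ?n * g z $ i $ j + ?t z / ?n * pd k g z $ i $ j)" for k i j
    proof -
      have "pd k ?T z $ i $ j = pd k (\<lambda>z. H z $ i $ j - ?t z / ?n * g z $ i $ j) z"
        by (simp add: pd_nth d' differentiable_vec_nth) (simp add: tf_def)
      then show ?thesis
        by (simp add: pd_diff pd_mult pd_divide differentiable_mult differentiable_divide diff_mtrace z H.diff_nth diff_nth
            pd_nth_nth H.pd_nth_nth add_divide_distrib)
    qed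
    have m: "pd k g z $ i $ j = (\<Sum>m\<in>UNIV. christoffel g z m k i * g z $ m $ j + christoffel g z m k j * g z $ i $ m)" for k i j
      using metric_compatible[OF z, of k i j] by (simp add: cov2_nth)
    show ?thesis
      by (simp add: vec_eq_iff cov2_nth p m) (simp add: tf_def algebra_simps sum.distrib sum_distrib_left sum_subtractf sum_divide_distrib add_divide_distrib)
  qed
  have d: "cov2 g ?T differentiable at y"
  proof (intro differentiable_vecI)
    fix k i j
    show "(\<lambda>z. cov2 g ?T z $ k $ i $ j) differentiable at y"
      by (rule differentiable_cong_open[OF open_S y, of "\<lambda>z. cov2 g H z $ k $ i $ j - pd k ?t z / ?n * g z $ i $ j"])
         (simp_all add: T differentiable_diff differentiable_mult differentiable_divide diff_pd_mtrace diff_cov2 diff_nth y)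
  qed
  have "cov3 g (cov2 g ?T) y k l i j = cov3 g (cov2 g H) y k l i j
      - (pd k (\<lambda>z. pd l ?t z) y - (\<Sum>m\<in>UNIV. christoffel g y m k l * pd m ?t y)) / ?n * g y $ i $ j" for k l i j
  proof -
    have p: "pd k (cov2 g ?T) y $ l $ i $ j = pd k (\<lambda>z. cov2 g H z $ l $ i $ j) y
       - (pd k (\<lambda>z. pd l ?t z) y / ?n * g y $ i $ j + pd l ?t y / ?n * pd k g y $ i $ j)"
    proof -
      have "pd k (cov2 g ?T) y $ l $ i $ j = pd k (\<lambda>z. cov2 g ?T z $ l $ i $ j) y"
        by (simp add: pd_nth d differentiable_vec_nth)
      also have "\<dots> = pd k (\<lambda>z. cov2 g H z $ l $ i $ j - pd l ?t z / ?n * g z $ i $ j) y"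
        by (rule pd_cong_open[OF open_S y]) (simp add: T)
      finally show ?thesis
        by (simp add: pd_diff pd_mult pd_divide differentiable_mult differentiable_divide diff_pd_mtrace y diff_cov2 diff_nth
            pd_nth_nth add_divide_distrib)
    qed
    have m: "pd k g y $ i $ j = (\<Sum>m\<in>UNIV. christoffel g y m k i * g y $ m $ j + christoffel g y m k j * g y $ i $ m)" for k i j
      using metric_compatible[OF y, of k i j] by (simp add: cov2_nth)
    show ?thesis
      unfolding cov3_cov2[OF y] cov3_def[of g "cov2 g ?T"] p m T[OF y]
      by (simp add: algebra_simps sum.distrib sum_distrib_left sum_subtractf sum_divide_distrib diff_divide_distrib add_divide_distrib)
  qed
  then show ?thesis
    unfolding hessian_mtrace[OF y]
    by (simp add: rough_laplacian_def vec_eq_iff right_diff_distrib sum_subtractf sum_distrib_right sum_distrib_left sum_divide_distrib mult_ac)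
qed

end

section \<open>Frame components\<close>

text \<open>The rows of \<open>e\<close> may be indexed by a type other than that of the
  coordinates, so that any finite family of vectors can be inserted, not only a frame.\<close>

definition fr2 :: "real^'n::finite^'m \<Rightarrow> ('n \<Rightarrow> 'n \<Rightarrow> real) \<Rightarrow> 'm \<Rightarrow> 'm \<Rightarrow> real" where
  "fr2 e T a b = (\<Sum>i\<in>UNIV. \<Sum>j\<in>UNIV. e $ a $ i * e $ b $ j * T i j)"

definition fr3 :: "real^'n::finite^'m \<Rightarrow> ('n \<Rightarrow> 'n \<Rightarrow> 'n \<Rightarrow> real) \<Rightarrow> 'm \<Rightarrow> 'm \<Rightarrow> 'm \<Rightarrow> real" where
  "fr3 e T a b c = (\<Sum>i\<in>UNIV. \<Sum>j\<in>UNIV. \<Sum>k\<in>UNIV. e $ a $ i * e $ b $ j * e $ c $ k * T i j k)"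

definition fr4 :: "real^'n::finite^'m \<Rightarrow> ('n \<Rightarrow> 'n \<Rightarrow> 'n \<Rightarrow> 'n \<Rightarrow> real) \<Rightarrow> 'm \<Rightarrow> 'm \<Rightarrow> 'm \<Rightarrow> 'm \<Rightarrow> real" where
  "fr4 e T a b c d = (\<Sum>i\<in>UNIV. \<Sum>j\<in>UNIV. \<Sum>k\<in>UNIV. \<Sum>l\<in>UNIV. e $ a $ i * e $ b $ j * e $ c $ k * e $ d $ l * T i j k l)"

lemma fr2_linear:
  "fr2 e (\<lambda>i j. A i j + B i j) a b = fr2 e A a b + fr2 e B a b"
  "fr2 e (\<lambda>i j. A i j - B i j) a b = fr2 e A a b - fr2 e B a b"
  "fr2 e (\<lambda>i j. - A i j) a b = - fr2 e A a b"
  "fr2 e (\<lambda>i j. r * A i j) a b = r * fr2 e A a b"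
  "fr2 e (\<lambda>i j. A i j * r) a b = fr2 e A a b * r"
  "fr2 e (\<lambda>i j. A i j / r) a b = fr2 e A a b / r"
  by (simp_all add: fr2_def distrib_left right_diff_distrib sum.distrib sum_subtractf sum_negf sum_distrib_left
      sum_divide_distrib mult_ac)

lemma fr4_linear:
  "fr4 e (\<lambda>i j k l. A i j k l + B i j k l) a b c d = fr4 e A a b c d + fr4 e B a b c d"
  "fr4 e (\<lambda>i j k l. A i j k l - B i j k l) a b c d = fr4 e A a b c d - fr4 e B a b c d"
  "fr4 e (\<lambda>i j k l. - A i j k l) a b c d = - fr4 e A a b c d"
  "fr4 e (\<lambda>i j k l. r * A i j k l) a b c d = r * fr4 e A a b c d"
  "fr4 e (\<lambda>i j k l. A i j k l / r) a b c d = fr4 e A a b c d / r"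
  by (simp_all add: fr4_def distrib_left right_diff_distrib sum.distrib sum_subtractf sum_negf sum_distrib_left
      sum_divide_distrib mult_ac)

lemma fr2_swap: "fr2 e (\<lambda>i j. T j i) a b = fr2 e T b a"
  unfolding fr2_def by (subst sum.swap) (simp add: mult_ac)

lemma fr4_swap12: "fr4 e (\<lambda>i j k l. T j i k l) a b c d = fr4 e T b a c d"
  unfolding fr4_def by (subst sum.swap) (simp add: mult_ac)

lemma fr4_swap23: "fr4 e (\<lambda>i j k l. T i k j l) a b c d = fr4 e T a c b d"
  unfolding fr4_def by (rule sum.cong[OF refl], subst sum.swap) (simp add: mult_ac)

lemma fr4_swap34: "fr4 e (\<lambda>i j k l. T i j l k) a b c d = fr4 e T a b d c"
  unfolding fr4_def by (rule sum.cong[OF refl], rule sum.cong[OF refl], subst sum.swap) (simp add: mult_ac)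

lemma fr4_perms:
  "fr4 e (\<lambda>i j k l. T i l j k) a b c d = fr4 e T a d b c"
  "fr4 e (\<lambda>i j k l. T j i l k) a b c d = fr4 e T b a d c"
  "fr4 e (\<lambda>i j k l. T j l i k) a b c d = fr4 e T b d a c"
  "fr4 e (\<lambda>i j k l. T j k i l) a b c d = fr4 e T b c a d"
  "fr4 e (\<lambda>i j k l. T k l i j) a b c d = fr4 e T c d a b"
  "fr4 e (\<lambda>i j k l. T k i l j) a b c d = fr4 e T c a d b"
  "fr4 e (\<lambda>i j k l. T k j i l) a b c d = fr4 e T c b a d"
proof -
  show 1: "fr4 e (\<lambda>i j k l. T i l j k) a b c d = fr4 e T a d b c" for a b c d T
    by (simp only: fr4_swap34[of e "\<lambda>i j k l. T i k j l"] fr4_swap23[of e T])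
  show "fr4 e (\<lambda>i j k l. T j i l k) a b c d = fr4 e T b a d c"
    by (simp only: fr4_swap34[of e "\<lambda>i j k l. T j i k l"] fr4_swap12[of e T])
  show 2: "fr4 e (\<lambda>i j k l. T j k i l) a b c d = fr4 e T b c a d" for a b c d
    by (simp only: fr4_swap12[of e "\<lambda>i j k l. T i k j l"] fr4_swap23[of e T])
  show 3: "fr4 e (\<lambda>i j k l. T j l i k) a b c d = fr4 e T b d a c" for a b c d
    by (simp only: fr4_swap34[of e "\<lambda>i j k l. T j k i l"] 2)
  show "fr4 e (\<lambda>i j k l. T k l i j) a b c d = fr4 e T c d a b"
    by (simp only: fr4_swap23[of e "\<lambda>i j k l. T j l i k"] 3)
  show 4: "fr4 e (\<lambda>i j k l. T k j i l) a b c d = fr4 e T c b a d" for a b c d T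
    by (simp only: fr4_swap23[of e "\<lambda>i j k l. T j k i l"] fr4_swap12[of e "\<lambda>i j k l. T i k j l"] fr4_swap23[of e T])
  show "fr4 e (\<lambda>i j k l. T k i l j) a b c d = fr4 e T c a d b"
    by (simp only: fr4_swap12[of e "\<lambda>i j k l. T k j l i"] 4[of "\<lambda>i j k l. T i j l k"]
       fr4_swap34[of e "\<lambda>i j k l. T k j i l"] fr4_swap34[of e T] fr4_swap34[of e "\<lambda>i j k l. T k i j l"]
       fr4_swap23[of e "\<lambda>i j k l. T j i k l"] fr4_swap12[of e T])
qed

lemma fr4_nested: "fr4 e T a b c d = fr2 e (\<lambda>i j. fr2 e (\<lambda>k l. T i j k l) c d) a b"
  by (simp add: fr4_def fr2_def sum_distrib_left mult_ac)

lemma fr4_prod: "fr4 e (\<lambda>i j k l. A i j * B k l) a b c d = fr2 e A a b * fr2 e B c d"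
  unfolding fr4_nested fr2_linear ..

lemma fr4_prods:
  "fr4 e (\<lambda>i j k l. A i k * B j l) a b c d = fr2 e A a c * fr2 e B b d"
  "fr4 e (\<lambda>i j k l. A i l * B j k) a b c d = fr2 e A a d * fr2 e B b c"
  "fr4 e (\<lambda>i j k l. A j k * B i l) a b c d = fr2 e A b c * fr2 e B a d"
  "fr4 e (\<lambda>i j k l. A j l * B i k) a b c d = fr2 e A b d * fr2 e B a c"
proof -
  show 1: "fr4 e (\<lambda>i j k l. A i k * B j l) a b c d = fr2 e A a c * fr2 e B b d" for A B
    using fr4_swap23[of e "\<lambda>i j k l. A i j * B k l"] by (simp only: fr4_prod)
  show 2: "fr4 e (\<lambda>i j k l. A i l * B j k) a b c d = fr2 e A a d * fr2 e B b c" for A B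
    using fr4_perms(1)[of e "\<lambda>i j k l. A i j * B k l"] by (simp only: fr4_prod)
  show "fr4 e (\<lambda>i j k l. A j k * B i l) a b c d = fr2 e A b c * fr2 e B a d"
    using 2[of B A] by (simp only: mult.commute)
  show "fr4 e (\<lambda>i j k l. A j l * B i k) a b c d = fr2 e A b d * fr2 e B a c"
    using 1[of B A] by (simp only: mult.commute)
qed

lemma frame_comp_fr2: "frame_comp e T = (\<chi> a b. fr2 e (\<lambda>i j. T $ i $ j) a b)"
  by (simp add: frame_comp_def fr2_def vec_eq_iff inner_vec_def matrix_vector_mult_def sum_distrib_left mult_ac)

text \<open>Orthonormality without orientation, in any dimension: it applies to the frame on Y and
  to its extension to the cylinder.\<close>

definition is_frame :: "real^'n^'n \<Rightarrow> real^'n^'n \<Rightarrow> bool" where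
  "is_frame G e \<longleftrightarrow> (\<forall>a b. fr2 e (\<lambda>i j. G $ i $ j) a b = (if a = b then 1 else 0))"

lemma is_frame_metric: "is_frame G e \<Longrightarrow> fr2 e (\<lambda>i j. G $ i $ j) a b = (if a = b then 1 else 0)"
  by (simp add: is_frame_def)

lemma is_frame_mult: "is_frame G e \<longleftrightarrow> e ** G ** transpose e = mat 1"
proof -
  have "(e ** G ** transpose e) $ a $ b = fr2 e (\<lambda>i j. G $ i $ j) a b" for a b
    unfolding fr2_def matrix_matrix_mult_def transpose_def
    by (simp add: sum_distrib_left sum_distrib_right) (subst sum.swap, simp add: mult_ac)
  then show ?thesis by (simp add: is_frame_def vec_eq_iff mat_def)
qed

text \<open>A one-sided inverse of a square matrix is two-sided, so e G e^T = 1 gives G^-1 = e^T e.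
  Contractions with the inverse metric thereby become sums over frame vectors.\<close>

lemma matrix_inv_frame:
  assumes "is_frame G e"
  shows "matrix_inv G $ k $ l = (\<Sum>a\<in>UNIV. e $ a $ k * e $ a $ l)"
proof -
  have "e ** (G ** transpose e) = mat 1"
    using assms by (simp add: is_frame_mult matrix_mul_assoc)
  then have "(G ** transpose e) ** e = mat 1"
    using matrix_left_right_inverse by blast
  then have "matrix_inv G = transpose e ** e"
    by (intro matrix_inv_unique) (simp only: matrix_mul_assoc)
  then show ?thesis by (simp add: matrix_matrix_mult_def transpose_def)
qed

lemma frame_contract:
  assumes "is_frame G e"
  shows "(\<Sum>k\<in>UNIV. \<Sum>l\<in>UNIV. matrix_inv G $ k $ l * T k l) = (\<Sum>c\<in>UNIV. fr2 e T c c)"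
proof -
  have "(\<Sum>k\<in>UNIV. \<Sum>l\<in>UNIV. matrix_inv G $ k $ l * T k l) = (\<Sum>k\<in>UNIV. \<Sum>l\<in>UNIV. \<Sum>c\<in>UNIV. e $ c $ k * e $ c $ l * T k l)"
    by (simp add: matrix_inv_frame[OF assms] sum_distrib_right)
  also have "\<dots> = (\<Sum>k\<in>UNIV. \<Sum>c\<in>UNIV. \<Sum>l\<in>UNIV. e $ c $ k * e $ c $ l * T k l)"
    by (rule sum.cong[OF refl], rule sum.swap)
  also have "\<dots> = (\<Sum>c\<in>UNIV. fr2 e T c c)"
    unfolding fr2_def by (rule sum.swap)
  finally show ?thesis .
qed

lemma fr2_sum: "fr2 e (\<lambda>i j. \<Sum>k\<in>UNIV. A k i j) a b = (\<Sum>k\<in>UNIV. fr2 e (A k) a b)" for A :: "'k::finite \<Rightarrow> _"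
proof -
  have "fr2 e (\<lambda>i j. \<Sum>k\<in>UNIV. A k i j) a b = (\<Sum>i\<in>UNIV. \<Sum>k\<in>UNIV. \<Sum>j\<in>UNIV. e $ a $ i * e $ b $ j * A k i j)"
    unfolding fr2_def sum_distrib_left by (rule sum.cong[OF refl], rule sum.swap)
  also have "\<dots> = (\<Sum>k\<in>UNIV. fr2 e (A k) a b)"
    unfolding fr2_def by (rule sum.swap)
  finally show ?thesis .
qed

lemma fr4_nested': "fr4 e T a b c d = fr2 e (\<lambda>k l. fr2 e (\<lambda>i j. T i j k l) a b) c d"
  using fr4_perms(5)[of e T c d a b] fr4_nested[of e "\<lambda>k l i j. T i j k l" c d a b]
  by simp

lemma frame_contract_12:
  assumes "is_frame G e"
  shows "fr2 e (\<lambda>i j. \<Sum>k\<in>UNIV. \<Sum>l\<in>UNIV. matrix_inv G $ k $ l * T k l i j) a b = (\<Sum>c\<in>UNIV. fr4 e T c c a b)"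
  unfolding frame_contract[OF assms, of "\<lambda>k l. T k l i j" for i j] fr2_sum fr4_nested' ..

text \<open>Serves the terms in which the inverse metric is varied: raising both indices of
  \<open>A\<close> and pairing with \<open>T\<close> is the plain inner product of frame
  components.\<close>

lemma frame_contract_raised:
  assumes "is_frame G e"
  shows "(\<Sum>c\<in>UNIV. \<Sum>d\<in>UNIV. (\<Sum>p\<in>UNIV. \<Sum>q\<in>UNIV. matrix_inv G $ c $ p * A p q * matrix_inv G $ q $ d) * T c d) =
    (\<Sum>r\<in>UNIV. \<Sum>s\<in>UNIV. fr2 e A r s * fr2 e T r s)"
proof -
  have sy: "matrix_inv G $ q $ d = matrix_inv G $ d $ q" for q d
    by (simp add: matrix_inv_frame[OF assms] mult.commute)
  have "(\<Sum>c\<in>UNIV. \<Sum>d\<in>UNIV. (\<Sum>p\<in>UNIV. \<Sum>q\<in>UNIV. matrix_inv G $ c $ p * A p q * matrix_inv G $ q $ d) * T c d) =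
    (\<Sum>c\<in>UNIV. \<Sum>d\<in>UNIV. \<Sum>p\<in>UNIV. \<Sum>q\<in>UNIV. matrix_inv G $ d $ q * (matrix_inv G $ c $ p * (A p q * T c d)))"
    by (simp add: sum_distrib_right sum_distrib_left mult_ac sy)
  also have "\<dots> = (\<Sum>c\<in>UNIV. \<Sum>p\<in>UNIV. \<Sum>d\<in>UNIV. \<Sum>q\<in>UNIV. matrix_inv G $ d $ q * (matrix_inv G $ c $ p * (A p q * T c d)))"
    by (rule sum.cong[OF refl], rule sum.swap)
  also have "\<dots> = (\<Sum>c\<in>UNIV. \<Sum>p\<in>UNIV. \<Sum>s\<in>UNIV. fr2 e (\<lambda>d q. matrix_inv G $ c $ p * (A p q * T c d)) s s)"
    unfolding frame_contract[OF assms, of "\<lambda>d q. matrix_inv G $ c $ p * (A p q * T c d)" for c p] ..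
  also have "\<dots> = (\<Sum>s\<in>UNIV. \<Sum>c\<in>UNIV. \<Sum>p\<in>UNIV. matrix_inv G $ c $ p * fr2 e (\<lambda>d q. A p q * T c d) s s)"
    by (subst (2) sum.swap, subst sum.swap) (simp only: fr2_linear)
  also have "\<dots> = (\<Sum>s\<in>UNIV. \<Sum>r\<in>UNIV. fr2 e (\<lambda>c p. fr2 e (\<lambda>d q. A p q * T c d) s s) r r)"
    unfolding frame_contract[OF assms] ..
  also have "\<dots> = (\<Sum>s\<in>UNIV. \<Sum>r\<in>UNIV. fr2 e A r s * fr2 e T r s)"
    unfolding fr4_nested[symmetric, of e "\<lambda>c p d q. A p q * T c d"]
    using fr4_perms(3)[of e "\<lambda>p q c d. A p q * T c d"] by (simp add: fr4_prods)
  finally show ?thesis by (subst sum.swap)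
qed

section \<open>Derivatives of the Ricci, scalar and Weyl curvatures along a variation\<close>

context metric_variation begin

text \<open>The variation with both indices raised; the derivative of the inverse metric is its
  negative, whence the minus signs in \<open>ric_var\<close> and \<open>scal_var\<close>.\<close>

definition inv_var :: "real^'n \<Rightarrow> 'n \<Rightarrow> 'n \<Rightarrow> real" where
  "inv_var x k l = (\<Sum>p\<in>UNIV. \<Sum>q\<in>UNIV. matrix_inv (g x) $ k $ p * H x $ p $ q * matrix_inv (g x) $ q $ l)"

definition riem_var :: "real^'n \<Rightarrow> 'n \<Rightarrow> 'n \<Rightarrow> 'n \<Rightarrow> 'n \<Rightarrow> real" where
  "riem_var x i j k l = (\<Sum>m\<in>UNIV. H x $ k $ m * curv_endo g x i j l m) +
    (cov3 g (cov2 g H) x i j l k + cov3 g (cov2 g H) x i l j k - cov3 g (cov2 g H) x i k j l) / 2 -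
    (cov3 g (cov2 g H) x j i l k + cov3 g (cov2 g H) x j l i k - cov3 g (cov2 g H) x j k i l) / 2"

definition ric_var :: "real^'n \<Rightarrow> 'n \<Rightarrow> 'n \<Rightarrow> real" where
  "ric_var x a b = (\<Sum>c\<in>UNIV. \<Sum>d\<in>UNIV. matrix_inv (g x) $ c $ d * riem_var x a c b d)
     - (\<Sum>c\<in>UNIV. \<Sum>d\<in>UNIV. inv_var x c d * riemann g x a c b d)"

definition scal_var :: "real^'n \<Rightarrow> real" where
  "scal_var x = (\<Sum>a\<in>UNIV. \<Sum>b\<in>UNIV. matrix_inv (g x) $ a $ b * ric_var x a b)
     - (\<Sum>a\<in>UNIV. \<Sum>b\<in>UNIV. inv_var x a b * ricci g x $ a $ b)"

definition weyl_var :: "real^'n \<Rightarrow> 'n \<Rightarrow> 'n \<Rightarrow> 'n \<Rightarrow> 'n \<Rightarrow> real" where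
  "weyl_var x i j k l = riem_var x i j k l
     - (ric_var x i k * g x $ j $ l + ricci g x $ i $ k * H x $ j $ l
        - (ric_var x i l * g x $ j $ k + ricci g x $ i $ l * H x $ j $ k)
        + (ric_var x j l * g x $ i $ k + ricci g x $ j $ l * H x $ i $ k)
        - (ric_var x j k * g x $ i $ l + ricci g x $ j $ k * H x $ i $ l)) / (real CARD('n) - 2)
     + (scal_var x * (g x $ i $ k * g x $ j $ l - g x $ i $ l * g x $ j $ k)
        + scalar_curvature g x * ((H x $ i $ k * g x $ j $ l + g x $ i $ k * H x $ j $ l)
            - (H x $ i $ l * g x $ j $ k + g x $ i $ l * H x $ j $ k)))
        / ((real CARD('n) - 1) * (real CARD('n) - 2))"

lemma has_derivative_inv: "x \<in> S \<Longrightarrow> ((\<lambda>s. matrix_inv (metric_at s x) $ k $ l) has_real_derivative - inv_var x k l) (at 0)"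
  unfolding inv_var_def by (rule has_derivative_inv_metric_at)

lemma has_derivative_riem: "x \<in> S \<Longrightarrow> ((\<lambda>s. riemann (metric_at s) x i j k l) has_real_derivative riem_var x i j k l) (at 0)"
  unfolding riem_var_def by (rule has_derivative_riemann_metric_at)

text \<open>The symmetries hold for the curvature of all metrics near s = 0 and pass to the
  derivative by its uniqueness. Read off from \<open>riem_var\<close>, the pair symmetry would
  require the commutation of covariant derivatives.\<close>

lemma riem_var_symmetries:
  assumes x: "x \<in> S"
  shows riem_var_pair: "riem_var x k l i j = riem_var x i j k l"
    and riem_var_antisym: "riem_var x i j k l = - riem_var x j i k l"
proof -
  have "\<forall>\<^sub>F s in nhds 0. riemann (metric_at s) x k l i j = riemann (metric_at s) x i j k l \<and>
     riemann (metric_at s) x i j k l = - riemann (metric_at s) x j i k l"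
    using eventually_metric_at[OF x]
  proof eventually_elim
    fix s assume "det (metric_at s x) \<noteq> 0"
    then obtain U where U: "x \<in> U" "local_metric (metric_at s) U"
      using local_metric_metric_at[OF x] by blast
    interpret s: local_metric "metric_at s" U by (rule U)
    show "riemann (metric_at s) x k l i j = riemann (metric_at s) x i j k l \<and>
     riemann (metric_at s) x i j k l = - riemann (metric_at s) x j i k l"
      using s.riemann_pair[OF U(1)] s.riemann_antisym_left by blast
  qed
  then have ev: "\<forall>\<^sub>F s in nhds 0. riemann (metric_at s) x i j k l = riemann (metric_at s) x k l i j"
    "\<forall>\<^sub>F s in nhds 0. riemann (metric_at s) x i j k l = - riemann (metric_at s) x j i k l"
    by (auto elim: eventually_mono)
  have "((\<lambda>s. riemann (metric_at s) x i j k l) has_real_derivative riem_var x k l i j) (at 0)"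
    using has_derivative_riem[OF x] by (subst DERIV_cong_ev[OF refl ev(1) refl])
  then show "riem_var x k l i j = riem_var x i j k l"
    using has_derivative_riem[OF x] DERIV_unique by blast
  have "((\<lambda>s. riemann (metric_at s) x i j k l) has_real_derivative - riem_var x j i k l) (at 0)"
    using DERIV_minus[OF has_derivative_riem[OF x]] by (subst DERIV_cong_ev[OF refl ev(2) refl])
  then show "riem_var x i j k l = - riem_var x j i k l"
    using has_derivative_riem[OF x] DERIV_unique by blast
qed

lemma has_derivative_metric: "((\<lambda>s. metric_at s x $ i $ j) has_real_derivative H x $ i $ j) (at 0)"
  by (auto simp: metric_at_def intro!: derivative_eq_intros)

lemma has_derivative_ric:
  assumes x: "x \<in> S"
  shows "((\<lambda>s. ricci (metric_at s) x $ a $ b) has_real_derivative ric_var x a b) (at 0)"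
proof -
  have "((\<lambda>s. \<Sum>c\<in>UNIV. \<Sum>d\<in>UNIV. matrix_inv (metric_at s x) $ c $ d * riemann (metric_at s) x a c b d) has_real_derivative
    (\<Sum>c\<in>UNIV. \<Sum>d\<in>UNIV. - inv_var x c d * riemann (metric_at 0) x a c b d + riem_var x a c b d * matrix_inv (metric_at 0 x) $ c $ d)) (at 0)"
    by (intro DERIV_sum DERIV_mult has_derivative_inv has_derivative_riem x)
  then show ?thesis
    unfolding ricci_def ric_var_def
    by (simp add: metric_at_0 sum.distrib sum_subtractf sum_negf mult.commute)
qed

lemma has_derivative_scal:
  assumes x: "x \<in> S"
  shows "((\<lambda>s. scalar_curvature (metric_at s) x) has_real_derivative scal_var x) (at 0)"
proof -
  have "((\<lambda>s. \<Sum>c\<in>UNIV. \<Sum>d\<in>UNIV. matrix_inv (metric_at s x) $ c $ d * ricci (metric_at s) x $ c $ d) has_real_derivative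
    (\<Sum>c\<in>UNIV. \<Sum>d\<in>UNIV. - inv_var x c d * ricci (metric_at 0) x $ c $ d + ric_var x c d * matrix_inv (metric_at 0 x) $ c $ d)) (at 0)"
    by (intro DERIV_sum DERIV_mult has_derivative_inv has_derivative_ric x)
  then show ?thesis
    unfolding scalar_curvature_def mtrace_def scal_var_def
    by (simp add: metric_at_0 sum.distrib sum_subtractf sum_negf mult.commute)
qed

lemma has_derivative_weyl:
  assumes x: "x \<in> S"
  shows "((\<lambda>s. weyl (metric_at s) x i j k l) has_real_derivative weyl_var x i j k l) (at 0)"
  unfolding weyl_def weyl_var_def
  by (rule derivative_eq_intros DERIV_cdivide has_derivative_riem[OF x] has_derivative_ric[OF x] has_derivative_scal[OF x]
      has_derivative_metric refl)+
     (simp add: metric_at_0 algebra_simps)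

lemma has_linearization_traceless_ricci:
  assumes x: "x \<in> S"
  shows "has_linearization (\<lambda>g'. traceless_ricci g' x) g H
    (\<chi> a b. ric_var x a b - (scal_var x * g x $ a $ b + scalar_curvature g x * H x $ a $ b) / real CARD('n))"
proof -
  have "((\<lambda>s. traceless_ricci (metric_at s) x $ a $ b) has_real_derivative
     ric_var x a b - (scal_var x * g x $ a $ b + scalar_curvature g x * H x $ a $ b) / real CARD('n)) (at 0)" for a b
    unfolding traceless_ricci_def vector_minus_component vector_scaleR_component real_scaleR_def times_divide_eq_left
    by (rule derivative_eq_intros DERIV_cdivide has_derivative_ric[OF x] has_derivative_scal[OF x]
        has_derivative_metric refl)+
       (simp add: metric_at_0 algebra_simps)
  then have "((\<lambda>s. \<chi> a b. traceless_ricci (metric_at s) x $ a $ b) has_vector_derivative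
    (\<chi> a b. ric_var x a b - (scal_var x * g x $ a $ b + scalar_curvature g x * H x $ a $ b) / real CARD('n))) (at 0)"
    by (intro has_vector_derivative_vec_lambda) (simp add: has_real_derivative_iff_has_vector_derivative)
  then show ?thesis
    by (simp add: has_linearization_def metric_at_def)
qed

end

section \<open>Constant curvature\<close>

text \<open>A tensor with the symmetries of a curvature tensor is determined by its biquadratic
  form. Polarization in one argument and then in the other gives antisymmetry in the second and
  fourth index.\<close>

lemma quadrilinear_polarization:
  fixes A :: "'n::finite \<Rightarrow> 'n \<Rightarrow> 'n \<Rightarrow> 'n \<Rightarrow> real"
  assumes pair: "\<And>i j k l. A i j k l = A k l i j" and anti: "\<And>i j k l. A i j k l = - A j i k l"
    and bianchi: "\<And>i j k l. A i j k l + A j l k i + A l i k j = 0"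
    and zero: "\<And>u v :: real^'n. (\<Sum>i\<in>UNIV. \<Sum>j\<in>UNIV. \<Sum>k\<in>UNIV. \<Sum>l\<in>UNIV. A i j k l * u $ i * v $ j * u $ k * v $ l) = 0"
  shows "A i j k l = 0"
proof -
  define Q where "Q u v w z = (\<Sum>i\<in>UNIV. \<Sum>j\<in>UNIV. \<Sum>k\<in>UNIV. \<Sum>l\<in>UNIV. A i j k l * u $ i * v $ j * w $ k * z $ l)"
    for u v w z :: "real^'n"
  have add: "Q (u + u') v w z = Q u v w z + Q u' v w z" "Q u (v + u') w z = Q u v w z + Q u u' w z"
    "Q u v (w + u') z = Q u v w z + Q u v u' z" "Q u v w (z + u') = Q u v w z + Q u v w u'" for u v w z u'
    by (simp_all add: Q_def distrib_left distrib_right sum.distrib)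
  have ax: "Q (axis i 1) (axis j 1) (axis k 1) (axis l 1) = A i j k l" for i j k l
  proof -
    have "Q (axis i 1) (axis j 1) (axis k 1) (axis l 1) = fr4 (mat 1) A i j k l"
      by (simp add: Q_def fr4_def mat_def axis_def mult_ac eq_commute)
    also have "\<dots> = A i j k l"
      by (simp add: fr4_nested fr2_def mat_def mult.assoc sum_distrib_left[symmetric])
    finally show ?thesis .
  qed
  have z: "Q u v u v = 0" for u v using zero[of u v] by (simp add: Q_def)
  have a1: "A i j i l = 0" for i j l
    using z[of "axis i 1" "axis j 1 + axis l 1"] z[of "axis i 1" "axis j 1"] z[of "axis i 1" "axis l 1"] pair[of i j i l]
    by (simp add: add ax)
  have a2: "A i j k l = - A i l k j" for i j k l
    using z[of "axis i 1 + axis k 1" "axis j 1 + axis l 1"] a1 pair[of i j k l] pair[of i l k j]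
      z[of "axis i 1 + axis k 1" "axis j 1"] z[of "axis i 1 + axis k 1" "axis l 1"]
    by (simp add: add ax)
  \<comment> \<open>The three terms of the Bianchi identity now coincide, so three times
    \<open>A i j k l\<close> vanishes.\<close>
  show ?thesis
    using bianchi[of i j k l] anti[of j l k i] a2[of l j k i] anti[of l i k j] a2[of i l k j] by linarith
qed

definition const_curv_at :: "(real^'n::finite \<Rightarrow> real^'n^'n) \<Rightarrow> real^'n \<Rightarrow> real \<Rightarrow> bool" where
  "const_curv_at g x \<kappa> \<longleftrightarrow> (\<forall>i j k l. riemann g x i j k l = \<kappa> * (g x $ i $ k * g x $ j $ l - g x $ i $ l * g x $ j $ k))"

context local_metric begin

text \<open>Sectional curvature is prescribed for independent pairs. For dependent pairs the
  curvature form and the Gram determinant both vanish, so the biquadratic identity holds for all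
  pairs and polarization applies to the difference \<open>A\<close>.\<close>

lemma const_curv_atI:
  assumes x: "x \<in> S"
    and pos: "\<And>v. v \<noteq> 0 \<Longrightarrow> v \<bullet> (g x *v v) > 0"
    and sec: "\<And>u v. u \<noteq> v \<Longrightarrow> independent {u, v} \<Longrightarrow> sectional_curvature g x u v = \<kappa>"
  shows "const_curv_at g x \<kappa>"
proof -
  define A where "A i j k l = riemann g x i j k l - \<kappa> * (g x $ i $ k * g x $ j $ l - g x $ i $ l * g x $ j $ k)" for i j k l
  define R where "R u v = (\<Sum>i\<in>UNIV. \<Sum>j\<in>UNIV. \<Sum>k\<in>UNIV. \<Sum>l\<in>UNIV. riemann g x i j k l * u $ i * v $ j * u $ k * v $ l)" for u v
  define B where "B u v = u \<bullet> (g x *v v)" for u v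
  have B_sym: "B u v = B v u" for u v
    unfolding B_def inner_vec_def matrix_vector_mult_def
    by (simp add: sum_distrib_left) (subst sum.swap, simp add: sym[OF x] mult_ac)
  have gg: "(\<Sum>i\<in>UNIV. \<Sum>j\<in>UNIV. \<Sum>k\<in>UNIV. \<Sum>l\<in>UNIV. (g x $ i $ k * g x $ j $ l - g x $ i $ l * g x $ j $ k) * u $ i * v $ j * u $ k * v $ l) =
     B u u * B v v - (B u v)\<^sup>2" for u v
  proof -
    \<comment> \<open>The pair u, v is treated as a family of rows: the index \<open>None\<close>
      selects u and every other index selects v. The product rules for \<open>fr4\<close> then
      evaluate the sums.\<close>
    have e: "(\<Sum>i\<in>UNIV. \<Sum>j\<in>UNIV. \<Sum>k\<in>UNIV. \<Sum>l\<in>UNIV. T i j k l * u $ i * v $ j * u $ k * v $ l) =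
      fr4 (\<chi> a. (case a of None \<Rightarrow> u | Some (b::bool) \<Rightarrow> v)) T None (Some True) None (Some True)" for T
      by (simp add: fr4_def mult_ac)
    have b: "fr2 (\<chi> a. (case a of None \<Rightarrow> u | Some (b::bool) \<Rightarrow> v)) (\<lambda>i j. g x $ i $ j) a b =
      B (case a of None \<Rightarrow> u | Some (b::bool) \<Rightarrow> v) (case b of None \<Rightarrow> u | Some (b::bool) \<Rightarrow> v)" for a b
      by (simp add: fr2_def B_def inner_vec_def matrix_vector_mult_def sum_distrib_left mult_ac)
    show ?thesis unfolding e fr4_linear fr4_prods b by (simp add: B_sym[of v u] power2_eq_square)
  qed
  have Rvv: "R v v = 0" for v
  proof -
    have "R v v = fr4 (\<chi> a::1. v) (riemann g x) 1 1 1 1"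
      by (simp add: R_def fr4_def mult_ac)
    moreover have "fr4 (\<chi> a::1. v) (riemann g x) 1 1 1 1 = - fr4 (\<chi> a::1. v) (riemann g x) 1 1 1 1"
      by (subst fr4_swap12[symmetric]) (simp only: fr4_linear[symmetric] riemann_antisym_left[symmetric])
    ultimately show ?thesis by simp
  qed
  have RQ: "R u v = \<kappa> * (B u u * B v v - (B u v)\<^sup>2)" for u v
  proof (cases "v = 0 \<or> (\<exists>c. u = c *\<^sub>R v)")
    case True
    then show ?thesis
    proof
      assume "v = 0"
      then show ?thesis by (simp add: R_def B_def)
    next
      assume "\<exists>c. u = c *\<^sub>R v"
      then obtain c where u: "u = c *\<^sub>R v" ..
      have "R u v = c\<^sup>2 * R v v"
        by (simp add: u R_def sum_distrib_left power2_eq_square mult_ac)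
      then show ?thesis
        by (simp add: Rvv u B_def power2_eq_square matrix_vector_mult_scaleR)
    qed
  next
    case False
    then have uv: "u \<noteq> v" by (metis scaleR_one)
    have "u \<notin> span {v}" using False by (auto simp: span_singleton)
    then have ind: "independent {u, v}" using False uv by (simp add: independent_insert)
    have "B u u * B v v - (B u v)\<^sup>2 \<noteq> 0"
    proof
      assume 0: "B u u * B v v - (B u v)\<^sup>2 = 0"
      \<comment> \<open>The component of u orthogonal to v, scaled by \<open>B v v\<close> to avoid
        a division. Its square norm is \<open>B v v\<close> times the Gram determinant.\<close>
      let ?w = "B v v *\<^sub>R u - B u v *\<^sub>R v"
      have bv: "B v v > 0" using pos False by (simp add: B_def)
      have lin: "B (a *\<^sub>R u - b *\<^sub>R v) w = a * B u w - b * B v w" for a b w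
        by (simp add: B_def inner_diff_left)
      have "B ?w ?w = B v v * B u ?w - B u v * B v ?w" by (rule lin)
      also have "\<dots> = B v v * (B v v * B u u - B u v * B v u) - B u v * (B v v * B u v - B u v * B v v)"
        unfolding B_sym[of _ ?w] lin ..
      also have "\<dots> = B v v * (B u u * B v v - (B u v)\<^sup>2)"
        by (simp add: B_sym[of v u] power2_eq_square algebra_simps)
      finally have "B ?w ?w = 0" using 0 by simp
      then have "B v v *\<^sub>R u = B u v *\<^sub>R v" using pos[of ?w] by (auto simp: B_def)
      then have "(1 / B v v) *\<^sub>R (B v v *\<^sub>R u) = (1 / B v v) *\<^sub>R (B u v *\<^sub>R v)" by simp
      then have "u = (B u v / B v v) *\<^sub>R v" using bv by simp
      then show False using False by blast
    qed
    then show ?thesis using sec[OF uv ind] by (simp add: sectional_curvature_def R_def B_def field_simps)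
  qed
  have "A i j k l = 0" for i j k l
  proof (rule quadrilinear_polarization)
    show "A i j k l = A k l i j" for i j k l
      using riemann_pair[OF x, of i j k l] by (simp add: A_def sym[OF x, of k i] sym[OF x, of l j] sym[OF x, of k j] sym[OF x, of l i] mult.commute)
    show "A i j k l = - A j i k l" for i j k l
      using riemann_antisym_left[of x i j k l] by (simp add: A_def algebra_simps)
    show "A i j k l + A j l k i + A l i k j = 0" for i j k l
      using riemann_bianchi[OF x, of i j k l]
      by (simp add: A_def sym[OF x, of j i] sym[OF x, of l i] sym[OF x, of l j] algebra_simps)
    show "(\<Sum>i\<in>UNIV. \<Sum>j\<in>UNIV. \<Sum>k\<in>UNIV. \<Sum>l\<in>UNIV. A i j k l * u $ i * v $ j * u $ k * v $ l) = 0" for u v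
    proof -
      have "(\<Sum>i\<in>UNIV. \<Sum>j\<in>UNIV. \<Sum>k\<in>UNIV. \<Sum>l\<in>UNIV. A i j k l * u $ i * v $ j * u $ k * v $ l) = R u v - \<kappa> *
        (\<Sum>i\<in>UNIV. \<Sum>j\<in>UNIV. \<Sum>k\<in>UNIV. \<Sum>l\<in>UNIV. (g x $ i $ k * g x $ j $ l - g x $ i $ l * g x $ j $ k) * u $ i * v $ j * u $ k * v $ l)"
        unfolding A_def R_def left_diff_distrib right_diff_distrib sum_subtractf sum_distrib_left
        by (simp add: mult_ac)
      then show ?thesis by (simp add: gg RQ)
    qed
  qed
  then show ?thesis by (simp add: const_curv_at_def A_def)
qed

end

section \<open>Volume forms and Hodge stars\<close>

lemma levi3_simps [simp]:
  "levi3 1 2 3 = 1" "levi3 2 3 1 = 1" "levi3 3 1 2 = 1"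
  "levi3 2 1 3 = -1" "levi3 3 2 1 = -1" "levi3 1 3 2 = -1"
  "levi3 i i k = 0" "levi3 i k i = 0" "levi3 k i i = 0"
  using exhaust_3[of i] exhaust_3[of k]
  by (auto simp: levi3_def det_3 vector_3 axis_def)

lemma UNIV_option_3: "(UNIV :: 3 option set) = {None, Some 1, Some 2, Some 3}"
  by (auto simp: UNIV_option UNIV_3)

lemma sum_option_3: "(\<Sum>a\<in>UNIV. f a) = f None + f (Some 1) + f (Some 2) + f (Some (3::3))"
  for f :: "3 option \<Rightarrow> 'b::comm_monoid_add"
  by (simp add: sum_option sum_3 add.assoc)

text \<open>Laplace expansion along the row \<open>None\<close>, with \<open>m\<close> for the
  minors; the permutations are enumerated by inserting one index at a time.\<close>

lemma det_option_3:
  fixes A :: "'a::comm_ring_1^(3 option)^(3 option)"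
  defines "m \<equiv> \<lambda>i j k. A $ Some 1 $ i * (A $ Some 2 $ j * A $ Some 3 $ k - A $ Some 2 $ k * A $ Some 3 $ j)
     - A $ Some 1 $ j * (A $ Some 2 $ i * A $ Some 3 $ k - A $ Some 2 $ k * A $ Some 3 $ i)
     + A $ Some 1 $ k * (A $ Some 2 $ i * A $ Some 3 $ j - A $ Some 2 $ j * A $ Some 3 $ i)"
  shows "det A = A $ None $ None * m (Some 1) (Some 2) (Some 3) - A $ None $ Some 1 * m None (Some 2) (Some 3)
     + A $ None $ Some 2 * m None (Some 1) (Some 3) - A $ None $ Some 3 * m None (Some 1) (Some 2)"
proof -
  have f1: "finite {Some 1, Some 2, Some (3::3)}" "None \<notin> {Some 1, Some 2, Some (3::3)}" by auto
  have f2: "finite {Some 2, Some (3::3)}" "Some 1 \<notin> {Some 2, Some (3::3)}" by auto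
  have f3: "finite {Some (3::3)}" "Some 2 \<notin> {Some (3::3)}" by auto
  show ?thesis
    unfolding det_def UNIV_option_3
    unfolding sum_over_permutations_insert[OF f1]
    unfolding sum_over_permutations_insert[OF f2]
    unfolding sum_over_permutations_insert[OF f3]
    unfolding permutes_sing
    by (simp add: sign_swap_id permutation_swap_id sign_compose sign_id swap_id_eq permutation_compose m_def algebra_simps)
qed

lemma levi4_None:
  "levi4 None (Some i) (Some j) (Some k) = levi3 i j k"
  "levi4 (Some i) None (Some j) (Some k) = - levi3 i j k"
  "levi4 (Some i) (Some j) None (Some k) = levi3 i j k"
  "levi4 (Some i) (Some j) (Some k) None = - levi3 i j k"
  by (simp_all add: levi4_def levi3_def det_option_3 det_3 vector_3 axis_def)

lemma levi4_zero:
  "levi4 (Some i) (Some j) (Some k) (Some l) = 0"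
  "levi4 None None c d = 0" "levi4 None b None d = 0" "levi4 None b c None = 0"
  "levi4 a None None d = 0" "levi4 a None c None = 0" "levi4 a b None None = 0"
  by (simp_all add: levi4_def det_option_3 vector_3 axis_def)

lemma levi3_cycle: "levi3 i j k = levi3 j k i" "levi3 i j k = levi3 k i j"
  using exhaust_3[of i] exhaust_3[of j] exhaust_3[of k] by (elim disjE; simp)+

lemma levi3_swap: "levi3 i j k = - levi3 j i k" "levi3 i j k = - levi3 i k j"
  using exhaust_3[of i] exhaust_3[of j] exhaust_3[of k] by (elim disjE; simp)+

text \<open>Exchanging the two pairs of indices is an even permutation. This is what makes the Hodge
  star self-adjoint on 2-forms.\<close>

lemma levi4_pairs: "levi4 a b c d = levi4 c d a b"
  by (cases a; cases b; cases c; cases d)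
     (simp_all add: levi4_None levi4_zero, (metis levi3_cycle levi3_swap minus_minus)+)

lemma det_cyl_metric: "det (cyl_metric g X) = det (g (cyl_proj X))" for g :: "real^3 \<Rightarrow> real^3^3"
  by (simp add: det_option_3 det_3 algebra_simps)

text \<open>The determinant as an alternating form. Together with
  \<open>sqrt (det G) * det e = 1\<close> it shows that the volume form has components
  \<open>levi3\<close> in an oriented orthonormal frame.\<close>

lemma fr3_levi3: "fr3 e levi3 a b c = det e * levi3 a b c"
  using exhaust_3[of a] exhaust_3[of b] exhaust_3[of c]
  by (elim disjE; simp add: fr3_def sum_3 det_3 algebra_simps)

lemma oriented_orthonormal_is_frame: "oriented_orthonormal G e \<Longrightarrow> is_frame G e"
proof -
  assume o: "oriented_orthonormal G e"
  have "fr2 e (\<lambda>i j. G $ i $ j) a b = e $ a \<bullet> (G *v e $ b)" for a b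
    by (simp add: fr2_def inner_vec_def matrix_vector_mult_def sum_distrib_left mult_ac)
  with o show ?thesis by (simp add: is_frame_def oriented_orthonormal_def)
qed

text \<open>A consequence of det (e G e^T) = 1; the orientation decides the sign of the square
  root.\<close>

lemma oriented_orthonormal_det:
  assumes "oriented_orthonormal G e"
  shows "det G > 0" "sqrt (det G) * det e = 1"
proof -
  have e: "det e > 0" using assms by (simp add: oriented_orthonormal_def)
  have "e ** G ** transpose e = mat 1"
    using oriented_orthonormal_is_frame[OF assms] by (simp add: is_frame_mult)
  then have "det e * det G * det e = 1"
    by (metis det_I det_mul det_transpose)
  then have G: "det G = 1 / (det e)\<^sup>2" using e by (simp add: field_simps power2_eq_square)
  then show "det G > 0" using e by simp
  show "sqrt (det G) * det e = 1" using e by (simp add: G real_sqrt_divide)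
qed

lemma raise_frame:
  assumes "is_frame G e"
  shows "(\<Sum>p\<in>UNIV. \<Sum>q\<in>UNIV. matrix_inv G $ k $ p * matrix_inv G $ l $ q * T p q) =
    (\<Sum>r\<in>UNIV. \<Sum>s\<in>UNIV. e $ r $ k * e $ s $ l * fr2 e T r s)"
proof -
  have "(\<Sum>p\<in>UNIV. \<Sum>q\<in>UNIV. matrix_inv G $ k $ p * matrix_inv G $ l $ q * T p q) =
    (\<Sum>p\<in>UNIV. \<Sum>q\<in>UNIV. \<Sum>r\<in>UNIV. \<Sum>s\<in>UNIV. e $ r $ k * e $ s $ l * (e $ r $ p * e $ s $ q * T p q))"
    by (simp only: matrix_inv_frame[OF assms] sum_product) (simp add: sum_distrib_left sum_distrib_right mult_ac)
  also have "\<dots> = (\<Sum>p\<in>UNIV. \<Sum>r\<in>UNIV. \<Sum>q\<in>UNIV. \<Sum>s\<in>UNIV. e $ r $ k * e $ s $ l * (e $ r $ p * e $ s $ q * T p q))"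
    by (rule sum.cong[OF refl], rule sum.swap)
  also have "\<dots> = (\<Sum>r\<in>UNIV. \<Sum>p\<in>UNIV. \<Sum>s\<in>UNIV. \<Sum>q\<in>UNIV. e $ r $ k * e $ s $ l * (e $ r $ p * e $ s $ q * T p q))"
    by (subst sum.swap) (rule sum.cong[OF refl], rule sum.cong[OF refl], rule sum.swap)
  also have "\<dots> = (\<Sum>r\<in>UNIV. \<Sum>s\<in>UNIV. \<Sum>p\<in>UNIV. \<Sum>q\<in>UNIV. e $ r $ k * e $ s $ l * (e $ r $ p * e $ s $ q * T p q))"
    by (rule sum.cong[OF refl], rule sum.swap)
  finally show ?thesis by (simp add: fr2_def sum_distrib_left mult_ac)
qed

context local_metric begin

text \<open>Raising an index commutes with covariant differentiation; the last sum is the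
  Christoffel term of the raised index.\<close>

lemma pd_raise:
  assumes y: "y \<in> S" and v: "\<And>p. v p differentiable at y"
  shows "pd a (\<lambda>z. \<Sum>p\<in>UNIV. matrix_inv (g z) $ k $ p * v p z) y =
    (\<Sum>p\<in>UNIV. matrix_inv (g y) $ k $ p * (pd a (v p) y - (\<Sum>m\<in>UNIV. christoffel g y m a p * v m y)))
    - (\<Sum>m\<in>UNIV. christoffel g y k a m * (\<Sum>p\<in>UNIV. matrix_inv (g y) $ m $ p * v p y))"
proof -
  let ?I = "matrix_inv (g y)" and ?G = "christoffel g y"
  have "pd a (\<lambda>z. \<Sum>p\<in>UNIV. matrix_inv (g z) $ k $ p * v p z) y =
     (\<Sum>p\<in>UNIV. ?I $ k $ p * pd a (v p) y + pd a (\<lambda>z. matrix_inv (g z) $ k $ p) y * v p y)"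
    by (simp add: pd_sum pd_mult diff_inv[OF y] v differentiable_mult)
  also have "\<dots> = (\<Sum>p\<in>UNIV. ?I $ k $ p * pd a (v p) y)
     - (\<Sum>p\<in>UNIV. \<Sum>m\<in>UNIV. ?G k a m * ?I $ m $ p * v p y) - (\<Sum>p\<in>UNIV. \<Sum>m\<in>UNIV. ?G p a m * ?I $ k $ m * v p y)"
    unfolding pd_inv[OF y] by (simp add: sum.distrib sum_subtractf sum_distrib_right sum_distrib_left algebra_simps)
  also have "(\<Sum>p\<in>UNIV. \<Sum>m\<in>UNIV. ?G k a m * ?I $ m $ p * v p y) = (\<Sum>m\<in>UNIV. \<Sum>p\<in>UNIV. ?G k a m * ?I $ m $ p * v p y)"
    by (rule sum.swap)
  also have "(\<Sum>p\<in>UNIV. \<Sum>m\<in>UNIV. ?G p a m * ?I $ k $ m * v p y) = (\<Sum>p\<in>UNIV. \<Sum>m\<in>UNIV. ?G m a p * ?I $ k $ p * v m y)"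
    by (rule sum.swap)
  finally show ?thesis
    by (simp add: sum_subtractf right_diff_distrib sum_distrib_left mult_ac)
qed

lemma diff_raise: "y \<in> S \<Longrightarrow> (\<And>p. v p differentiable at y) \<Longrightarrow>
    (\<lambda>z. \<Sum>p\<in>UNIV. matrix_inv (g z) $ k $ p * v p z) differentiable at y"
  by (intro differentiable_sum ballI differentiable_mult diff_inv) auto

lemma pd_raise2:
  assumes y: "y \<in> S" and w: "w differentiable at y"
  shows "pd a (\<lambda>z. \<Sum>p\<in>UNIV. \<Sum>q\<in>UNIV. matrix_inv (g z) $ k $ p * matrix_inv (g z) $ l $ q * w z $ p $ q) y =
    (\<Sum>p\<in>UNIV. \<Sum>q\<in>UNIV. matrix_inv (g y) $ k $ p * matrix_inv (g y) $ l $ q * cov2 g w y $ a $ p $ q)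
    - (\<Sum>m\<in>UNIV. christoffel g y k a m * (\<Sum>p\<in>UNIV. \<Sum>q\<in>UNIV. matrix_inv (g y) $ m $ p * matrix_inv (g y) $ l $ q * w y $ p $ q))
    - (\<Sum>m\<in>UNIV. christoffel g y l a m * (\<Sum>p\<in>UNIV. \<Sum>q\<in>UNIV. matrix_inv (g y) $ k $ p * matrix_inv (g y) $ m $ q * w y $ p $ q))"
proof -
  let ?I = "matrix_inv (g y)" and ?G = "christoffel g y"
  have d: "(\<lambda>z. w z $ p $ q) differentiable at y" for p q
    by (intro differentiable_vec_nth w)
  note d' = diff_raise[OF y, of "\<lambda>q z. w z $ p $ q" for p, OF d]
  have wn: "pd a (\<lambda>z. w z $ p $ q) y = pd a w y $ p $ q" for p q
    by (simp add: pd_nth w differentiable_vec_nth)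
  have 1: "(\<Sum>m\<in>UNIV. ?G m a p * (\<Sum>q\<in>UNIV. ?I $ l $ q * w y $ m $ q)) = (\<Sum>q\<in>UNIV. ?I $ l $ q * (\<Sum>m\<in>UNIV. ?G m a p * w y $ m $ q))" for p
    unfolding sum_distrib_left by (subst sum.swap) (simp add: mult_ac)
  have 2: "(\<Sum>p\<in>UNIV. ?I $ k $ p * (\<Sum>m\<in>UNIV. ?G l a m * (\<Sum>q\<in>UNIV. ?I $ m $ q * w y $ p $ q))) =
     (\<Sum>m\<in>UNIV. ?G l a m * (\<Sum>p\<in>UNIV. ?I $ k $ p * (\<Sum>q\<in>UNIV. ?I $ m $ q * w y $ p $ q)))"
    unfolding sum_distrib_left by (subst sum.swap) (simp add: mult_ac)
  have "pd a (\<lambda>z. \<Sum>p\<in>UNIV. \<Sum>q\<in>UNIV. matrix_inv (g z) $ k $ p * matrix_inv (g z) $ l $ q * w z $ p $ q) y =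
     pd a (\<lambda>z. \<Sum>p\<in>UNIV. matrix_inv (g z) $ k $ p * (\<Sum>q\<in>UNIV. matrix_inv (g z) $ l $ q * w z $ p $ q)) y"
    by (simp add: sum_distrib_left mult.assoc)
  also have "\<dots> = (\<Sum>p\<in>UNIV. ?I $ k $ p * (\<Sum>q\<in>UNIV. ?I $ l $ q * cov2 g w y $ a $ p $ q))
    - (\<Sum>m\<in>UNIV. ?G k a m * (\<Sum>p\<in>UNIV. ?I $ m $ p * (\<Sum>q\<in>UNIV. ?I $ l $ q * w y $ p $ q)))
    - (\<Sum>m\<in>UNIV. ?G l a m * (\<Sum>p\<in>UNIV. ?I $ k $ p * (\<Sum>q\<in>UNIV. ?I $ m $ q * w y $ p $ q)))"
    unfolding pd_raise[OF y d'] pd_raise[OF y d] 1 2[symmetric] cov2_nth wn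
    by (simp add: right_diff_distrib distrib_left sum_subtractf sum.distrib)
  finally show ?thesis by (simp add: sum_distrib_left mult.assoc)
qed

end

lemma pd_sqrt:
  assumes "f differentiable at x" "f x > 0"
  shows "(\<lambda>y. sqrt (f y)) differentiable at x" "pd k (\<lambda>y. sqrt (f y)) x = pd k f x / (2 * sqrt (f x))"
proof -
  have "(sqrt has_derivative (\<lambda>v. v / (2 * sqrt (f x)))) (at (f x))"
    using DERIV_real_sqrt[OF assms(2)] unfolding has_field_derivative_def
    by (rule has_derivative_eq_rhs) (auto simp: field_simps)
  then have "((\<lambda>y. sqrt (f y)) has_derivative (\<lambda>v. frechet_derivative f (at x) v / (2 * sqrt (f x)))) (at x)"
    using has_derivative_compose[OF pd_has_derivative[OF assms(1)], of sqrt "\<lambda>v. v / (2 * sqrt (f x))"]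
    by simp
  then show "(\<lambda>y. sqrt (f y)) differentiable at x" "pd k (\<lambda>y. sqrt (f y)) x = pd k f x / (2 * sqrt (f x))"
    by (auto simp: differentiable_def pd_eqI pd_def[of k f])
qed

locale local_metric_3 = local_metric g S for g :: "real^3 \<Rightarrow> real^3^3" and S
begin

text \<open>Jacobi's formula: the trace of the inverse metric times the derivative of the metric is
  twice the contracted Christoffel symbol. In dimension three it is checked by expanding the
  determinant and inserting metric compatibility.\<close>

lemma pd_det:
  assumes y: "y \<in> S"
  shows "pd a (\<lambda>z. det (g z)) y = 2 * (\<Sum>m\<in>UNIV. christoffel g y m a m) * det (g y)"
proof -
  have p: "pd a (\<lambda>z. g z $ i $ j) y = (\<Sum>m\<in>UNIV. christoffel g y m a i * g y $ m $ j + christoffel g y m a j * g y $ m $ i)" for i j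
    using metric_compatible[OF y, of a i j] by (simp add: cov2_nth pd_nth_nth[OF y] sym[OF y, of i])
  show ?thesis
    unfolding det_3
    by (simp add: pd_add pd_diff pd_mult differentiable_mult differentiable_add differentiable_diff diff_nth[OF y] p sum_3
        sym[OF y, of 2 1] sym[OF y, of 3 1] sym[OF y, of 3 2] algebra_simps)
qed

text \<open>The volume form is parallel. The contracted Christoffel symbol from
  \<open>sqrt (det (g y))\<close> cancels the Christoffel terms of the three indices of
  \<open>levi3\<close>, as an endomorphism acts on an alternating 3-form by its trace.\<close>

lemma cov1_star2:
  assumes y: "y \<in> S" and pos: "det (g y) > 0" and w: "w differentiable at y"
  shows "cov1 g (\<lambda>z. star2 (g z) (w z)) y $ a $ i = star2 (g y) (cov2 g w y $ a) $ i"
proof -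
  define B where "B k l = (\<lambda>z. \<Sum>p\<in>UNIV. \<Sum>q\<in>UNIV. matrix_inv (g z) $ k $ p * matrix_inv (g z) $ l $ q * w z $ p $ q)" for k l
  define N where "N k l = (\<Sum>p\<in>UNIV. \<Sum>q\<in>UNIV. matrix_inv (g y) $ k $ p * matrix_inv (g y) $ l $ q * cov2 g w y $ a $ p $ q)" for k l
  have dw: "(\<lambda>z. w z $ p $ q) differentiable at y" for p q
    by (intro differentiable_vec_nth w)
  have dB: "B k l differentiable at y" for k l
    unfolding B_def by (intro differentiable_sum ballI differentiable_mult diff_inv y dw) auto
  have ddet: "(\<lambda>z. det (g z)) differentiable at y" by (intro differentiable_det diff_nth y)
  have s: "star2 (g z) (w z) $ i = sqrt (det (g z)) / 2 * (\<Sum>k\<in>UNIV. \<Sum>l\<in>UNIV. B k l z * levi3 k l i)" for z i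
    by (simp add: star2_def B_def sum_distrib_right)
  have s': "star2 (g y) (cov2 g w y $ a) $ i = sqrt (det (g y)) / 2 * (\<Sum>k\<in>UNIV. \<Sum>l\<in>UNIV. N k l * levi3 k l i)"
    by (simp add: star2_def N_def sum_distrib_right)
  have pB: "pd a (B k l) y = N k l - (\<Sum>m\<in>UNIV. christoffel g y k a m * B m l y) - (\<Sum>m\<in>UNIV. christoffel g y l a m * B k m y)" for k l
    unfolding B_def N_def by (rule pd_raise2[OF y w])
  have ps: "pd a (\<lambda>z. sqrt (det (g z))) y = (\<Sum>m\<in>UNIV. christoffel g y m a m) * sqrt (det (g y))"
    using pos by (simp add: pd_sqrt(2)[OF ddet pos] pd_det[OF y] field_simps)
  have dsum: "(\<lambda>z. \<Sum>k\<in>UNIV. \<Sum>l\<in>UNIV. B k l z * levi3 k l i) differentiable at y" for i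
    by (intro differentiable_sum ballI differentiable_mult dB) auto
  have dst: "(\<lambda>z. star2 (g z) (w z)) differentiable at y"
    by (intro differentiable_vecI) (simp add: s differentiable_mult pd_sqrt(1)[OF ddet pos] dsum)
  have "pd a (\<lambda>z. star2 (g z) (w z)) y $ i = sqrt (det (g y)) / 2 * ((\<Sum>m\<in>UNIV. christoffel g y m a m) * (\<Sum>k\<in>UNIV. \<Sum>l\<in>UNIV. B k l y * levi3 k l i)
     + (\<Sum>k\<in>UNIV. \<Sum>l\<in>UNIV. pd a (B k l) y * levi3 k l i))"
    unfolding pd_nth[OF dst] s
    by (simp add: pd_mult pd_divide pd_sum differentiable_mult differentiable_divide differentiable_sum dB dsum pd_sqrt(1)[OF ddet pos] ps)
       (simp add: algebra_simps)
  then show ?thesis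
    unfolding cov1_def vec_lambda_beta s' s pB
    using exhaust_3[of i] by (elim disjE; simp add: sum_3 algebra_simps)
qed

end

section \<open>The anti-self-dual Weyl operator in a frame\<close>

text \<open>The difference quotient of the product at 0 is c times that of f. With f a component of
  the Weyl tensor or of its image, the varying projections and inverse metrics may be frozen at s =
  0.\<close>

lemma has_derivative_mult_vanishing:
  fixes c f :: "real \<Rightarrow> real"
  assumes "(f has_real_derivative D) (at 0)" "f 0 = 0" "isCont c 0"
  shows "((\<lambda>s. c s * f s) has_real_derivative c 0 * D) (at 0)"
proof -
  have "((\<lambda>h. c h * (f h / h)) \<longlongrightarrow> c 0 * D) (at 0)"
    using assms by (intro tendsto_mult) (auto simp: DERIV_def isCont_def)
  then show ?thesis using assms(2) by (simp add: DERIV_def)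
qed

locale frame_point = cyl_variation g S H
  for g :: "real^3 \<Rightarrow> real^3^3" and S and H :: "real^(3 option) \<Rightarrow> real^(3 option)^(3 option)" +
  fixes x :: "real^3" and t \<kappa> :: real and e :: "real^3^3"
  assumes x: "x \<in> S" and cc: "const_curv_at g x \<kappa>" and oe: "oriented_orthonormal (g x) e"
begin

abbreviation "X \<equiv> cyl_point t x"
text \<open>\<open>cyl_metric\<close> serves merely as a block matrix here: the rows of
  \<open>E\<close> are the unit vector in the direction of t and the frame of Y.\<close>

abbreviation "E \<equiv> cyl_metric (\<lambda>y. e) X"
abbreviation "G \<equiv> cyl_metric g X"

lemma X: "X \<in> cyl_set S" using x by simp

lemmas frame_e = oriented_orthonormal_is_frame[OF oe]

lemma fr2_E:
  "fr2 E T None None = T None None"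
  "fr2 E T None (Some b) = (\<Sum>j\<in>UNIV. e $ b $ j * T None (Some j))"
  "fr2 E T (Some a) None = (\<Sum>i\<in>UNIV. e $ a $ i * T (Some i) None)"
  "fr2 E T (Some a) (Some b) = fr2 e (\<lambda>i j. T (Some i) (Some j)) a b"
  by (simp_all add: fr2_def sum_option)

lemma frame_E: "is_frame G E"
  unfolding is_frame_def forall_option
  by (simp add: fr2_E is_frame_metric[OF frame_e])

lemma riemann_x: "riemann g x i j k l = \<kappa> * (g x $ i $ k * g x $ j $ l - g x $ i $ l * g x $ j $ k)"
  using cc by (simp add: const_curv_at_def)

lemma curv_endo_x: "curv_endo g x i j k l = \<kappa> * ((if l = i then 1 else 0) * g x $ j $ k - (if l = j then 1 else 0) * g x $ i $ k)"
proof -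
  have "curv_endo g x i j k l = \<kappa> * ((\<Sum>m\<in>UNIV. matrix_inv (g x) $ l $ m * g x $ m $ i) * g x $ j $ k
      - (\<Sum>m\<in>UNIV. matrix_inv (g x) $ l $ m * g x $ m $ j) * g x $ i $ k)"
    unfolding curv_endo_riemann[OF x] riemann_x
    by (simp add: sum_distrib_left sum_distrib_right sum_subtractf sym[OF x, of i] sym[OF x, of j] algebra_simps)
  then show ?thesis by (simp only: inv_left[OF x])
qed

lemma ricci_x: "ricci g x $ a $ b = 2 * \<kappa> * g x $ a $ b"
proof -
  let ?I = "matrix_inv (g x)"
  have "ricci g x $ a $ b = \<kappa> * ((\<Sum>c\<in>UNIV. \<Sum>d\<in>UNIV. ?I $ c $ d * g x $ d $ c) * g x $ a $ b
      - (\<Sum>c\<in>UNIV. (\<Sum>d\<in>UNIV. g x $ a $ d * ?I $ d $ c) * g x $ c $ b))"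
    unfolding ricci_def vec_lambda_beta riemann_x
    by (simp add: sum_distrib_left sum_distrib_right sum_subtractf algebra_simps inv_sym[OF x] sym[OF x])
  then show ?thesis by (simp only: inv_left[OF x] inv_right[OF x] sum_delta_mult) (simp add: sum_3)
qed

lemma scalar_x: "scalar_curvature g x = 6 * \<kappa>"
proof -
  have "scalar_curvature g x = 2 * \<kappa> * (\<Sum>c\<in>UNIV. \<Sum>d\<in>UNIV. matrix_inv (g x) $ c $ d * g x $ d $ c)"
    unfolding scalar_curvature_def mtrace_def ricci_x
    by (simp add: sum_distrib_left sym[OF x] mult_ac)
  then show ?thesis by (simp only: inv_left[OF x]) (simp add: sum_3)
qed

lemma ricci_cyl:
  "ricci (cyl_metric g) X $ None $ b = 0" "ricci (cyl_metric g) X $ a $ None = 0"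
  "ricci (cyl_metric g) X $ Some i $ Some j = 2 * \<kappa> * g x $ i $ j"
  using ricci_x[of i j]
  by (simp_all add: ricci_def sum_option riemann_cyl[OF X] matrix_inv_cyl[OF X])

lemma scalar_cyl: "scalar_curvature (cyl_metric g) X = 6 * \<kappa>"
  using scalar_x
  by (simp add: scalar_curvature_def mtrace_def sum_option ricci_cyl matrix_inv_cyl[OF X] ricci_x)

text \<open>No conformal change is made: with Ricci tensor \<open>2 * \<kappa>\<close> times the
  metric of Y and scalar curvature \<open>6 * \<kappa>\<close>, the trace terms cancel the curvature
  of Y index by index.\<close>

lemma weyl_cyl: "weyl (cyl_metric g) X a b c d = 0"
  by (cases a; cases b; cases c; cases d)
     (simp_all add: weyl_def riemann_cyl[OF X] ricci_cyl scalar_cyl riemann_x field_simps)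

text \<open>The components in the frame \<open>E\<close> of the i-th form dt wedge e_i minus star
  e_i. They are numerical constants because the frame is orthonormal and oriented.\<close>

definition basis_form :: "3 \<Rightarrow> 3 option \<Rightarrow> 3 option \<Rightarrow> real" where
  "basis_form i a b = (case a of None \<Rightarrow> (case b of None \<Rightarrow> 0 | Some j \<Rightarrow> if i = j then 1 else 0)
     | Some k \<Rightarrow> (case b of None \<Rightarrow> if i = k then - 1 else 0 | Some l \<Rightarrow> - levi3 i k l))"

abbreviation "\<xi> i \<equiv> g x *v (e $ i)"
abbreviation "\<omega> i \<equiv> asd_form (g x) (\<xi> i)"

definition raise :: "real^(3 option)^(3 option) \<Rightarrow> 3 option \<Rightarrow> 3 option \<Rightarrow> real" where
  "raise \<eta> k l = (\<Sum>p\<in>UNIV. \<Sum>q\<in>UNIV. matrix_inv G $ k $ p * matrix_inv G $ l $ q * \<eta> $ p $ q)"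

lemma inv_xi: "(\<Sum>p\<in>UNIV. matrix_inv (g x) $ k $ p * \<xi> i $ p) = e $ i $ k"
proof -
  have "matrix_inv (g x) *v \<xi> i = e $ i"
    by (simp add: matrix_vector_mul_assoc matrix_inv_left[OF nz[OF x]])
  then have "(matrix_inv (g x) *v \<xi> i) $ k = e $ i $ k" by simp
  then show ?thesis by (simp add: matrix_vector_mult_def)
qed

lemma e_xi: "(\<Sum>p\<in>UNIV. e $ a $ p * \<xi> i $ p) = (if a = i then 1 else 0)"
proof -
  have "(\<Sum>p\<in>UNIV. e $ a $ p * \<xi> i $ p) = fr2 e (\<lambda>i j. g x $ i $ j) a i"
    by (simp add: fr2_def matrix_vector_mult_def sum_distrib_left mult_ac)
  then show ?thesis by (simp add: is_frame_metric[OF frame_e])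
qed

lemma star1_xi: "star1 (g x) (\<xi> i) $ k $ l = sqrt (det (g x)) * (\<Sum>a\<in>UNIV. e $ i $ a * levi3 a k l)"
proof -
  have "star1 (g x) (\<xi> i) $ k $ l = sqrt (det (g x)) * (\<Sum>a\<in>UNIV. (\<Sum>p\<in>UNIV. matrix_inv (g x) $ a $ p * \<xi> i $ p) * levi3 a k l)"
    by (simp add: star1_def sum_distrib_right)
  then show ?thesis by (simp only: inv_xi)
qed

lemma fr2_star1: "fr2 e (\<lambda>k l. star1 (g x) (\<xi> i) $ k $ l) r s = levi3 i r s"
proof -
  have "fr2 e (\<lambda>k l. star1 (g x) (\<xi> i) $ k $ l) r s = sqrt (det (g x)) * fr3 e levi3 i r s"
    unfolding star1_xi fr2_linear fr2_sum by (simp add: fr3_def fr2_def sum_distrib_left mult_ac)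
  then show ?thesis
    using oriented_orthonormal_det(2)[OF oe] by (simp add: fr3_levi3)
qed

lemma asd_form_nth:
  "asd_form F v $ None $ None = 0" "asd_form F v $ None $ Some j = v $ j" "asd_form F v $ Some i $ None = - v $ i"
  "asd_form F v $ Some i $ Some j = - star1 F v $ i $ j"
  by (simp_all add: asd_form_def)

lemma fr2_omega: "fr2 E (\<lambda>a b. \<omega> i $ a $ b) r s = basis_form i r s"
  by (cases r; cases s)
     (simp_all add: fr2_E asd_form_nth basis_form_def e_xi fr2_linear fr2_star1 sum_negf)

lemma raise_omega: "raise (\<omega> i) k l = (\<Sum>r\<in>UNIV. \<Sum>s\<in>UNIV. E $ r $ k * E $ s $ l * basis_form i r s)"
  unfolding raise_def raise_frame[OF frame_E] fr2_omega ..

lemma raise_omega_Some: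
  "raise (\<omega> i) None None = 0" "raise (\<omega> i) None (Some l) = e $ i $ l" "raise (\<omega> i) (Some k) None = - e $ i $ k"
  "raise (\<omega> i) (Some k) (Some l) = - (\<Sum>r\<in>UNIV. \<Sum>s\<in>UNIV. e $ r $ k * e $ s $ l * levi3 i r s)"
  by (simp_all add: raise_omega sum_option basis_form_def sum_negf if_distrib[of "\<lambda>a. _ * a"] cong: if_cong)

lemma hodge4_raise: "hodge4 G \<eta> $ c $ d = sqrt (det (g x)) / 2 * (\<Sum>a\<in>UNIV. \<Sum>b\<in>UNIV. raise \<eta> a b * levi4 a b c d)"
  by (simp add: hodge4_def raise_def sum_distrib_right det_cyl_metric)

lemma levi3_levi3: "(\<Sum>r\<in>UNIV. \<Sum>s\<in>UNIV. levi3 i r s * levi3 r s u) = (if i = u then 2 else 0)"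
  using exhaust_3[of i] exhaust_3[of u] by (elim disjE; simp add: sum_3)

text \<open>On 1-forms of Y the star squares to the identity. This is tested on the frame vectors,
  where the volume form becomes \<open>levi3\<close>, and the invertibility of \<open>e\<close> does
  the rest.\<close>

lemma star_star_xi:
  "sqrt (det (g x)) / 2 * (\<Sum>a\<in>UNIV. \<Sum>b\<in>UNIV. (\<Sum>r\<in>UNIV. \<Sum>s\<in>UNIV. e $ r $ a * e $ s $ b * levi3 i r s) * levi3 a b d) = \<xi> i $ d"
proof -
  define y where "y d = sqrt (det (g x)) / 2 * (\<Sum>a\<in>UNIV. \<Sum>b\<in>UNIV. (\<Sum>r\<in>UNIV. \<Sum>s\<in>UNIV. e $ r $ a * e $ s $ b * levi3 i r s) * levi3 a b d)" for d
  have "(\<Sum>d\<in>UNIV. e $ u $ d * y d) = sqrt (det (g x)) / 2 * (\<Sum>r\<in>UNIV. \<Sum>s\<in>UNIV. levi3 i r s * fr3 e levi3 r s u)" for u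
    unfolding y_def fr3_def by (simp add: sum_3 algebra_simps)
  then have 2: "(\<Sum>d\<in>UNIV. e $ u $ d * y d) = (sqrt (det (g x)) * det e) * (\<Sum>r\<in>UNIV. \<Sum>s\<in>UNIV. levi3 i r s * levi3 r s u) / 2" for u
    by (simp add: fr3_levi3 sum_distrib_left mult_ac)
  have "(\<Sum>d\<in>UNIV. e $ u $ d * y d) = (if i = u then 1 else 0)" for u
    unfolding 2 oriented_orthonormal_det(2)[OF oe] levi3_levi3 by simp
  then have "(\<Sum>d\<in>UNIV. e $ u $ d * y d) = (\<Sum>d\<in>UNIV. e $ u $ d * \<xi> i $ d)" for u
    by (cases "i = u") (simp_all add: e_xi)
  then have "e *v (\<chi> d. y d) = e *v \<xi> i"
    by (simp add: vec_eq_iff matrix_vector_mult_def)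
  moreover have "det e \<noteq> 0" using oe by (simp add: oriented_orthonormal_def)
  ultimately have "(\<chi> d. y d) = \<xi> i"
    by (metis invertible_det_nz invertible_def matrix_vector_mul_assoc matrix_vector_mul_lid)
  then show ?thesis unfolding y_def[symmetric] by (metis vec_lambda_beta)
qed

text \<open>Consequently the projection to anti-self-dual forms at s = 0 fixes
  \<open>\<omega> i\<close>. The components with one index \<open>None\<close> use that the star of
  Y squares to the identity.\<close>

lemma hodge4_omega: "hodge4 G (\<omega> i) = - \<omega> i"
proof -
  have a: "hodge4 G (\<omega> i) $ None $ Some d = - \<xi> i $ d" for d
    unfolding hodge4_raise star_star_xi[symmetric]
    by (simp add: sum_option levi4_None levi4_zero raise_omega_Some sum_negf)
  have b: "hodge4 G (\<omega> i) $ Some d $ None = \<xi> i $ d" for d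
    unfolding hodge4_raise star_star_xi[symmetric]
    by (simp add: sum_option levi4_None levi4_zero raise_omega_Some sum_negf)
  have c: "hodge4 G (\<omega> i) $ Some c $ Some d = star1 (g x) (\<xi> i) $ c $ d" for c d
    unfolding hodge4_raise star1_xi
    by (simp add: sum_option levi4_None levi4_zero raise_omega_Some sum_negf)
  have d: "hodge4 G (\<omega> i) $ None $ None = 0"
    unfolding hodge4_raise by (simp add: sum_option levi4_None levi4_zero)
  show ?thesis
    by (simp add: vec_eq_iff forall_option a b c d asd_form_nth)
qed

lemma form_inner_raise: "form_inner G \<eta> \<zeta> = (\<Sum>a\<in>UNIV. \<Sum>b\<in>UNIV. \<eta> $ a $ b * raise \<zeta> a b) / 2"
  by (simp add: form_inner_def raise_def sum_distrib_left mult_ac)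

lemma form_inner_sym: "form_inner G \<eta> \<zeta> = form_inner G \<zeta> \<eta>"
proof -
  have "(\<Sum>a\<in>UNIV. \<Sum>b\<in>UNIV. \<Sum>p\<in>UNIV. \<Sum>q\<in>UNIV. matrix_inv G $ a $ p * matrix_inv G $ b $ q * \<eta> $ a $ b * \<zeta> $ p $ q) =
    (\<Sum>p\<in>UNIV. \<Sum>q\<in>UNIV. \<Sum>a\<in>UNIV. \<Sum>b\<in>UNIV. matrix_inv G $ a $ p * matrix_inv G $ b $ q * \<eta> $ a $ b * \<zeta> $ p $ q)"
    by (subst (2) sum.swap, subst sum.swap, subst (3) sum.swap, subst (2) sum.swap) (rule refl)
  also have "\<dots> = (\<Sum>p\<in>UNIV. \<Sum>q\<in>UNIV. \<Sum>a\<in>UNIV. \<Sum>b\<in>UNIV. matrix_inv G $ p $ a * matrix_inv G $ q $ b * \<zeta> $ p $ q * \<eta> $ a $ b)"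
    by (simp add: M.inv_sym[OF X] mult_ac)
  finally show ?thesis by (simp add: form_inner_def)
qed

text \<open>Both sides contract two raised forms with \<open>levi4\<close>, whose two pairs of
  indices may be exchanged. Self-adjointness allows the outer projection to be moved onto
  \<open>\<omega> j\<close>.\<close>

lemma form_inner_hodge: "form_inner G (hodge4 G \<eta>) \<zeta> = form_inner G \<eta> (hodge4 G \<zeta>)"
proof -
  have *: "form_inner G (hodge4 G \<eta>) \<zeta> = sqrt (det (g x)) / 4 * (\<Sum>c\<in>UNIV. \<Sum>d\<in>UNIV. \<Sum>a\<in>UNIV. \<Sum>b\<in>UNIV. raise \<eta> a b * raise \<zeta> c d * levi4 a b c d)" for \<eta> \<zeta>
    by (simp add: form_inner_raise hodge4_raise sum_distrib_left sum_distrib_right sum_divide_distrib mult_ac)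
  have "(\<Sum>c\<in>UNIV. \<Sum>d\<in>UNIV. \<Sum>a\<in>UNIV. \<Sum>b\<in>UNIV. raise \<eta> a b * raise \<zeta> c d * levi4 a b c d) =
     (\<Sum>a\<in>UNIV. \<Sum>b\<in>UNIV. \<Sum>c\<in>UNIV. \<Sum>d\<in>UNIV. raise \<eta> a b * raise \<zeta> c d * levi4 a b c d)"
    by (subst (2) sum.swap, subst sum.swap, subst (3) sum.swap, subst (2) sum.swap) (rule refl)
  also have "\<dots> = (\<Sum>a\<in>UNIV. \<Sum>b\<in>UNIV. \<Sum>c\<in>UNIV. \<Sum>d\<in>UNIV. raise \<zeta> c d * raise \<eta> a b * levi4 c d a b)"
    by (subst levi4_pairs) (simp add: mult_ac)
  finally show ?thesis unfolding form_inner_sym[of \<eta>] * by simp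
qed

end

lemma hodge4_nth: "hodge4 F \<eta> $ c $ d = sqrt (det F) / 2 *
     (\<Sum>a\<in>UNIV. \<Sum>b\<in>UNIV. \<Sum>p\<in>UNIV. \<Sum>q\<in>UNIV.
        (matrix_inv F $ a $ p * matrix_inv F $ b $ q * levi4 a b c d) * \<eta> $ p $ q)"
  by (simp add: hodge4_def mult_ac)

lemma asd_part_nth: "asd_part F \<eta> $ c $ d = (\<eta> $ c $ d - hodge4 F \<eta> $ c $ d) / 2"
  by (simp add: asd_part_def)

lemma form_inner_diff: "form_inner F (\<eta> - \<theta>) \<zeta> = form_inner F \<eta> \<zeta> - form_inner F \<theta> \<zeta>"
  by (simp add: form_inner_def algebra_simps sum_subtractf diff_divide_distrib)

lemma form_inner_scale: "form_inner F (c *\<^sub>R \<eta>) \<zeta> = c * form_inner F \<eta> \<zeta>"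
  by (simp add: form_inner_def sum_distrib_left mult_ac)

lemma form_inner_minus: "form_inner F \<eta> (- \<zeta>) = - form_inner F \<eta> \<zeta>"
  by (simp add: form_inner_def sum_negf)

context frame_point begin

text \<open>The linearized Weyl tensor as an operator on the fixed form \<open>\<omega> i\<close>;
  the indices are raised with the unperturbed metric.\<close>

definition Weyl_dir :: "3 \<Rightarrow> real^(3 option)^(3 option)" where
  "Weyl_dir i = (\<chi> a b. (\<Sum>k\<in>UNIV. \<Sum>l\<in>UNIV. V.weyl_var X a b k l * raise (\<omega> i) k l) / 2)"

lemma isCont_inv: "isCont (\<lambda>s. matrix_inv (V.metric_at s X) $ k $ l) 0"
  by (rule DERIV_isCont[OF V.has_derivative_inv[OF X]])

lemma isCont_sqrt_det: "isCont (\<lambda>s. sqrt (det (V.metric_at s X))) 0"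
proof -
  have "(\<lambda>s. V.metric_at s X $ i $ j) differentiable at 0" for i j
    using V.has_derivative_metric[of X i j] by (auto simp: has_field_derivative_def differentiable_def)
  then have "isCont (\<lambda>s. det (V.metric_at s X)) 0"
    by (intro differentiable_imp_continuous_within differentiable_det)
  then show ?thesis by (rule continuous_real_sqrt)
qed

lemma has_derivative_asd_weyl:
  "((\<lambda>s. form_inner G (asd_weyl_operator (V.metric_at s) X (\<omega> i)) (\<omega> j)) has_real_derivative
     form_inner G (Weyl_dir i) (\<omega> j)) (at 0)"
proof -
  define U where "U s = asd_part (V.metric_at s X) (\<omega> i)" for s
  define W where "W s = weyl_operator (V.metric_at s) X (U s)" for s
  have U0: "U 0 = \<omega> i"
    by (simp add: U_def V.metric_at_0 asd_part_def hodge4_omega)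
  \<comment> \<open>Continuity suffices for the projected form, since it is multiplied by the Weyl
    tensor, which vanishes at s = 0.\<close>
  have cU: "isCont (\<lambda>s. U s $ p $ q) 0" for p q
    unfolding U_def asd_part_nth hodge4_nth
    by (intro continuous_intros isCont_inv isCont_sqrt_det) auto
  have W_nth: "W s $ a $ b = (\<Sum>k\<in>UNIV. \<Sum>l\<in>UNIV. \<Sum>p\<in>UNIV. \<Sum>q\<in>UNIV.
        (matrix_inv (V.metric_at s X) $ k $ p * matrix_inv (V.metric_at s X) $ l $ q * U s $ p $ q) * weyl (V.metric_at s) X a b k l) / 2" for s a b
    by (simp add: W_def weyl_operator_def mult_ac)
  have W0: "W 0 $ a $ b = 0" for a b
    by (simp add: W_nth V.metric_at_0 weyl_cyl)
  have dW: "((\<lambda>s. W s $ a $ b) has_real_derivative Weyl_dir i $ a $ b) (at 0)" for a b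
  proof -
    have "((\<lambda>s. W s $ a $ b) has_real_derivative
      (\<Sum>k\<in>UNIV. \<Sum>l\<in>UNIV. \<Sum>p\<in>UNIV. \<Sum>q\<in>UNIV.
        (matrix_inv (V.metric_at 0 X) $ k $ p * matrix_inv (V.metric_at 0 X) $ l $ q * U 0 $ p $ q) * V.weyl_var X a b k l) / 2) (at 0)"
      unfolding W_nth
      by (intro DERIV_cdivide DERIV_sum has_derivative_mult_vanishing V.has_derivative_weyl X continuous_intros isCont_inv cU)
         (simp_all add: V.metric_at_0 weyl_cyl)
    then show ?thesis
      by (simp add: Weyl_dir_def V.metric_at_0 U0 raise_def sum_distrib_left mult_ac)
  qed
  have dA: "((\<lambda>s. asd_part (V.metric_at s X) (W s) $ c $ d) has_real_derivative asd_part G (Weyl_dir i) $ c $ d) (at 0)" for c d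
  proof -
    have 1: "((\<lambda>s. \<Sum>a\<in>UNIV. \<Sum>b\<in>UNIV. \<Sum>p\<in>UNIV. \<Sum>q\<in>UNIV.
        (matrix_inv (V.metric_at s X) $ a $ p * matrix_inv (V.metric_at s X) $ b $ q * levi4 a b c d) * W s $ p $ q) has_real_derivative
       (\<Sum>a\<in>UNIV. \<Sum>b\<in>UNIV. \<Sum>p\<in>UNIV. \<Sum>q\<in>UNIV.
        (matrix_inv (V.metric_at 0 X) $ a $ p * matrix_inv (V.metric_at 0 X) $ b $ q * levi4 a b c d) * Weyl_dir i $ p $ q)) (at 0)"
      by (intro DERIV_sum has_derivative_mult_vanishing dW W0 continuous_intros isCont_inv)
    have "((\<lambda>s. hodge4 (V.metric_at s X) (W s) $ c $ d) has_real_derivative hodge4 (V.metric_at 0 X) (Weyl_dir i) $ c $ d) (at 0)"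
      unfolding hodge4_nth
      by (rule has_derivative_mult_vanishing[OF 1]) (auto simp: W0 intro!: continuous_intros isCont_sqrt_det)
    then show ?thesis
      unfolding asd_part_nth by (intro DERIV_cdivide DERIV_diff dW) (simp add: V.metric_at_0)
  qed
  have "((\<lambda>s. form_inner G (asd_part (V.metric_at s X) (W s)) (\<omega> j)) has_real_derivative
      form_inner G (asd_part G (Weyl_dir i)) (\<omega> j)) (at 0)"
    unfolding form_inner_raise
    by (intro DERIV_cdivide DERIV_sum DERIV_cmult_right dA)
  \<comment> \<open>The background projection is self-adjoint and fixes
    \<open>\<omega> j\<close>.\<close>
  moreover have "form_inner G (asd_part G (Weyl_dir i)) (\<omega> j) = form_inner G (Weyl_dir i) (\<omega> j)"
    unfolding asd_part_def form_inner_scale form_inner_diff form_inner_hodge hodge4_omega form_inner_minus by simp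
  ultimately show ?thesis
    by (simp add: asd_weyl_operator_def W_def U_def)
qed

text \<open>The factor 1/4 combines the 1/2 of the curvature operator with the 1/2 of the inner
  product, both of which sum over ordered pairs of indices.\<close>

lemma form_inner_Weyl_dir:
  "form_inner G (Weyl_dir i) (\<omega> j) =
    (\<Sum>r\<in>UNIV. \<Sum>s\<in>UNIV. \<Sum>u\<in>UNIV. \<Sum>v\<in>UNIV. fr4 E (V.weyl_var X) r s u v * basis_form j r s * basis_form i u v) / 4"
proof -
  have c: "(\<Sum>k\<in>UNIV. \<Sum>l\<in>UNIV. T k l * raise (\<omega> i) k l) = (\<Sum>u\<in>UNIV. \<Sum>v\<in>UNIV. fr2 E T u v * basis_form i u v)" for T i
  proof -
    have "(\<Sum>k\<in>UNIV. \<Sum>l\<in>UNIV. T k l * raise (\<omega> i) k l) =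
       (\<Sum>k\<in>UNIV. \<Sum>l\<in>UNIV. \<Sum>u\<in>UNIV. \<Sum>v\<in>UNIV. E $ u $ k * E $ v $ l * T k l * basis_form i u v)"
      by (simp add: raise_omega sum_distrib_left mult_ac)
    also have "\<dots> = (\<Sum>u\<in>UNIV. \<Sum>v\<in>UNIV. \<Sum>k\<in>UNIV. \<Sum>l\<in>UNIV. E $ u $ k * E $ v $ l * T k l * basis_form i u v)"
      by (subst (2) sum.swap, subst sum.swap, subst (3) sum.swap, subst (2) sum.swap) (rule refl)
    finally show ?thesis by (simp add: fr2_def sum_distrib_right)
  qed
  have "form_inner G (Weyl_dir i) (\<omega> j) = (\<Sum>a\<in>UNIV. \<Sum>b\<in>UNIV. (\<Sum>k\<in>UNIV. \<Sum>l\<in>UNIV. V.weyl_var X a b k l * raise (\<omega> i) k l) * raise (\<omega> j) a b) / 4"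
    unfolding form_inner_raise Weyl_dir_def vec_lambda_beta by (simp add: sum_divide_distrib[symmetric])
  also have "\<dots> = (\<Sum>r\<in>UNIV. \<Sum>s\<in>UNIV. fr2 E (\<lambda>a b. \<Sum>u\<in>UNIV. \<Sum>v\<in>UNIV. fr2 E (V.weyl_var X a b) u v * basis_form i u v) r s * basis_form j r s) / 4"
    unfolding c ..
  also have "\<dots> = (\<Sum>r\<in>UNIV. \<Sum>s\<in>UNIV. (\<Sum>u\<in>UNIV. \<Sum>v\<in>UNIV. fr4 E (V.weyl_var X) r s u v * basis_form i u v) * basis_form j r s) / 4"
    unfolding fr2_sum fr2_linear fr4_nested ..
  finally show ?thesis by (simp add: sum_distrib_left sum_distrib_right mult_ac)
qed

text \<open>Components in the frame \<open>E\<close> are indexed by \<open>3 option\<close>, with \<open>None\<close> for \<open>\<partial>\<^sub>t\<close>. There the metric of \<open>Y\<close> is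
  the diagonal matrix of \<open>Yf\<close>, which is why \<open>Yf\<close> accompanies each curvature term.\<close>

definition "Hf a b = fr2 E (\<lambda>i j. H X $ i $ j) a b"
definition "Sf a b c d = fr4 E (N2 X) a b c d"
definition "Rf a b c d = fr4 E (V.riem_var X) a b c d"
definition Yf :: "3 option \<Rightarrow> real" where "Yf a = (if a = None then 0 else 1)"
definition Df :: "3 option \<Rightarrow> 3 option \<Rightarrow> real" where "Df a b = (if a = b then 1 else 0)"

lemma Hf_sym: "Hf a b = Hf b a"
  unfolding Hf_def by (subst fr2_swap[symmetric]) (simp add: H.sym[OF X])

lemma fr2_G: "fr2 E (\<lambda>i j. G $ i $ j) a b = Df a b"
  by (simp add: is_frame_metric[OF frame_E] Df_def)

lemma fr2_Y_left: "fr2 E (\<lambda>i j. Yf i * T i j) a b = Yf a * fr2 E T a b"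
  by (cases a; cases b) (simp_all add: fr2_def sum_option Yf_def)

lemma fr2_Y_right: "fr2 E (\<lambda>i j. T i j * Yf j) a b = fr2 E T a b * Yf b"
  by (cases a; cases b) (simp_all add: fr2_def sum_option Yf_def)

text \<open>For constant curvature the curvature endomorphism is a difference of metric terms; the
  factors \<open>Yf\<close> remove the direction of t, so that all index types are covered by one
  formula.\<close>

lemma curv_term: "(\<Sum>m\<in>UNIV. T m * curv_endo (cyl_metric g) X i j l m) =
   \<kappa> * ((T i * Yf i) * (Yf j * G $ j $ l) - (T j * Yf j) * (Yf i * G $ i $ l))"
proof -
  have *: "T (Some m) * (\<kappa> * ((if m = i then 1 else 0) * p)) = (if m = i then \<kappa> * (T (Some i) * p) else 0)" for m i p
    by auto
  show ?thesis
    by (cases i; cases j; cases l)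
       (simp_all add: sum_option curv_endo_cyl[OF X] curv_endo_x Yf_def * sum_subtractf right_diff_distrib)
qed

lemma Sf_sym: "Sf a b c d = Sf a b d c"
proof -
  have "(\<lambda>i j k l. N2 X i j l k) = N2 X"
    by (intro ext) (rule V.cov3_sym[OF X])
  then show ?thesis using fr4_swap34[of E "N2 X" a b c d] by (simp only: Sf_def)
qed

lemma HY: "fr2 E (\<lambda>i k. H X $ k $ i * Yf i) a c = Hf c a * Yf a"
  using fr2_swap[of E "\<lambda>k i. H X $ k $ i * Yf i" a c] fr2_Y_right[of "\<lambda>k i. H X $ k $ i" c a]
  by (simp only: Hf_def)

lemma YG: "fr2 E (\<lambda>i k. Yf i * G $ i $ k) a c = Yf a * Df a c"
  using fr2_Y_left[of "\<lambda>i k. G $ i $ k" a c] by (simp only: fr2_G)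

text \<open>The Ricci identity in the frame. Constant curvature turns the commutator into terms
  algebraic in \<open>Hf\<close>.\<close>

lemma Sf_commute: "Sf a b c d - Sf b a c d =
   - \<kappa> * (Hf d a * Yf a * (Yf b * Df b c) - Hf d b * Yf b * (Yf a * Df a c))
   - \<kappa> * (Hf c a * Yf a * (Yf b * Df b d) - Hf c b * Yf b * (Yf a * Df a d))"
proof -
  have "N2 X i j k l - N2 X j i k l = - (\<kappa> * ((H X $ l $ i * Yf i) * (Yf j * G $ j $ k) - (H X $ l $ j * Yf j) * (Yf i * G $ i $ k)))
     - \<kappa> * ((H X $ k $ i * Yf i) * (Yf j * G $ j $ l) - (H X $ k $ j * Yf j) * (Yf i * G $ i $ l))" for i j k l
    using V.cov3_commute[OF X, of i j k l] curv_term[of "\<lambda>m. H X $ l $ m" i j k] curv_term[of "\<lambda>m. H X $ k $ m" i j l]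
    by (simp add: H.sym[OF X, of _ l] mult.commute)
  then have "fr4 E (\<lambda>i j k l. N2 X i j k l - N2 X j i k l) a b c d = fr4 E (\<lambda>i j k l. - (\<kappa> * ((H X $ l $ i * Yf i) * (Yf j * G $ j $ k) - (H X $ l $ j * Yf j) * (Yf i * G $ i $ k)))
     - \<kappa> * ((H X $ k $ i * Yf i) * (Yf j * G $ j $ l) - (H X $ k $ j * Yf j) * (Yf i * G $ i $ l))) a b c d"
    by simp
  moreover have "fr4 E (\<lambda>i j k l. (H X $ l $ i * Yf i) * (Yf j * G $ j $ k)) a b c d = Hf d a * Yf a * (Yf b * Df b c)"
    using fr4_prods(2)[of E "\<lambda>i l. H X $ l $ i * Yf i" "\<lambda>j k. Yf j * G $ j $ k" a b c d]
    by (simp only: HY YG mult.assoc)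
  moreover have "fr4 E (\<lambda>i j k l. (H X $ l $ j * Yf j) * (Yf i * G $ i $ k)) a b c d = Hf d b * Yf b * (Yf a * Df a c)"
    using fr4_prods(4)[of E "\<lambda>j l. H X $ l $ j * Yf j" "\<lambda>i k. Yf i * G $ i $ k" a b c d]
    by (simp only: HY YG mult.assoc)
  moreover have "fr4 E (\<lambda>i j k l. (H X $ k $ i * Yf i) * (Yf j * G $ j $ l)) a b c d = Hf c a * Yf a * (Yf b * Df b d)"
    using fr4_prods(1)[of E "\<lambda>i k. H X $ k $ i * Yf i" "\<lambda>j l. Yf j * G $ j $ l" a b c d]
    by (simp only: HY YG mult.assoc)
  moreover have "fr4 E (\<lambda>i j k l. (H X $ k $ j * Yf j) * (Yf i * G $ i $ l)) a b c d = Hf c b * Yf b * (Yf a * Df a d)"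
    using fr4_prods(3)[of E "\<lambda>j k. H X $ k $ j * Yf j" "\<lambda>i l. Yf i * G $ i $ l" a b c d]
    by (simp only: HY YG mult.assoc)
  ultimately show ?thesis
    unfolding Sf_def by (simp only: fr4_linear fr4_swap12[of E "N2 X"])
qed

lemma Rf_eq: "Rf a b c d = \<kappa> * (Hf c a * Yf a * (Yf b * Df b d) - Hf c b * Yf b * (Yf a * Df a d))
   + (Sf a b d c + Sf a d b c - Sf a c b d) / 2 - (Sf b a d c + Sf b d a c - Sf b c a d) / 2"
proof -
  have "fr4 E (\<lambda>i j k l. (H X $ k $ i * Yf i) * (Yf j * G $ j $ l)) a b c d = Hf c a * Yf a * (Yf b * Df b d)"
    using fr4_prods(1)[of E "\<lambda>i k. H X $ k $ i * Yf i" "\<lambda>j l. Yf j * G $ j $ l" a b c d]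
    by (simp only: HY YG mult.assoc)
  moreover have "fr4 E (\<lambda>i j k l. (H X $ k $ j * Yf j) * (Yf i * G $ i $ l)) a b c d = Hf c b * Yf b * (Yf a * Df a d)"
    using fr4_prods(3)[of E "\<lambda>j k. H X $ k $ j * Yf j" "\<lambda>i l. Yf i * G $ i $ l" a b c d]
    by (simp only: HY YG mult.assoc)
  ultimately show ?thesis
    unfolding Rf_def V.riem_var_def[abs_def] curv_term Sf_def
    by (simp only: fr4_linear fr4_swap34[of E "N2 X"] fr4_swap23[of E "N2 X"] fr4_swap12[of E "N2 X"] fr4_perms[of E "N2 X"])
qed

end

lemma cov1_add: "u differentiable at x \<Longrightarrow> v differentiable at x \<Longrightarrow> cov1 g (\<lambda>y. u y + v y) x = cov1 g u x + cov1 g v x"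
  by (simp add: cov1_def vec_eq_iff pd_add distrib_left sum.distrib)

lemma cov1_diff: "u differentiable at x \<Longrightarrow> v differentiable at x \<Longrightarrow> cov1 g (\<lambda>y. u y - v y) x = cov1 g u x - cov1 g v x"
  by (simp add: cov1_def vec_eq_iff pd_diff right_diff_distrib sum_subtractf)

lemma cov1_scaleR: "u differentiable at x \<Longrightarrow> cov1 g (\<lambda>y. c *\<^sub>R u y) x = c *\<^sub>R cov1 g u x"
  by (simp add: cov1_def vec_eq_iff pd_scaleR right_diff_distrib sum_distrib_left mult_ac)

context local_metric_3 begin

lemma diff_star2:
  assumes y: "y \<in> S" and pos: "det (g y) > 0" and w: "w differentiable at y"
  shows "(\<lambda>z. star2 (g z) (w z)) differentiable at y"
proof (rule differentiable_vecI)
  fix i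
  have "(\<lambda>z. det (g z)) differentiable at y" by (intro differentiable_det diff_nth y)
  from pd_sqrt(1)[OF this pos] show "(\<lambda>z. star2 (g z) (w z) $ i) differentiable at y"
    unfolding star2_def vec_lambda_beta
    by (intro differentiable_mult differentiable_divide differentiable_sum ballI diff_inv y differentiable_vec_nth w) auto
qed

end

context frame_point begin

lemma base_riemann: "riemann (cyl_metric g) X i j k l =
   \<kappa> * ((Yf i * G $ i $ k) * (Yf j * G $ j $ l) - (Yf i * G $ i $ l) * (Yf j * G $ j $ k))"
  by (cases i; cases j; cases k; cases l) (simp_all add: riemann_cyl[OF X] riemann_x Yf_def)

lemma base_ricci: "ricci (cyl_metric g) X $ i $ j = 2 * \<kappa> * (Yf i * G $ i $ j)"
  by (cases i; cases j) (simp_all add: ricci_cyl Yf_def)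

definition "Ric a b = fr2 E (V.ric_var X) a b"
definition "Wf a b c d = fr4 E (V.weyl_var X) a b c d"

lemma base_riemann_frame: "fr4 E (riemann (cyl_metric g) X) a b c d = \<kappa> * (Yf a * Df a c * (Yf b * Df b d) - Yf a * Df a d * (Yf b * Df b c))"
  unfolding base_riemann[abs_def] fr4_linear
    fr4_prods(1)[of E "\<lambda>i k. Yf i * G $ i $ k" "\<lambda>j l. Yf j * G $ j $ l"]
    fr4_prods(2)[of E "\<lambda>i l. Yf i * G $ i $ l" "\<lambda>j k. Yf j * G $ j $ k"] YG ..

text \<open>The double sum comes from the variation of the inverse metric, paired with the
  background curvature.\<close>

lemma Ric_eq: "Ric a b = (\<Sum>c\<in>UNIV. Rf a c b c)
   - (\<Sum>r\<in>UNIV. \<Sum>s\<in>UNIV. Hf r s * (\<kappa> * (Yf a * Df a b * (Yf r * Df r s) - Yf a * Df a s * (Yf r * Df r b))))"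
proof -
  have 1: "fr2 E (\<lambda>i j. \<Sum>k\<in>UNIV. \<Sum>l\<in>UNIV. matrix_inv G $ k $ l * V.riem_var X i k j l) a b = (\<Sum>c\<in>UNIV. Rf a c b c)"
    using frame_contract_12[OF frame_E, of "\<lambda>k l i j. V.riem_var X i k j l"] fr4_perms(6)[of E "V.riem_var X"]
    by (simp only: Rf_def)
  have 2: "fr2 E (\<lambda>i j. \<Sum>c\<in>UNIV. \<Sum>d\<in>UNIV. V.inv_var X c d * riemann (cyl_metric g) X i c j d) a b =
     (\<Sum>r\<in>UNIV. \<Sum>s\<in>UNIV. Hf r s * fr4 E (riemann (cyl_metric g) X) a r b s)"
  proof -
    have "(\<lambda>i j. \<Sum>c\<in>UNIV. \<Sum>d\<in>UNIV. V.inv_var X c d * riemann (cyl_metric g) X i c j d) =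
      (\<lambda>i j. \<Sum>r\<in>UNIV. \<Sum>s\<in>UNIV. Hf r s * fr2 E (\<lambda>c d. riemann (cyl_metric g) X i c j d) r s)"
      unfolding V.inv_var_def frame_contract_raised[OF frame_E, of "\<lambda>p q. H X $ p $ q" "\<lambda>c d. riemann (cyl_metric g) X i c j d" for i j]
        Hf_def ..
    then have "fr2 E (\<lambda>i j. \<Sum>c\<in>UNIV. \<Sum>d\<in>UNIV. V.inv_var X c d * riemann (cyl_metric g) X i c j d) a b =
      (\<Sum>r\<in>UNIV. \<Sum>s\<in>UNIV. Hf r s * fr4 E (\<lambda>i j c d. riemann (cyl_metric g) X i c j d) a b r s)"
      by (simp only: fr2_sum fr2_linear fr4_nested)
    then show ?thesis by (simp only: fr4_swap23[of E "riemann (cyl_metric g) X"])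
  qed
  show ?thesis
    unfolding Ric_def V.ric_var_def[abs_def] fr2_linear 1 2 base_riemann_frame ..
qed

lemma scal_eq: "V.scal_var X = (\<Sum>a\<in>UNIV. Ric a a) - (\<Sum>r\<in>UNIV. \<Sum>s\<in>UNIV. Hf r s * (2 * \<kappa> * (Yf r * Df r s)))"
  unfolding V.scal_var_def V.inv_var_def frame_contract_raised[OF frame_E, of "\<lambda>p q. H X $ p $ q"]
    frame_contract[OF frame_E] base_ricci fr2_linear YG Ric_def Hf_def ..

lemma Wf_eq: "Wf a b c d = Rf a b c d
   - (Ric a c * Df b d + 2 * \<kappa> * (Yf a * Df a c) * Hf b d - (Ric a d * Df b c + 2 * \<kappa> * (Yf a * Df a d) * Hf b c)
      + (Ric b d * Df a c + 2 * \<kappa> * (Yf b * Df b d) * Hf a c) - (Ric b c * Df a d + 2 * \<kappa> * (Yf b * Df b c) * Hf a d)) / 2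
   + (V.scal_var X * (Df a c * Df b d - Df a d * Df b c)
      + 6 * \<kappa> * ((Hf a c * Df b d + Df a c * Hf b d) - (Hf a d * Df b c + Df a d * Hf b c))) / 6"
proof -
  \<comment> \<open>The dimension n = 4 of the cylinder: n - 2 = 2 and (n - 1)(n - 2) = 6. The
    further constants \<open>2 * \<kappa>\<close> and \<open>6 * \<kappa>\<close> belong to the
    background Ricci tensor and scalar curvature.\<close>
  have n: "real CARD(3 option) - 2 = 2" "(real CARD(3 option) - 1) * 2 = 6" by simp_all
  show ?thesis
    unfolding Wf_def V.weyl_var_def[abs_def] n base_ricci scalar_cyl fr4_linear
      fr4_prods(1)[of E "V.ric_var X" "\<lambda>i j. G $ i $ j"] fr4_prods(2)[of E "V.ric_var X" "\<lambda>i j. G $ i $ j"]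
      fr4_prods(3)[of E "V.ric_var X" "\<lambda>i j. G $ i $ j"] fr4_prods(4)[of E "V.ric_var X" "\<lambda>i j. G $ i $ j"]
      fr4_prods(1)[of E "\<lambda>i j. 2 * \<kappa> * (Yf i * G $ i $ j)" "\<lambda>i j. H X $ i $ j"]
      fr4_prods(2)[of E "\<lambda>i j. 2 * \<kappa> * (Yf i * G $ i $ j)" "\<lambda>i j. H X $ i $ j"]
      fr4_prods(3)[of E "\<lambda>i j. 2 * \<kappa> * (Yf i * G $ i $ j)" "\<lambda>i j. H X $ i $ j"]
      fr4_prods(4)[of E "\<lambda>i j. 2 * \<kappa> * (Yf i * G $ i $ j)" "\<lambda>i j. H X $ i $ j"]
      fr4_prods(1)[of E "\<lambda>i j. G $ i $ j" "\<lambda>i j. G $ i $ j"] fr4_prods(2)[of E "\<lambda>i j. G $ i $ j" "\<lambda>i j. G $ i $ j"]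
      fr4_prods(1)[of E "\<lambda>i j. H X $ i $ j" "\<lambda>i j. G $ i $ j"] fr4_prods(2)[of E "\<lambda>i j. H X $ i $ j" "\<lambda>i j. G $ i $ j"]
      fr4_prods(1)[of E "\<lambda>i j. G $ i $ j" "\<lambda>i j. H X $ i $ j"] fr4_prods(2)[of E "\<lambda>i j. G $ i $ j" "\<lambda>i j. H X $ i $ j"]
      fr2_linear YG fr2_G Hf_def[symmetric] Ric_def[symmetric] Rf_def[symmetric] ..
qed

lemma asd_weyl_pairing: "form_inner G (Weyl_dir i) (\<omega> j) =
    (\<Sum>r\<in>UNIV. \<Sum>s\<in>UNIV. \<Sum>u\<in>UNIV. \<Sum>v\<in>UNIV. Wf r s u v * basis_form j r s * basis_form i u v) / 4"
  unfolding form_inner_Weyl_dir Wf_def ..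

section \<open>Frame components of the operators on Y\<close>

lemma frame_parts:
  "fr2 e (\<lambda>i j. partYY H t x $ i $ j) a b = Hf (Some a) (Some b)"
  "fr2 e (\<lambda>i j. N2 X (Some i) (Some j) None None) a b = Sf (Some a) (Some b) None None"
  "fr2 e (\<lambda>i j. N2 X (Some i) None None (Some j)) a b = Sf (Some a) None None (Some b)"
  "fr2 e (\<lambda>i j. N2 X None None (Some i) (Some j)) a b = Sf None None (Some a) (Some b)"
  "fr3 e (\<lambda>i j k. N2 X (Some i) None (Some j) (Some k)) a b c = Sf (Some a) None (Some b) (Some c)"
  "fr3 e (\<lambda>i j k. N2 X (Some i) (Some j) None (Some k)) a b c = Sf (Some a) (Some b) None (Some c)"
  "fr4 e (\<lambda>i j k l. N2 X (Some i) (Some j) (Some k) (Some l)) a b c d = Sf (Some a) (Some b) (Some c) (Some d)"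
  by (simp_all add: Hf_def Sf_def fr2_E partYY_def fr2_def fr3_def fr4_def sum_option)

lemma dslash_eq: "dslash_frame g (dot (partYY H) t) x e $ a $ b =
   ((\<Sum>k\<in>UNIV. \<Sum>l\<in>UNIV. levi3 a k l * (Sf (Some k) None (Some l) (Some b) - Sf (Some l) None (Some k) (Some b)))
   + (\<Sum>k\<in>UNIV. \<Sum>l\<in>UNIV. levi3 b k l * (Sf (Some k) None (Some l) (Some a) - Sf (Some l) None (Some k) (Some a)))) / 2"
proof -
  have "(\<Sum>a\<in>UNIV. \<Sum>b\<in>UNIV. \<Sum>c\<in>UNIV. cov2 g (dot (partYY H) t) x $ a $ b $ c * e $ k $ a * e $ l $ b * e $ j $ c) =
     Sf (Some k) None (Some l) (Some j)" for k l j
    unfolding frame_parts(5)[symmetric] by (simp add: cov2_dot_partYY[OF x] fr3_def mult_ac)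
  then show ?thesis by (simp add: dslash_frame_def Let_def)
qed

lemma frame_contract_e: "(\<Sum>k\<in>UNIV. \<Sum>l\<in>UNIV. matrix_inv (g x) $ k $ l * T k l) = (\<Sum>c\<in>UNIV. fr2 e T c c)"
  by (rule frame_contract[OF frame_e])

definition De :: "3 \<Rightarrow> 3 \<Rightarrow> real" where "De a b = (if a = b then 1 else 0)"

lemma fr2_g: "fr2 e (\<lambda>i j. g x $ i $ j) a b = De a b"
  by (simp add: is_frame_metric[OF frame_e] De_def)

lemma frame_comp_tf: "fr2 e (\<lambda>i j. tf (g x) T $ i $ j) a b =
    fr2 e (\<lambda>i j. T $ i $ j) a b - (\<Sum>c\<in>UNIV. fr2 e (\<lambda>i j. T $ i $ j) c c) / 3 * De a b"
  unfolding tf_def mtrace_def frame_contract_e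
  by (simp add: fr2_linear fr2_g)

lemma frame_comp_killing: "fr2 e (\<lambda>i j. conformal_killing g w x $ i $ j) a b =
    fr2 e (\<lambda>i j. cov1 g w x $ i $ j) a b + fr2 e (\<lambda>i j. cov1 g w x $ i $ j) b a
    - 2 / 3 * (\<Sum>c\<in>UNIV. fr2 e (\<lambda>i j. cov1 g w x $ i $ j) c c) * De a b"
  unfolding conformal_killing_def lie_op_def div1_def frame_contract_e fr2_swap[of e "\<lambda>i j. cov1 g w x $ i $ j"]
  by (simp add: fr2_linear fr2_g fr2_swap[of e "\<lambda>i j. cov1 g w x $ i $ j"])

lemma frame_comp_laplacian: "fr2 e (\<lambda>i j. rough_laplacian g (\<lambda>y. tf (g y) (partYY H t y)) x $ i $ j) a b =
   (\<Sum>c\<in>UNIV. Sf (Some c) (Some c) (Some a) (Some b)) - (\<Sum>c\<in>UNIV. \<Sum>d\<in>UNIV. Sf (Some c) (Some c) (Some d) (Some d)) / 3 * De a b"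
proof -
  interpret Y: metric_variation g "partYY H t" S by (rule metric_variation_partYY)
  have 1: "fr2 e (\<lambda>i j. \<Sum>k\<in>UNIV. \<Sum>l\<in>UNIV. matrix_inv (g x) $ k $ l * N2 X (Some k) (Some l) (Some i) (Some j)) a b =
     (\<Sum>c\<in>UNIV. Sf (Some c) (Some c) (Some a) (Some b))"
    unfolding frame_contract_12[OF frame_e, of "\<lambda>k l i j. N2 X (Some k) (Some l) (Some i) (Some j)"] frame_parts ..
  have 2: "(\<Sum>k\<in>UNIV. \<Sum>l\<in>UNIV. matrix_inv (g x) $ k $ l * (\<Sum>p\<in>UNIV. \<Sum>q\<in>UNIV. matrix_inv (g x) $ p $ q * N2 X (Some k) (Some l) (Some p) (Some q))) =
     (\<Sum>c\<in>UNIV. \<Sum>d\<in>UNIV. Sf (Some c) (Some c) (Some d) (Some d))"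
    unfolding frame_contract_e fr2_sum fr4_nested[symmetric] frame_parts ..
  show ?thesis
    unfolding Y.rough_laplacian_tf[OF x] vec_lambda_beta cov3_partYY[OF x] 2 fr2_linear 1 fr2_g by simp
qed

lemma frame_cov1_d0_part00: "fr2 e (\<lambda>i j. cov1 g (d0 (part00 H t)) x $ i $ j) a b = Sf (Some a) (Some b) None None"
  by (simp add: cov1_d0_part00[OF x] frame_parts)

lemma frame_cov1_dot_part0Y: "fr2 e (\<lambda>i j. cov1 g (dot (part0Y H) t) x $ i $ j) a b = Sf (Some a) None None (Some b)"
  by (simp add: cov1_dot_part0Y[OF x] frame_parts)

lemma frame_cov1_div2: "fr2 e (\<lambda>i j. cov1 g (div2 g (partYY H t)) x $ i $ j) a b = (\<Sum>c\<in>UNIV. Sf (Some a) (Some c) (Some c) (Some b))"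
proof -
  interpret Y: metric_variation g "partYY H t" S by (rule metric_variation_partYY)
  show ?thesis
    using frame_contract_12[OF frame_e, of "\<lambda>k l i j. N2 X (Some i) (Some l) (Some k) (Some j)" a b]
      fr4_perms(7)[of e "\<lambda>i j k l. N2 X (Some i) (Some j) (Some k) (Some l)"]
    by (simp only: Y.cov1_div2[OF x] vec_lambda_beta cov3_partYY[OF x] frame_parts)
qed

lemma frame_cov1_d0_mtrace: "fr2 e (\<lambda>i j. cov1 g (d0 (\<lambda>z. mtrace (g z) (partYY H t z))) x $ i $ j) a b =
    (\<Sum>c\<in>UNIV. Sf (Some a) (Some b) (Some c) (Some c))"
proof -
  interpret Y: metric_variation g "partYY H t" S by (rule metric_variation_partYY)
  show ?thesis
    using frame_contract_12[OF frame_e, of "\<lambda>k l i j. N2 X (Some i) (Some j) (Some k) (Some l)" a b]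
      fr4_perms(5)[of e "\<lambda>i j k l. N2 X (Some i) (Some j) (Some k) (Some l)"]
    by (simp only: Y.cov1_d0_mtrace[OF x] vec_lambda_beta cov3_partYY[OF x] frame_parts)
qed

text \<open>Torsion-freeness: the Christoffel terms cancel in the antisymmetrization, so the
  exterior derivative consists of components of the covariant derivative.\<close>

lemma d1_part0Y:
  assumes y: "y \<in> S"
  shows "d1 (part0Y H t) y = (\<chi> i j. N (cyl_point t y) (Some i) None (Some j) - N (cyl_point t y) (Some j) None (Some i))"
proof -
  have "pd i (part0Y H t) y $ j - pd j (part0Y H t) y $ i = cov1 g (part0Y H t) y $ i $ j - cov1 g (part0Y H t) y $ j $ i" for i j
    by (simp add: cov1_def chr_sym[OF y, of _ i j])
  then show ?thesis by (simp add: d1_def cov1_part0Y[OF y])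
qed

lemma diff_d1_part0Y: "d1 (part0Y H t) differentiable at x"
proof (rule differentiable_cong_open[OF open_S x d1_part0Y[symmetric]])
  show "(\<lambda>y. \<chi> i j. N (cyl_point t y) (Some i) None (Some j) - N (cyl_point t y) (Some j) None (Some i)) differentiable at x"
    by (intro differentiable_vecI) (simp add: differentiable_diff diff_N_slice[OF x])
qed

lemma cov2_d1_part0Y: "cov2 g (d1 (part0Y H t)) x $ a $ p $ q =
    N2 X (Some a) (Some p) None (Some q) - N2 X (Some a) (Some q) None (Some p)"
proof -
  have "pd a (d1 (part0Y H t)) x $ p $ q = pd a (\<lambda>y. d1 (part0Y H t) y $ p $ q) x"
    by (simp add: pd_nth diff_d1_part0Y differentiable_vec_nth)
  also have "\<dots> = pd a (\<lambda>y. N (cyl_point t y) (Some p) None (Some q) - N (cyl_point t y) (Some q) None (Some p)) x"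
    by (rule pd_cong_open[OF open_S x]) (simp add: d1_part0Y)
  also have "\<dots> = pd (Some a) (\<lambda>X. N X (Some p) None (Some q)) X - pd (Some a) (\<lambda>X. N X (Some q) None (Some p)) X"
    by (simp add: pd_diff diff_N_slice[OF x] pd_N_slice[OF x])
  finally show ?thesis
    by (simp add: cov2_nth d1_part0Y[OF x] N2_eq[OF X] chr_cyl[OF X] sum_option sum.distrib right_diff_distrib sum_subtractf)
qed

lemma frame_star2: "(\<Sum>j\<in>UNIV. e $ b $ j * star2 (g x) \<eta> $ j) = (\<Sum>r\<in>UNIV. \<Sum>s\<in>UNIV. fr2 e (\<lambda>p q. \<eta> $ p $ q) r s * levi3 r s b) / 2"
proof -
  define F where "F r s = fr2 e (\<lambda>p q. \<eta> $ p $ q) r s" for r s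
  have "star2 (g x) \<eta> $ j = sqrt (det (g x)) / 2 * (\<Sum>k\<in>UNIV. \<Sum>l\<in>UNIV. (\<Sum>r\<in>UNIV. \<Sum>s\<in>UNIV. e $ r $ k * e $ s $ l * F r s) * levi3 k l j)" for j
    unfolding F_def raise_frame[OF frame_e, symmetric] by (simp add: star2_def sum_distrib_right)
  then have "(\<Sum>j\<in>UNIV. e $ b $ j * star2 (g x) \<eta> $ j) = sqrt (det (g x)) / 2 * (\<Sum>r\<in>UNIV. \<Sum>s\<in>UNIV. F r s * fr3 e levi3 r s b)"
    unfolding fr3_def by (simp add: sum_3 algebra_simps)
  also have "\<dots> = (sqrt (det (g x)) * det e) * (\<Sum>r\<in>UNIV. \<Sum>s\<in>UNIV. F r s * levi3 r s b) / 2"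
    by (simp add: fr3_levi3 sum_distrib_left mult_ac)
  finally show ?thesis by (simp add: oriented_orthonormal_det(2)[OF oe] F_def)
qed

text \<open>The star is parallel, so it acts on the covariant derivative of the exterior derivative;
  in the frame it is a contraction with \<open>levi3\<close>.\<close>

lemma frame_cov1_star2: "fr2 e (\<lambda>i j. cov1 g (\<lambda>y. star2 (g y) (d1 (part0Y H t) y)) x $ i $ j) a b =
   (\<Sum>r\<in>UNIV. \<Sum>s\<in>UNIV. (Sf (Some a) (Some r) None (Some s) - Sf (Some a) (Some s) None (Some r)) * levi3 r s b) / 2"
proof -
  interpret g3: local_metric_3 g S ..
  have I: "(\<Sum>i\<in>UNIV. e $ a $ i * fr2 e (\<lambda>p q. cov2 g (d1 (part0Y H t)) x $ i $ p $ q) r s) =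
    Sf (Some a) (Some r) None (Some s) - Sf (Some a) (Some s) None (Some r)" for r s
  proof -
    have "(\<Sum>i\<in>UNIV. e $ a $ i * fr2 e (\<lambda>p q. N2 X (Some i) (Some p) None (Some q)) r s) = Sf (Some a) (Some r) None (Some s)" for r s
      unfolding frame_parts(6)[symmetric] by (simp add: fr2_def fr3_def sum_distrib_left mult_ac)
    then show ?thesis
      unfolding cov2_d1_part0Y fr2_linear fr2_swap[of e "\<lambda>q p. N2 X (Some i) (Some q) None (Some p)" for i]
      by (simp add: right_diff_distrib sum_subtractf)
  qed
  have "fr2 e (\<lambda>i j. cov1 g (\<lambda>y. star2 (g y) (d1 (part0Y H t) y)) x $ i $ j) a b =
    (\<Sum>i\<in>UNIV. e $ a $ i * (\<Sum>j\<in>UNIV. e $ b $ j * star2 (g x) (cov2 g (d1 (part0Y H t)) x $ i) $ j))"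
    by (simp add: g3.cov1_star2[OF x oriented_orthonormal_det(1)[OF oe] diff_d1_part0Y] fr2_def sum_distrib_left mult_ac)
  also have "\<dots> = (\<Sum>i\<in>UNIV. \<Sum>r\<in>UNIV. \<Sum>s\<in>UNIV. e $ a $ i * fr2 e (\<lambda>p q. cov2 g (d1 (part0Y H t)) x $ i $ p $ q) r s * levi3 r s b) / 2"
    unfolding frame_star2 by (simp add: sum_distrib_left sum_divide_distrib mult_ac)
  also have "\<dots> = (\<Sum>r\<in>UNIV. \<Sum>s\<in>UNIV. (\<Sum>i\<in>UNIV. e $ a $ i * fr2 e (\<lambda>p q. cov2 g (d1 (part0Y H t)) x $ i $ p $ q) r s) * levi3 r s b) / 2"
  proof -
    have "(\<Sum>i\<in>UNIV. \<Sum>r\<in>UNIV. \<Sum>s\<in>UNIV. T i r s) = (\<Sum>r\<in>UNIV. \<Sum>s\<in>UNIV. \<Sum>i\<in>UNIV. T i r s)"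
      for T :: "3 \<Rightarrow> 3 \<Rightarrow> 3 \<Rightarrow> real"
      by (subst sum.swap) (rule sum.cong[OF refl], rule sum.swap)
    from arg_cong[where f = "\<lambda>z. z / 2", OF this] show ?thesis unfolding sum_distrib_right .
  qed
  finally show ?thesis unfolding I .
qed


section \<open>Normal form of the components and comparison of the two sides\<close>

lemma Sf_sort:
  "Sf a b (Some i) None = Sf a b None (Some i)"
  "Sf a b (Some 2) (Some 1) = Sf a b (Some 1) (Some 2)"
  "Sf a b (Some 3) (Some 1) = Sf a b (Some 1) (Some 3)"
  "Sf a b (Some 3) (Some 2) = Sf a b (Some 2) (Some 3)"
  by (rule Sf_sym)+

lemma Hf_sort:
  "Hf (Some i) None = Hf None (Some i)"
  "Hf (Some 2) (Some 1) = Hf (Some 1) (Some 2)"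
  "Hf (Some 3) (Some 1) = Hf (Some 1) (Some 3)"
  "Hf (Some 3) (Some 2) = Hf (Some 2) (Some 3)"
  by (rule Hf_sym)+

lemma Sf_swap:
  "Sf a b c d = Sf b a c d
   - \<kappa> * (Hf d a * Yf a * (Yf b * Df b c) - Hf d b * Yf b * (Yf a * Df a c))
   - \<kappa> * (Hf c a * Yf a * (Yf b * Df b d) - Hf c b * Yf b * (Yf a * Df a d))"
  using Sf_commute[of a b c d] by simp

lemma YD [simp]: "Yf None = 0" "Yf (Some i) = 1" "Df a a = 1" "Df None (Some i) = 0" "Df (Some i) None = 0"
  "Df (Some 1) (Some 2) = 0" "Df (Some 1) (Some 3) = 0" "Df (Some 2) (Some 1) = 0" "Df (Some 2) (Some 3) = 0"
  "Df (Some 3) (Some 1) = 0" "Df (Some 3) (Some 2) = 0"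
  by (simp_all add: Yf_def Df_def)

text \<open>Instances of the commutation rule that move the smaller first index to the front, with
  \<open>None\<close> the smallest. As rewrite rules they terminate and leave only corrections in
  \<kappa> times \<open>Hf\<close>.\<close>

lemmas Sf_swaps = Sf_swap[of "Some i" None for i] Sf_swap[of "Some 2" "Some 1"] Sf_swap[of "Some 3" "Some 1"] Sf_swap[of "Some 3" "Some 2"]

text \<open>Here \<open>star_f\<close> stands for the covariant derivative of star d\<alpha>,
  \<open>cov_w\<close> for that of the 1-form in the first formula, and \<open>cov_v\<close> for
  that of the two terms which the second formula adds: minus the divergence of h and half the
  differential of its trace.\<close>

definition "star_f a b = (\<Sum>r\<in>UNIV. \<Sum>s\<in>UNIV. (Sf (Some a) (Some r) None (Some s) - Sf (Some a) (Some s) None (Some r)) * levi3 r s b) / 2"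
definition "cov_w a b = - Sf (Some a) (Some b) None None / 2 + Sf (Some a) None None (Some b) - star_f a b"
definition "cov_v a b = (\<Sum>c\<in>UNIV. Sf (Some a) (Some b) (Some c) (Some c)) / 2 - (\<Sum>c\<in>UNIV. Sf (Some a) (Some c) (Some c) (Some b))"
definition "kill_f T a b = T a b + T b a - 2 / 3 * (\<Sum>c\<in>UNIV. T c c) * De a b"
definition "tf_f T a b = T a b - (\<Sum>c\<in>UNIV. T c c) / 3 * De a b"
definition "dslash_f a b =
   ((\<Sum>k\<in>UNIV. \<Sum>l\<in>UNIV. levi3 a k l * (Sf (Some k) None (Some l) (Some b) - Sf (Some l) None (Some k) (Some b)))
   + (\<Sum>k\<in>UNIV. \<Sum>l\<in>UNIV. levi3 b k l * (Sf (Some k) None (Some l) (Some a) - Sf (Some l) None (Some k) (Some a)))) / 2"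
definition "lap_f a b = (\<Sum>c\<in>UNIV. Sf (Some c) (Some c) (Some a) (Some b))"

lemma De_simps [simp]: "De a a = 1" "De 1 2 = 0" "De 1 3 = 0" "De 2 1 = 0" "De 2 3 = 0" "De 3 1 = 0" "De 3 2 = 0"
  by (simp_all add: De_def)

text \<open>The second formula in frame components; both displayed formulas are reduced to
  it.\<close>

definition "rhs a b = kill_f (\<lambda>a b. cov_w a b + cov_v a b) a b / 2 - tf_f (\<lambda>a b. Sf None None (Some a) (Some b)) a b / 2
  - \<kappa> * tf_f (\<lambda>a b. Hf (Some a) (Some b)) a b + tf_f lap_f a b / 2 + dslash_f a b / 2"

lemma Rf_pair: "Rf a b c d = Rf c d a b"
proof -
  have "(\<lambda>i j k l. V.riem_var X k l i j) = V.riem_var X"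
    by (intro ext) (rule V.riem_var_pair[OF X])
  then show ?thesis using fr4_perms(5)[of E "V.riem_var X" a b c d] by (simp only: Rf_def)
qed

lemma Rf_anti: "Rf a b c d = - Rf b a c d"
proof -
  have "(\<lambda>i j k l. - V.riem_var X j i k l) = V.riem_var X"
    by (intro ext) (rule V.riem_var_antisym[OF X, symmetric])
  then show ?thesis
    using fr4_linear(3)[of E "\<lambda>i j k l. V.riem_var X j i k l" a b c d] fr4_swap12[of E "V.riem_var X" a b c d]
    by (simp only: Rf_def)
qed

lemma Rf_anti': "Rf a b c d = - Rf a b d c"
  using Rf_pair[of a b c d] Rf_anti[of c d a b] Rf_pair[of d c a b] by simp

lemma Wf_anti: "Wf a b c d = - Wf b a c d" "Wf a b c d = - Wf a b d c"
  using Rf_anti[of a b c d] Rf_anti'[of a b c d] by (simp_all add: Wf_eq field_simps)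

lemma Wf_diag: "Wf a a c d = 0" "Wf a b c c = 0"
  using Wf_anti(1)[of a a c d] Wf_anti(2)[of a b c c] by simp_all

text \<open>Pairs of indices of Y are brought to the order (1,2), (2,3), (3,1), in which the star of
  a coframe element has component +1.\<close>

lemma Wf_sort:
  "Wf (Some i) None c d = - Wf None (Some i) c d" "Wf a b (Some i) None = - Wf a b None (Some i)"
  "Wf (Some 2) (Some 1) c d = - Wf (Some 1) (Some 2) c d" "Wf a b (Some 2) (Some 1) = - Wf a b (Some 1) (Some 2)"
  "Wf (Some 1) (Some 3) c d = - Wf (Some 3) (Some 1) c d" "Wf a b (Some 1) (Some 3) = - Wf a b (Some 3) (Some 1)"
  "Wf (Some 3) (Some 2) c d = - Wf (Some 2) (Some 3) c d" "Wf a b (Some 3) (Some 2) = - Wf a b (Some 2) (Some 3)"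
  by (rule Wf_anti)+

lemma Rf_diag: "Rf a a c d = 0" "Rf a b c c = 0"
  using Rf_anti[of a a c d] Rf_anti'[of a b c c] by simp_all

lemma Rf_sort:
  "Rf (Some i) None c d = - Rf None (Some i) c d" "Rf a b (Some i) None = - Rf a b None (Some i)"
  "Rf (Some 2) (Some 1) c d = - Rf (Some 1) (Some 2) c d" "Rf a b (Some 2) (Some 1) = - Rf a b (Some 1) (Some 2)"
  "Rf (Some 1) (Some 3) c d = - Rf (Some 3) (Some 1) c d" "Rf a b (Some 1) (Some 3) = - Rf a b (Some 3) (Some 1)"
  "Rf (Some 3) (Some 2) c d = - Rf (Some 2) (Some 3) c d" "Rf a b (Some 3) (Some 2) = - Rf a b (Some 2) (Some 3)"
  by (rule Rf_anti Rf_anti')+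

text \<open>The cyclic successor: i, \<open>nx i\<close>, \<open>nx (nx i)\<close> are positively
  oriented, so the star of the i-th coframe element is the wedge product of the other two in this
  order.\<close>

definition nx :: "3 \<Rightarrow> 3" where "nx i = (if i = 1 then 2 else if i = 2 then 3 else 1)"

lemma nx_simps [simp]: "nx 1 = 2" "nx 2 = 3" "nx 3 = 1"
  by (simp_all add: nx_def)

text \<open>Each form has four nonzero components, in two antisymmetric pairs. The sixteen products
  fall into four groups of equal terms, which absorbs the factor 1/4.\<close>

lemma asd_weyl_pairing_cyclic: "form_inner G (Weyl_dir i) (\<omega> j) =
   Wf None (Some j) None (Some i) - Wf None (Some j) (Some (nx i)) (Some (nx (nx i)))
   - Wf (Some (nx j)) (Some (nx (nx j))) None (Some i) + Wf (Some (nx j)) (Some (nx (nx j))) (Some (nx i)) (Some (nx (nx i)))"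
  unfolding asd_weyl_pairing
  using exhaust_3[of i] exhaust_3[of j]
  by (elim disjE; simp add: sum_option_3 basis_form_def Wf_sort Wf_diag)

text \<open>Both sides are linear in \<open>Sf\<close> and in \<kappa> times \<open>Hf\<close>; once
  the derivatives are sorted, the coefficients agree for each of the nine pairs of indices.\<close>

lemma asd_weyl_eq_rhs: "form_inner G (Weyl_dir i) (\<omega> j) = rhs i j"
proof -
  note step1 = scal_eq Ric_eq sum_option_3 Rf_sort Rf_diag
  note step2 = rhs_def kill_f_def cov_w_def cov_v_def star_f_def tf_f_def lap_f_def dslash_f_def sum_3
  note step3 = Sf_sort Hf_sort Sf_swaps
  show ?thesis
    unfolding asd_weyl_pairing_cyclic Wf_eq
    using exhaust_3[of i] exhaust_3[of j]
    \<comment> \<open>Antisymmetry is applied while the terms are still curvature components, which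
      keeps them few; the commutators come after the expansion of both sides.\<close>
    by (elim disjE; simp add: step1; simp add: Rf_eq; simp add: step2; simp add: step3; simp add: field_simps)
qed

section \<open>The linearized traceless Ricci tensor of Y\<close>

definition "Qf a b c d = \<kappa> * (Hf (Some c) (Some a) * De b d - Hf (Some c) (Some b) * De a d)
   + (Sf (Some a) (Some b) (Some d) (Some c) + Sf (Some a) (Some d) (Some b) (Some c) - Sf (Some a) (Some c) (Some b) (Some d)) / 2
   - (Sf (Some b) (Some a) (Some d) (Some c) + Sf (Some b) (Some d) (Some a) (Some c) - Sf (Some b) (Some c) (Some a) (Some d)) / 2"

text \<open>The passage from the Riemann tensor to its traces, now in dimension three: the
  background has Ricci tensor \<open>2 * \<kappa>\<close> times the metric and scalar curvature
  \<open>6 * \<kappa>\<close>, and the trace part is a third.\<close>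

definition "ricY a b = (\<Sum>c\<in>UNIV. Qf a c b c)
   - (\<Sum>r\<in>UNIV. \<Sum>s\<in>UNIV. Hf (Some r) (Some s) * (\<kappa> * (De a b * De r s - De a s * De r b)))"

definition "scalY = (\<Sum>a\<in>UNIV. ricY a a) - (\<Sum>r\<in>UNIV. \<Sum>s\<in>UNIV. Hf (Some r) (Some s) * (2 * \<kappa> * De r s))"

definition "tricY a b = ricY a b - (scalY * De a b + 6 * \<kappa> * Hf (Some a) (Some b)) / 3"

text \<open>The explicit form of E'(h). Substituting it turns the first formula of the theorem into
  the second.\<close>

lemma tricY_eq: "tricY a b = - kill_f cov_v a b / 2 + \<kappa> * tf_f (\<lambda>a b. Hf (Some a) (Some b)) a b - tf_f lap_f a b / 2"
proof -
  note step1 = tricY_def scalY_def ricY_def Qf_def sum_3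
  note step2 = kill_f_def cov_v_def tf_f_def lap_f_def sum_3
  note step3 = Sf_sort Hf_sort Sf_swaps
  show ?thesis
    using exhaust_3[of a] exhaust_3[of b]
    by (elim disjE; simp add: step1; simp add: step2; simp add: step3; simp add: field_simps)
qed


lemma curv_term_Y: "(\<Sum>m\<in>UNIV. T m * curv_endo g x i j l m) = \<kappa> * (T i * g x $ j $ l - T j * g x $ i $ l)"
proof -
  have *: "T m * (\<kappa> * ((if m = i then 1 else 0) * p)) = (if m = i then \<kappa> * (T i * p) else 0)" for m i p
    by auto
  show ?thesis by (simp add: curv_endo_x * sum_subtractf right_diff_distrib)
qed

lemma frame_riemann: "fr4 e (riemann g x) a b c d = \<kappa> * (De a c * De b d - De a d * De b c)"
  unfolding riemann_x[abs_def] fr4_linear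
    fr4_prods(1)[of e "\<lambda>i k. g x $ i $ k" "\<lambda>j l. g x $ j $ l"]
    fr4_prods(2)[of e "\<lambda>i l. g x $ i $ l" "\<lambda>j k. g x $ j $ k"] fr2_g ..

text \<open>The general linearization is applied a second time, to the metric of Y at fixed t. Its
  second covariant derivatives are the components of \<open>N2\<close> without an index
  \<open>None\<close>, so the result is again expressed by \<open>Sf\<close> and
  \<open>Hf\<close>.\<close>

lemma frame_traceless_ricci:
  defines "h \<equiv> partYY H t"
  obtains E' where "has_linearization (\<lambda>g'. traceless_ricci g' x) g h E'"
    and "\<And>a b. fr2 e (\<lambda>i j. E' $ i $ j) a b = tricY a b"
proof -
  interpret Y: metric_variation g h S unfolding h_def by (rule metric_variation_partYY)
  let ?M = "\<lambda>i j k l. N2 X (Some i) (Some j) (Some k) (Some l)"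
  have h: "fr2 e (\<lambda>i j. h x $ i $ j) a b = Hf (Some a) (Some b)" for a b
    unfolding h_def by (rule frame_parts)
  have h': "fr2 e (\<lambda>i k. h x $ k $ i) a c = Hf (Some c) (Some a)" for a c
    using fr2_swap[of e "\<lambda>k i. h x $ k $ i" a c] by (simp only: h)
  have Q: "fr4 e (Y.riem_var x) a b c d = Qf a b c d" for a b c d
    unfolding Y.riem_var_def[abs_def] Y.riem_var_def curv_term_Y Qf_def cov3_partYY[OF x, where t = t, folded h_def] fr4_linear
      fr4_prods(1)[of e "\<lambda>i k. h x $ k $ i" "\<lambda>j l. g x $ j $ l"] fr4_prods(3)[of e "\<lambda>j k. h x $ k $ j" "\<lambda>i l. g x $ i $ l"]
      fr2_g h' fr4_swap34[of e ?M] fr4_swap23[of e ?M] fr4_swap12[of e ?M] fr4_perms[of e ?M] frame_parts ..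
  have ric: "fr2 e (Y.ric_var x) a b = ricY a b" for a b
  proof -
    have 1: "fr2 e (\<lambda>i j. \<Sum>k\<in>UNIV. \<Sum>l\<in>UNIV. matrix_inv (g x) $ k $ l * Y.riem_var x i k j l) a b = (\<Sum>c\<in>UNIV. Qf a c b c)"
      using frame_contract_12[OF frame_e, of "\<lambda>k l i j. Y.riem_var x i k j l"] fr4_perms(6)[of e "Y.riem_var x"]
      by (simp only: Q)
    have "(\<lambda>i j. \<Sum>c\<in>UNIV. \<Sum>d\<in>UNIV. Y.inv_var x c d * riemann g x i c j d) =
      (\<lambda>i j. \<Sum>r\<in>UNIV. \<Sum>s\<in>UNIV. Hf (Some r) (Some s) * fr2 e (\<lambda>c d. riemann g x i c j d) r s)"
      unfolding Y.inv_var_def frame_contract_raised[OF frame_e, of "\<lambda>p q. h x $ p $ q" "\<lambda>c d. riemann g x i c j d" for i j] h ..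
    then have "fr2 e (\<lambda>i j. \<Sum>c\<in>UNIV. \<Sum>d\<in>UNIV. Y.inv_var x c d * riemann g x i c j d) a b =
      (\<Sum>r\<in>UNIV. \<Sum>s\<in>UNIV. Hf (Some r) (Some s) * fr4 e (\<lambda>i j c d. riemann g x i c j d) a b r s)"
      by (simp only: fr2_sum fr2_linear fr4_nested)
    then have 2: "fr2 e (\<lambda>i j. \<Sum>c\<in>UNIV. \<Sum>d\<in>UNIV. Y.inv_var x c d * riemann g x i c j d) a b =
      (\<Sum>r\<in>UNIV. \<Sum>s\<in>UNIV. Hf (Some r) (Some s) * fr4 e (riemann g x) a r b s)"
      by (simp only: fr4_swap23[of e "riemann g x"])
    show ?thesis
      unfolding Y.ric_var_def[abs_def] fr2_linear 1 2 frame_riemann ricY_def ..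
  qed
  have scal: "Y.scal_var x = scalY"
    unfolding Y.scal_var_def Y.inv_var_def frame_contract_raised[OF frame_e, of "\<lambda>p q. h x $ p $ q"]
      frame_contract_e ricci_x fr2_linear fr2_g ric h scalY_def ..
  show thesis
  proof (rule that[OF Y.has_linearization_traceless_ricci[OF x]])
    fix a b
    show "fr2 e (\<lambda>i j. (\<chi> a b. Y.ric_var x a b - (Y.scal_var x * g x $ a $ b + scalar_curvature g x * h x $ a $ b) / real CARD(3)) $ i $ j) a b = tricY a b"
      by (simp add: fr2_linear ric scal scalar_x fr2_g h tricY_def)
  qed
qed

lemma diff_d0_part00: "d0 (part00 H t) differentiable at x"
proof (rule differentiable_cong_open[OF open_S x d0_part00[symmetric]])
  show "(\<lambda>y. \<chi> k. N (cyl_point t y) (Some k) None None) differentiable at x"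
    by (intro differentiable_vecI) (simp add: diff_N_slice[OF x])
qed

lemma diff_dot_part0Y: "dot (part0Y H) t differentiable at x"
proof (rule differentiable_cong_open[OF open_S x dot_part0Y[symmetric]])
  show "(\<lambda>y. \<chi> k. N (cyl_point t y) None None (Some k)) differentiable at x"
    by (intro differentiable_vecI) (simp add: diff_N_slice[OF x])
qed

lemma diff_star2_d1: "(\<lambda>y. star2 (g y) (d1 (part0Y H t) y)) differentiable at x"
proof -
  interpret g3: local_metric_3 g S ..
  show ?thesis by (rule g3.diff_star2[OF x oriented_orthonormal_det(1)[OF oe] diff_d1_part0Y])
qed

lemmas diff_1forms = diff_d0_part00 diff_dot_part0Y diff_star2_d1
  metric_variation.diff_div2[OF metric_variation_partYY x]
  metric_variation.diff_d0_mtrace[OF metric_variation_partYY x]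

lemma frame_cov_w: "fr2 e (\<lambda>i j. cov1 g (\<lambda>y. (-1/2) *\<^sub>R d0 (part00 H t) y + dot (part0Y H) t y - star2 (g y) (d1 (part0Y H t) y)) x $ i $ j) a b
    = cov_w a b"
  by (simp only: cov1_add cov1_diff cov1_scaleR diff_1forms differentiable_add differentiable_diff differentiable_scaleR
      differentiable_const vector_add_component vector_minus_component vector_scaleR_component real_scaleR_def
      fr2_linear frame_cov1_d0_part00 frame_cov1_dot_part0Y frame_cov1_star2 cov_w_def star_f_def)

lemma frame_cov_wv: "fr2 e (\<lambda>i j. cov1 g (\<lambda>y. (-1/2) *\<^sub>R d0 (part00 H t) y - div2 g (partYY H t) y + dot (part0Y H) t y
      - star2 (g y) (d1 (part0Y H t) y) + (1/2) *\<^sub>R d0 (\<lambda>z. mtrace (g z) (partYY H t z)) y) x $ i $ j) a b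
    = cov_w a b + cov_v a b"
  by (simp only: cov1_add cov1_diff cov1_scaleR diff_1forms differentiable_add differentiable_diff differentiable_scaleR
      differentiable_const vector_add_component vector_minus_component vector_scaleR_component real_scaleR_def
      fr2_linear frame_cov1_d0_part00 frame_cov1_dot_part0Y frame_cov1_star2 frame_cov1_div2 frame_cov1_d0_mtrace
      cov_w_def cov_v_def star_f_def)

section \<open>Assembly of the two formulas\<close>

lemma has_linearization_asd_weyl:
  "has_linearization (asd_weyl_frame g t x e) (cyl_metric g) H (\<chi> a b. rhs a b)"
proof -
  have "((\<lambda>s. \<chi> i j. form_inner G (asd_weyl_operator (V.metric_at s) X (\<omega> i)) (\<omega> j)) has_vector_derivative (\<chi> a b. rhs a b)) (at 0)"
    using has_derivative_asd_weyl unfolding asd_weyl_eq_rhs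
    by (intro has_vector_derivative_vec_lambda) (simp add: has_real_derivative_iff_has_vector_derivative)
  then show ?thesis
    by (simp add: has_linearization_def asd_weyl_frame_def V.metric_at_def)
qed

lemma rhs_eq:
  "rhs a b = (frame_comp e
       ((1/2) *\<^sub>R conformal_killing g
          (\<lambda>y. (-1/2) *\<^sub>R d0 (part00 H t) y - div2 g (partYY H t) y + dot (part0Y H) t y
                - star2 (g y) (d1 (part0Y H t) y)
                + (1/2) *\<^sub>R d0 (\<lambda>z. mtrace (g z) (partYY H t z)) y) x
        - (1/2) *\<^sub>R tf (g x) (dot (dot (partYY H)) t x)
        - \<kappa> *\<^sub>R tf (g x) (partYY H t x)
        + (1/2) *\<^sub>R rough_laplacian g (\<lambda>y. tf (g y) (partYY H t y)) x)
     + (1/2) *\<^sub>R dslash_frame g (dot (partYY H) t) x e) $ a $ b"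
proof -
  \<comment> \<open>The Laplacian of the trace is the trace of the Laplacian; the two sums come in
    opposite order.\<close>
  have "(\<Sum>c\<in>UNIV. \<Sum>d\<in>UNIV. Sf (Some c) (Some c) (Some d) (Some d)) = (\<Sum>c\<in>UNIV. lap_f c c)"
    unfolding lap_f_def by (rule sum.swap)
  then show ?thesis
    by (simp only: frame_comp_fr2 vec_lambda_beta vector_add_component vector_minus_component vector_scaleR_component
        real_scaleR_def fr2_linear frame_comp_killing frame_cov_wv frame_comp_tf frame_comp_laplacian dslash_eq
        dot_dot_partYY[OF x] frame_parts)
       (simp add: rhs_def kill_f_def tf_f_def dslash_f_def lap_f_def)
qed

text \<open>By linearity of \<open>kill_f\<close>, the part \<open>cov_v\<close> of
  \<open>rhs\<close> together with the terms in \<kappa> and in the Laplacian is minus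
  \<open>tricY\<close>.\<close>

lemma rhs_eq_traceless_ricci:
  assumes "\<And>a b. fr2 e (\<lambda>i j. E' $ i $ j) a b = tricY a b"
  shows "rhs a b = (frame_comp e
       ((1/2) *\<^sub>R conformal_killing g
          (\<lambda>y. (-1/2) *\<^sub>R d0 (part00 H t) y + dot (part0Y H) t y - star2 (g y) (d1 (part0Y H t) y)) x
        - (1/2) *\<^sub>R tf (g x) (dot (dot (partYY H)) t x)
        - E')
     + (1/2) *\<^sub>R dslash_frame g (dot (partYY H) t) x e) $ a $ b"
  by (simp only: frame_comp_fr2 vec_lambda_beta vector_add_component vector_minus_component vector_scaleR_component
      real_scaleR_def fr2_linear frame_comp_killing frame_cov_w frame_comp_tf dslash_eq assms tricY_eq
      dot_dot_partYY[OF x] frame_parts rhs_def)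
     (simp add: kill_f_def tf_f_def dslash_f_def sum.distrib field_simps)

end

section \<open>Charts\<close>

lemma chart_image_cyl: "chart_image (cyl_chart c) = cyl_set (chart_image c)"
proof
  show "chart_image (cyl_chart c) \<subseteq> cyl_set (chart_image c)"
    by (auto simp: chart_image_def cyl_chart_def)
  show "cyl_set (chart_image c) \<subseteq> chart_image (cyl_chart c)"
  proof
    fix X assume "X \<in> cyl_set (chart_image c)"
    then obtain p where p: "p \<in> fst c" "cyl_proj X = snd c p" by (auto simp: cyl_set_def chart_image_def)
    have "X = cyl_point (X $ None) (snd c p)"
      by (simp add: vec_eq_iff forall_option p(2)[symmetric]) (simp add: cyl_proj_def)
    then have "X = snd (cyl_chart c) (X $ None, p)" "(X $ None, p) \<in> fst (cyl_chart c)"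
      using p by (simp_all add: cyl_chart_def)
    then show "X \<in> chart_image (cyl_chart c)"
      unfolding chart_image_def by (rule image_eqI)
  qed
qed

lemma symmetric_2tensor_C2_field:
  assumes "symmetric_2tensor A T" "c \<in> A" "open (chart_image c)"
  shows "C2_field (T c) (chart_image c)"
proof
  have "smooth_on (chart_image c) (T c)" using assms by (simp add: symmetric_2tensor_def)
  with assms(3) show "C2_on (chart_image c) (\<lambda>y. T c y $ i $ j)" for i j by (rule smooth_on_imp_C2_on)
  show "T c y $ i $ j = T c y $ j $ i" if "y \<in> chart_image c" for y i j
  proof -
    have "transpose (T c y) = T c y" using assms that by (simp add: symmetric_2tensor_def)
    then have "transpose (T c y) $ i $ j = T c y $ i $ j" by simp
    then show ?thesis by (simp add: transpose_def)
  qed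
qed (rule assms)

lemma riemannian_metric_local_metric:
  assumes "riemannian_metric A g" "c \<in> A" "open (chart_image c)"
  shows "local_metric (g c) (chart_image c)"
proof (intro local_metric.intro local_metric_axioms.intro)
  show "C2_field (g c) (chart_image c)"
    using assms by (intro symmetric_2tensor_C2_field) (simp_all add: riemannian_metric_def)
  show "det (g c y) \<noteq> 0" if "y \<in> chart_image c" for y
  proof
    assume "det (g c y) = 0"
    then obtain v where "v \<noteq> 0" "g c y *v v = 0"
      by (metis invertible_det_nz invertible_left_inverse matrix_left_invertible_ker)
    moreover have "v \<noteq> 0 \<longrightarrow> v \<bullet> (g c y *v v) > 0"
      using assms that by (simp add: riemannian_metric_def)
    ultimately show False by simp
  qed
qed

theorem theorem3p3:
  fixes A :: "('y::t2_space, 3) chart set"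
    and gY :: "('y, 3) chart \<Rightarrow> real^3 \<Rightarrow> real^3^3"
    and \<kappa> :: real
    and ht :: "(real \<times> 'y, 3 option) chart \<Rightarrow> real^(3 option) \<Rightarrow> real^(3 option)^(3 option)"
  assumes "compact (UNIV :: 'y set)"
    and "oriented_atlas A"
    and "riemannian_metric A gY"
    and "\<kappa> \<in> {1, 0, -1}"
    and "constant_curvature A gY \<kappa>"
    and "symmetric_2tensor (cyl_atlas A) ht"
    and "\<And>c X. c \<in> A \<Longrightarrow> X \<in> chart_image (cyl_chart c) \<Longrightarrow>
           mtrace (cyl_metric (gY c) X) (ht (cyl_chart c) X) = 0"
  shows "\<forall>c\<in>A. \<forall>t. \<forall>x\<in>chart_image c. \<forall>e. oriented_orthonormal (gY c x) e \<longrightarrow>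
    (let g = gY c;
         H = ht (cyl_chart c);
         h00 = part00 H;
         \<alpha> = part0Y H;
         h = partYY H;
         E' = linearization (\<lambda>g'. traceless_ricci g' x) g (h t)
     in has_linearization (\<lambda>g'. traceless_ricci g' x) g (h t) E' \<and>
        has_linearization (asd_weyl_frame g t x e) (cyl_metric g) H
          (frame_comp e
             ((1/2) *\<^sub>R conformal_killing g
                (\<lambda>y. (-1/2) *\<^sub>R d0 (h00 t) y + dot \<alpha> t y - star2 (g y) (d1 (\<alpha> t) y)) x
              - (1/2) *\<^sub>R tf (g x) (dot (dot h) t x)
              - E')
           + (1/2) *\<^sub>R dslash_frame g (dot h t) x e) \<and>
        has_linearization (asd_weyl_frame g t x e) (cyl_metric g) H
          (frame_comp e
             ((1/2) *\<^sub>R conformal_killing g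
                (\<lambda>y. (-1/2) *\<^sub>R d0 (h00 t) y - div2 g (h t) y + dot \<alpha> t y
                      - star2 (g y) (d1 (\<alpha> t) y)
                      + (1/2) *\<^sub>R d0 (\<lambda>z. mtrace (g z) (h t z)) y) x
              - (1/2) *\<^sub>R tf (g x) (dot (dot h) t x)
              - \<kappa> *\<^sub>R tf (g x) (h t x)
              + (1/2) *\<^sub>R rough_laplacian g (\<lambda>y. tf (g y) (h t y)) x)
           + (1/2) *\<^sub>R dslash_frame g (dot h t) x e))"
proof (intro ballI allI impI, goal_cases)
  case (1 c t x e)
  then have c: "c \<in> A" and x: "x \<in> chart_image c" and e: "oriented_orthonormal (gY c x) e" by simp_all
  let ?g = "gY c" and ?H = "ht (cyl_chart c)" and ?S = "chart_image c"
  have o: "open ?S" using assms(2) c by (simp add: oriented_atlas_def is_chart_def)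
  interpret g: local_metric ?g ?S
    by (rule riemannian_metric_local_metric[OF assms(3) c o])
  have "cyl_chart c \<in> cyl_atlas A" using c by (simp add: cyl_atlas_def)
  then have H: "C2_field ?H (cyl_set ?S)"
    using symmetric_2tensor_C2_field[OF assms(6), of "cyl_chart c"] open_cyl_set[OF o] by (simp add: chart_image_cyl)
  have "const_curv_at ?g x \<kappa>"
  proof (rule g.const_curv_atI[OF x])
    show "v \<bullet> (?g x *v v) > 0" if "v \<noteq> 0" for v
      using assms(3) c x that by (simp add: riemannian_metric_def)
    show "sectional_curvature ?g x u v = \<kappa>" if "u \<noteq> v" "independent {u, v}" for u v
      using assms(5) c x that by (simp add: constant_curvature_def)
  qed
  then interpret frame_point ?g ?S ?H x t \<kappa> e
    by (intro frame_point.intro cyl_variation.intro cylinder.intro g.local_metric_axioms H frame_point_axioms.intro x e)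
  obtain E' where E': "has_linearization (\<lambda>g'. traceless_ricci g' x) ?g (partYY ?H t) E'"
    and fr: "\<And>a b. fr2 e (\<lambda>i j. E' $ i $ j) a b = tricY a b"
    using frame_traceless_ricci by blast
  \<comment> \<open>\<open>linearization\<close> denotes a chosen derivative; as a derivative
    exists, it is this one by uniqueness.\<close>
  have lin: "linearization (\<lambda>g'. traceless_ricci g' x) ?g (partYY ?H t) = E'"
    using E' by (simp add: has_linearization_def linearization_def vector_derivative_at)
  have M: "(\<chi> a b. rhs a b) = B" if "\<And>a b. rhs a b = B $ a $ b" for B :: "real^3^3"
    by (simp add: vec_eq_iff that)
  show ?case
    unfolding Let_def lin
    using E' has_linearization_asd_weyl[unfolded M[OF rhs_eq_traceless_ricci[OF fr]]]
      has_linearization_asd_weyl[unfolded M[OF rhs_eq]]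
    by (intro conjI)
qed

end
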